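(* For $k,\ell\to\infty$ the number $|\mathcal{S}(G^*_{k,\ell})|$ of Schnyder woods of the augmented grid $G^*_{k,\ell}$ is asymptotically $|\mathcal{S}(G^*_{k,\ell})|\approx 3.209^{k\ell}$; that is, the limit $\lim_{k,\ell\to\infty}|\mathcal{S}(G^*_{k,\ell})|^{1/(k\ell)}$ exists and its decimal expansion begins $3.209$.
   Context: Grid: $G_{k,\ell}$ has vertex set $\{(i,j): 1\le i\le k,\ 1\le j\le \ell\}$, horizontal edges $\{(i,j),(i,j+1)\}$ and vertical edges $\{(i,j),(i+1,j)\}$, drawn in the usual way with row $1$ at the top and column $1$ at the left. The augmented grid $G^*_{k,\ell}$ is the planar map obtained from $G_{k,\ell}$ by adding a triangle with vertices $a_1,a_2,a_3$ (in clockwise order) to the outer face, enclosing the grid, where $a_1$ is made adjacent to all vertices $(1,j)$ of the first row, $a_2$ to all vertices $(i,\ell)$ of the last column, and $a_3$ to all vertices of the last row $(k,j)$ and of the first column $(i,1)$. The special vertices are $a_1,a_2,a_3$. Schnyder woods: Let $M$ be a planar map with three special vertices $a_1,a_2,a_3$ occurring in clockwise order on the outer face. The suspension $M^\sigma$ is obtained by attaching to each $a_i$ a half-edge reaching into the outer face. A Schnyder wood of $M$ rooted at $a_1,a_2,a_3$ is an orientation and coloring of the edges of $M^\sigma$ with the colors $1,2,3$ (indices cyclic modulo 3) such that: (W1) every edge is oriented in one direction or in two opposite directions; if an edge is bidirected, the two directions have distinct colors. (W2) The half-edge at $a_i$ is directed outwards and has color $i$. (W3) Every vertex $v$ has out-degree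 one in each color; the edges $e_1,e_2,e_3$ leaving $v$ in colors $1,2,3$ occur in clockwise order; each edge entering $v$ in color $i$ enters $v$ in the clockwise sector from $e_{i+1}$ to $e_{i-1}$. (W4) There is no interior face whose boundary is a monochromatic directed cycle. $\mathcal{S}(M)$ denotes the set of Schnyder woods of $M$. *)

theory Defs
  imports "HOL-Analysis.Analysis" "HOL-Combinatorics.Cycles" "HOL-Combinatorics.Orbits"
begin

text \<open>
  A plane drawing is represented by its rotation system.  Every edge \<open>{u, v}\<close> consists of two
  darts \<open>d\<close> and \<open>rev d\<close>, one based at each end; a dart \<open>d\<close> also stands for the direction of its
  edge that leaves \<open>org d\<close>.  The permutation \<open>cw\<close> sends a dart to the clockwise next dart
  at the same vertex.
\<close>

record ('v, 'd) plane_map =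
  verts :: "'v set"
  darts :: "'d set"
  org :: "'d \<Rightarrow> 'v"
  rev_dart :: "'d \<Rightarrow> 'd"
  cw :: "'d \<Rightarrow> 'd"

text \<open>
  For a dart \<open>d\<close> from \<open>u\<close> to \<open>v\<close>, the clockwise successor at \<open>v\<close> of the dart back to \<open>u\<close> is the
  next dart on the boundary of the face to the left of \<open>d\<close>.  So interior faces are traversed
  counterclockwise and the outer face is traversed clockwise.
\<close>

definition face_succ :: "('v, 'd) plane_map \<Rightarrow> 'd \<Rightarrow> 'd" where
  "face_succ M d = cw M (rev_dart M d)"

definition faces :: "('v, 'd) plane_map \<Rightarrow> 'd set set" where
  "faces M = orbit (face_succ M) ` darts M"

text \<open>
  The colors (and the indices of the special vertices) are the elements of the type \<open>3\<close>, whose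
  arithmetic is modulo 3; the color 3 is the element \<open>3 = 0\<close>.

  The special vertices and the outer face are given by three root darts: \<open>r i\<close> is the dart
  based at \<open>a\<^sub>i\<close> that leaves \<open>a\<^sub>i\<close> along the outer face traversed clockwise.  This fixes the
  corner of the outer face at \<open>a\<^sub>i\<close> into which the half-edge of the suspension is inserted:
  immediately before \<open>r i\<close> in the clockwise order around \<open>a\<^sub>i\<close>.  The three root darts lie on
  the same face cycle, so that any of them (here \<open>r 1\<close>) determines the outer face.
\<close>

definition interior_faces :: "('v, 'd) plane_map \<Rightarrow> (3 \<Rightarrow> 'd) \<Rightarrow> 'd set set" where
  "interior_faces M r = faces M - {orbit (face_succ M) (r 1)}"

datatype 'd susp_dart = Dart 'd | Half_Edge 3

definition susp_darts :: "('v, 'd) plane_map \<Rightarrow> 'd susp_dart set" where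
  "susp_darts M = Dart ` darts M \<union> range Half_Edge"

fun susp_org :: "('v, 'd) plane_map \<Rightarrow> (3 \<Rightarrow> 'd) \<Rightarrow> 'd susp_dart \<Rightarrow> 'v" where
  "susp_org M r (Dart d) = org M d"
| "susp_org M r (Half_Edge i) = org M (r i)"

fun susp_cw :: "('v, 'd) plane_map \<Rightarrow> (3 \<Rightarrow> 'd) \<Rightarrow> 'd susp_dart \<Rightarrow> 'd susp_dart" where
  "susp_cw M r (Dart d) =
     (if cw M d \<in> range r then Half_Edge (THE i. r i = cw M d) else Dart (cw M d))"
| "susp_cw M r (Half_Edge i) = Dart (r i)"

text \<open>
  \<open>funpow_dist (susp_cw M r) x y\<close> is the number of clockwise steps from \<open>x\<close> to \<open>y\<close>.
  Sectors are closed, as bidirected edges require: an edge entering in color \<open>i\<close> may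
  coincide with \<open>e\<^sub>i\<^sub>+\<^sub>1\<close> or \<open>e\<^sub>i\<^sub>-\<^sub>1\<close>.
\<close>

definition clockwise :: "('v, 'd) plane_map \<Rightarrow> (3 \<Rightarrow> 'd) \<Rightarrow>
    'd susp_dart \<Rightarrow> 'd susp_dart \<Rightarrow> 'd susp_dart \<Rightarrow> bool" where
  "clockwise M r x y z \<longleftrightarrow>
     0 < funpow_dist (susp_cw M r) x y \<and>
     funpow_dist (susp_cw M r) x y < funpow_dist (susp_cw M r) x z"

definition in_cw_sector :: "('v, 'd) plane_map \<Rightarrow> (3 \<Rightarrow> 'd) \<Rightarrow>
    'd susp_dart \<Rightarrow> 'd susp_dart \<Rightarrow> 'd susp_dart \<Rightarrow> bool" where
  "in_cw_sector M r x y z \<longleftrightarrow>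
     funpow_dist (susp_cw M r) x y \<le> funpow_dist (susp_cw M r) x z"

text \<open>
  An orientation and coloring \<open>w\<close> assigns to a dart \<open>d\<close> the color \<open>Some c\<close> if its edge is
  oriented away from \<open>org d\<close> with color \<open>c\<close> in that direction, and \<open>None\<close> if its edge is
  not oriented in this direction.  A half-edge has a single dart, directed outwards.
  The condition on the domain makes \<open>w\<close> determined by its values on the suspension, so that
  Schnyder woods can be counted.
\<close>

definition schnyder_wood ::
    "('v, 'd) plane_map \<Rightarrow> (3 \<Rightarrow> 'd) \<Rightarrow> ('d susp_dart \<rightharpoonup> 3) \<Rightarrow> bool" where
  "schnyder_wood M r w \<longleftrightarrow>
     dom w \<subseteq> susp_darts M \<and>
     \<comment> \<open>(W1)\<close>
     (\<forall>d\<in>darts M.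
        (w (Dart d) \<noteq> None \<or> w (Dart (rev_dart M d)) \<noteq> None) \<and>
        (w (Dart d) \<noteq> None \<and> w (Dart (rev_dart M d)) \<noteq> None \<longrightarrow>
           w (Dart d) \<noteq> w (Dart (rev_dart M d)))) \<and>
     \<comment> \<open>(W2)\<close>
     (\<forall>i. w (Half_Edge i) = Some i) \<and>
     \<comment> \<open>(W3)\<close>
     (\<forall>v\<in>verts M. \<exists>e :: 3 \<Rightarrow> 'd susp_dart.
        (\<forall>i. {x \<in> susp_darts M. susp_org M r x = v \<and> w x = Some i} = {e i}) \<and>
        clockwise M r (e 1) (e 2) (e 3) \<and>
        (\<forall>d\<in>darts M. \<forall>i. org M d = v \<and> w (Dart (rev_dart M d)) = Some i \<longrightarrow>
           in_cw_sector M r (e (i + 1)) (Dart d) (e (i - 1)))) \<and>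
     \<comment> \<open>(W4)\<close>
     (\<forall>F\<in>interior_faces M r. \<forall>i.
        \<not> (\<forall>d\<in>F. w (Dart d) = Some i) \<and>
        \<not> (\<forall>d\<in>F. w (Dart (rev_dart M d)) = Some i))"

definition schnyder_woods ::
    "('v, 'd) plane_map \<Rightarrow> (3 \<Rightarrow> 'd) \<Rightarrow> ('d susp_dart \<rightharpoonup> 3) set" where
  "schnyder_woods M r = {w. schnyder_wood M r w}"

datatype grid_vertex = Grid nat nat | Special 3

definition aug_grid_verts :: "nat \<Rightarrow> nat \<Rightarrow> grid_vertex set" where
  "aug_grid_verts k l = {Grid i j | i j. i \<in> {1..k} \<and> j \<in> {1..l}} \<union> range Special"

definition aug_grid_edges :: "nat \<Rightarrow> nat \<Rightarrow> grid_vertex set set" where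
  "aug_grid_edges k l =
     {{Grid i j, Grid i (j + 1)} | i j. i \<in> {1..k} \<and> j \<in> {1..<l}} \<union>
     {{Grid i j, Grid (i + 1) j} | i j. i \<in> {1..<k} \<and> j \<in> {1..l}} \<union>
     {{Special i, Special j} | i j. i \<noteq> j} \<union>
     {{Special 1, Grid 1 j} | j. j \<in> {1..l}} \<union>
     {{Special 2, Grid i l} | i. i \<in> {1..k}} \<union>
     {{Special 3, Grid k j} | j. j \<in> {1..l}} \<union>
     {{Special 3, Grid i 1} | i. i \<in> {1..k}}"

text \<open>
  The neighbors of a vertex in clockwise order in the drawing: up, right, down, left at a grid
  vertex (row 1 at the top, column 1 at the left).  At \<open>a\<^sub>1\<close> (top), \<open>a\<^sub>2\<close> (right) and \<open>a\<^sub>3\<close> (bottom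
  left), the list starts just after the outer face.  The grid vertex \<open>(k, 1)\<close> is joined to
  \<open>a\<^sub>3\<close> by a single edge, whence \<open>remdups\<close>.
\<close>

fun aug_grid_nbrs :: "nat \<Rightarrow> nat \<Rightarrow> grid_vertex \<Rightarrow> grid_vertex list" where
  "aug_grid_nbrs k l (Grid i j) = remdups
     [if i = 1 then Special 1 else Grid (i - 1) j,
      if j = l then Special 2 else Grid i (j + 1),
      if i = k then Special 3 else Grid (i + 1) j,
      if j = 1 then Special 3 else Grid i (j - 1)]"
| "aug_grid_nbrs k l (Special i) =
     (if i = 1 then
        [Special 2] @ map (\<lambda>j. Grid 1 j) (rev [1..<Suc l]) @ [Special 3]
      else if i = 2 then
        [Special 3] @ map (\<lambda>i. Grid i l) (rev [1..<Suc k]) @ [Special 1]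
      else
        [Special 1] @ map (\<lambda>i. Grid i 1) [1..<k] @ map (\<lambda>j. Grid k j) [1..<Suc l] @ [Special 2])"

definition aug_grid :: "nat \<Rightarrow> nat \<Rightarrow> (grid_vertex, grid_vertex \<times> grid_vertex) plane_map" where
  "aug_grid k l =
     \<lparr>verts = aug_grid_verts k l,
      darts = {(u, v). {u, v} \<in> aug_grid_edges k l},
      org = fst,
      rev_dart = prod.swap,
      cw = (\<lambda>(u, v). (u, cycle_of_list (aug_grid_nbrs k l u) v))\<rparr>"

definition aug_grid_root :: "3 \<Rightarrow> grid_vertex \<times> grid_vertex" where
  "aug_grid_root i = (Special i, Special (i + 1))"

text \<open>The rotation lists enumerate exactly the neighbors given by the edge set.\<close>

lemma distinct_aug_grid_nbrs: "distinct (aug_grid_nbrs k l u)"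
  by (cases u) (auto simp: distinct_map inj_on_def)

lemma set_aug_grid_nbrs:
  assumes "1 \<le> k" "1 \<le> l" "u \<in> aug_grid_verts k l"
  shows "set (aug_grid_nbrs k l u) = {v. {u, v} \<in> aug_grid_edges k l}"
proof -
  have s3: "s = 1 \<or> s = 2 \<or> s = 3" for s :: 3 by (rule exhaust_3)
  have nz: "(0::3) \<noteq> 1" "(0::3) \<noteq> 2" "(1::3) \<noteq> 2" by simp_all
  have GG: "{Grid i j, Grid i' j'} \<in> aug_grid_edges k l \<longleftrightarrow>
     i' = i \<and> i \<in> {1..k} \<and> (j' = j + 1 \<and> j \<in> {1..<l} \<or> j = j' + 1 \<and> j' \<in> {1..<l}) \<or>
     j' = j \<and> j \<in> {1..l} \<and> (i' = i + 1 \<and> i \<in> {1..<k} \<or> i = i' + 1 \<and> i' \<in> {1..<k})" for i j i' j'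
    unfolding aug_grid_edges_def by (simp add: doubleton_eq_iff) blast
  have SG: "{Special s, Grid i j} \<in> aug_grid_edges k l \<longleftrightarrow>
     s = 1 \<and> i = 1 \<and> j \<in> {1..l} \<or> s = 2 \<and> j = l \<and> i \<in> {1..k} \<or>
     s = 3 \<and> (i = k \<and> j \<in> {1..l} \<or> j = 1 \<and> i \<in> {1..k})" for s i j
    unfolding aug_grid_edges_def by (simp add: doubleton_eq_iff) blast
  have SS: "{Special s, Special t} \<in> aug_grid_edges k l \<longleftrightarrow> s \<noteq> t" for s t
    unfolding aug_grid_edges_def by (simp add: doubleton_eq_iff) blast
  have "v \<in> set (aug_grid_nbrs k l u) \<longleftrightarrow> {u, v} \<in> aug_grid_edges k l" for v
  proof (cases u)
    case u: (Grid i j)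
    then have ij: "1 \<le> i" "i \<le> k" "1 \<le> j" "j \<le> l"
      using assms by (auto simp: aug_grid_verts_def)
    show ?thesis
    proof (cases v)
      case (Grid i' j')
      have "v \<in> set (aug_grid_nbrs k l u) \<longleftrightarrow>
          (i \<noteq> 1 \<and> i' = i - 1 \<and> j' = j) \<or> (j \<noteq> l \<and> i' = i \<and> j' = j + 1) \<or>
          (i \<noteq> k \<and> i' = i + 1 \<and> j' = j) \<or> (j \<noteq> 1 \<and> i' = i \<and> j' = j - 1)"
        unfolding u Grid aug_grid_nbrs.simps set_remdups
        by (simp del: One_nat_def)
      also have "\<dots> \<longleftrightarrow> {u, v} \<in> aug_grid_edges k l"
        unfolding u Grid GG atLeastAtMost_iff atLeastLessThan_iff using ij by linarith
      finally show ?thesis .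
    next
      case (Special s)
      have "v \<in> set (aug_grid_nbrs k l u) \<longleftrightarrow>
          (i = 1 \<and> s = 1) \<or> (j = l \<and> s = 2) \<or> (i = k \<and> s = 3) \<or> (j = 1 \<and> s = 3)"
        unfolding u Special aug_grid_nbrs.simps set_remdups
        by (simp del: One_nat_def)
      also have "\<dots> \<longleftrightarrow> {u, v} \<in> aug_grid_edges k l"
        unfolding u Special insert_commute[of "Grid i j"] SG using ij by auto
      finally show ?thesis .
    qed
  next
    case u: (Special s)
    show ?thesis
    proof (cases v)
      case (Grid i j)
      show ?thesis unfolding u Grid SG using s3[of s] assms(1,2)
        by (elim disjE) (auto simp: nz image_iff)
    next
      case (Special t)
      show ?thesis unfolding u Special SS using s3[of s] s3[of t]
        by (elim disjE) (auto simp: nz)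
    qed
  qed
  then show ?thesis by blast
qed

end

theory Submission
  imports Defs "HOL-Real_Asymp.Real_Asymp" "Jordan_Normal_Form.Determinant"
begin

text \<open>
  In a Schnyder wood every vertex has out-degree 3, and in the augmented grid every grid vertex
  has degree 4, except for the bottom left one, which has degree 3.  Hence every other grid
  vertex has exactly one incident edge that does not leave it.  The edges between the grid and
  the triangle all lead into the triangle, so this missing edge goes to another grid vertex; let
  each of these vertices point along its missing edge.  These pointers form a spanning tree of the
  grid, rooted at the bottom left vertex, and the tree determines the wood.  This is a form of
  Temperley's correspondence between domino tilings and spanning trees: the inner faces choose
  edges as well, and together the vertices and faces are matched with the edges of the grid.

  The link is the labelling of the corners at the vertices with the colors: a corner carries the
  color in which an edge would have to enter through it.  Clockwise around a vertex the label
  increases by 1 at every dart except for the missing one; along one side of an edge it stays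
  equal or changes by 1.  As the changes around the four sides of a face of the grid add up to 0
  modulo 3, some side of the face has no change, and the face is matched with this edge.  A cycle of pointers is then
  excluded by infinite descent (\<open>no_hop_cycle\<close>): it would enclose a cycle of faces, which would
  enclose a cycle of vertices, and so on.  Conversely, from a spanning tree the faces get their
  edges from the dual tree (\<open>dual_orientation\<close>), the labels are recovered as a potential modulo 3
  (\<open>corner_labelling\<close>), and the labels give the colors (\<open>wood_in_woods\<close>).

  For the growth rate a sandwich is enough.  Let \<open>N(k, l)\<close> be the number of ways to choose one of
  the four directions at every point of a \<open>k \<times> l\<close> box such that every walk along the chosen
  directions leaves the box.  Then the number of Schnyder woods is at most \<open>N(k, l)\<close>
  (\<open>card_woods_upper\<close>) and at least \<open>N(k - 2, l - 2)\<close> (\<open>card_woods_lower\<close>), because the ring around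
  the inner box can be used to lead every walk that has left it to the root.

  By the matrix-tree theorem, \<open>N(k, l)\<close> is the determinant of the Laplacian of the grid with
  Dirichlet boundary, which is diagonalized by products of sines (\<open>card_escaping_walks\<close>):
  it is the product of the numbers \<open>4 - 2 cos(\<pi> a / (k + 1)) - 2 cos(\<pi> b / (l + 1))\<close>.  For fixed \<open>a\<close>
  the product over \<open>b\<close> is a value of a Chebyshev polynomial, namely \<open>sinh((l + 1) t) / sinh t\<close> with
  \<open>t = 2 arsinh(sin(\<pi> a / (2 (k + 1))))\<close>, which is \<open>exp(l t)\<close> up to a factor \<open>l + 1\<close>.  So
  \<open>ln N(k, l) / (k l)\<close> tends to \<open>4/\<pi>\<close> times the integral of \<open>arsinh(sin u)\<close> over \<open>[0, \<pi>/2]\<close>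
  (\<open>sandwich_growth_rate\<close>).  This integral is Catalan's constant \<open>1 - 1/9 + 1/25 - \<dots>\<close>, and
  partial sums of the series show that the limit, \<open>3.20991\<dots>\<close>, lies between 3.209 and 3.210.
\<close>

section \<open>An integral for Catalan's constant and its numerical value\<close>

text \<open>
  \<open>(2 n choose n) / 4\<^sup>n\<close>, up to sign the \<open>n\<close>-th Taylor coefficient of \<open>1 / sqrt (1 + x)\<close>.
\<close>

definition binom_coeff :: "nat \<Rightarrow> real" where
  "binom_coeff n = (\<Prod>m<n. (2 * real m + 1) / (2 * real m + 2))"

lemma binom_coeff_simps [simp]:
  "binom_coeff 0 = 1"
  "binom_coeff (Suc n) = binom_coeff n * ((2 * real n + 1) / (2 * real n + 2))"
  by (simp_all add: binom_coeff_def)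

lemma binom_coeff_pos: "0 < binom_coeff n"
  unfolding binom_coeff_def by (intro prod_pos) auto

text \<open>
  The Taylor polynomials of \<open>1 / sqrt (1 + x)\<close> bound this function alternately from above and
  below, for all \<open>x \<ge> 0\<close>.  The reason is that the derivative of \<open>sqrt (1 + x)\<close> times the polynomial
  telescopes to a single monomial divided by \<open>sqrt (1 + x)\<close>, and so has constant sign.
\<close>

lemma inverse_sqrt_partial_sums:
  fixes x :: real
  assumes "0 \<le> x"
  shows "0 \<le> (-1) ^ n * (1 / sqrt (1 + x) - (\<Sum>m<n. (-1) ^ m * binom_coeff m * x ^ m))"
proof (cases "n = 0")
  case True
  then show ?thesis using assms by simp
next
  case False
  define Q where "Q n x = (\<Sum>m<n. (-1) ^ m * binom_coeff m * x ^ m)" for n and x :: real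
  define Q' where "Q' n x = (\<Sum>m<n. (-1) ^ m * binom_coeff m * (real m * x ^ (m - 1)))" for n and x :: real
  have Q': "(Q n has_real_derivative Q' n x) (at x)" for n x
    unfolding Q_def Q'_def
    by (intro DERIV_sum) (rule derivative_eq_intros refl | simp)+
  have tele: "Q n x / 2 + (1 + x) * Q' n x = - ((-1) ^ n * real n * binom_coeff n * x ^ (n - 1))" for n x
  proof (induction n)
    case 0
    then show ?case by (simp add: Q_def Q'_def)
  next
    case (Suc n)
    have "Q (Suc n) x / 2 + (1 + x) * Q' (Suc n) x =
        (Q n x / 2 + (1 + x) * Q' n x) + (-1) ^ n * binom_coeff n * (x ^ n / 2 + (1 + x) * (real n * x ^ (n - 1)))"
      by (simp add: Q_def Q'_def algebra_simps)
    also have "\<dots> = (-1) ^ n * binom_coeff n * (real n + 1/2) * x ^ n"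
      unfolding Suc by (cases n) (simp_all add: algebra_simps del: binom_coeff_simps(2))
    also have "\<dots> = - ((-1) ^ Suc n * real (Suc n) * binom_coeff (Suc n) * x ^ (Suc n - 1))"
      by (simp add: field_simps)
    finally show ?case .
  qed
  (* h vanishes at 0 and is increasing. *)
  define h where "h x = (-1) ^ n * (1 - sqrt (1 + x) * Q n x)" for x
  have "h 0 \<le> h x"
  proof (rule DERIV_nonneg_imp_nondecreasing[OF assms])
    fix y :: real assume y: "0 \<le> y" "y \<le> x"
    have s: "sqrt (1 + y) > 0" "sqrt (1 + y) * sqrt (1 + y) = 1 + y" using y by auto
    have "(h has_real_derivative
        (-1) ^ n * - (inverse (sqrt (1 + y)) / 2 * Q n y + sqrt (1 + y) * Q' n y)) (at y)"
      unfolding h_def using y by (auto intro!: derivative_eq_intros Q' simp: algebra_simps)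
    also have "inverse (sqrt (1 + y)) / 2 * Q n y + sqrt (1 + y) * Q' n y =
        (Q n y / 2 + (1 + y) * Q' n y) / sqrt (1 + y)"
      using s by (simp add: field_simps)
    also have "(-1) ^ n * - \<dots> = real n * binom_coeff n * y ^ (n - 1) / sqrt (1 + y)"
      unfolding tele by simp
    finally have "(h has_real_derivative real n * binom_coeff n * y ^ (n - 1) / sqrt (1 + y)) (at y)" .
    moreover have "0 \<le> real n * binom_coeff n * y ^ (n - 1) / sqrt (1 + y)"
      using y binom_coeff_pos[of n] by simp
    ultimately show "\<exists>z. DERIV h y :> z \<and> 0 \<le> z" by blast
  qed
  moreover have "Q n 0 = 1"
    using False by (cases n) (simp_all add: Q_def lessThan_Suc_eq_insert_0 sum.reindex)
  ultimately have "0 \<le> h x" by (simp add: h_def)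
  then have "0 \<le> h x / sqrt (1 + x)" using assms by simp
  also have "\<dots> = (-1) ^ n * (1 / sqrt (1 + x) - Q n x)"
    using assms by (simp add: h_def field_simps)
  finally show ?thesis by (simp add: Q_def)
qed

text \<open>
  The derivative of \<open>arsinh\<close> is \<open>1 / sqrt (1 + s\<^sup>2)\<close>, so these bounds come from the previous ones
  by monotonicity.
\<close>

lemma arsinh_partial_sums:
  fixes s :: real
  assumes "0 \<le> s"
  shows "0 \<le> (-1) ^ n * (arsinh s - (\<Sum>m<n. (-1) ^ m * binom_coeff m * s ^ (2 * m + 1) / (2 * real m + 1)))"
proof -
  define h where "h s = (-1) ^ n * (arsinh s - (\<Sum>m<n. (-1) ^ m * binom_coeff m * s ^ (2 * m + 1) / (2 * real m + 1)))" for s :: real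
  have "h 0 \<le> h s"
  proof (rule DERIV_nonneg_imp_nondecreasing[OF assms])
    fix y :: real assume y: "0 \<le> y" "y \<le> s"
    have "((\<lambda>s. (-1) ^ m * binom_coeff m * s ^ (2 * m + 1) / (2 * real m + 1)) has_real_derivative
        (-1) ^ m * binom_coeff m * (y\<^sup>2) ^ m) (at y)" for m
    proof -
      have "((\<lambda>s. (-1) ^ m * binom_coeff m * s ^ (2 * m + 1) / (2 * real m + 1)) has_real_derivative
        (-1) ^ m * binom_coeff m * (real (2 * m + 1) * y ^ (2 * m)) / (2 * real m + 1)) (at y)"
        by (rule derivative_eq_intros refl | simp)+
      moreover have "(-1) ^ m * binom_coeff m * (real (2 * m + 1) * y ^ (2 * m)) / (2 * real m + 1)
         = (-1) ^ m * binom_coeff m * (y\<^sup>2) ^ m"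
        by (simp add: field_simps flip: power_mult)
      ultimately show ?thesis by simp
    qed
    then have "(h has_real_derivative
        (-1) ^ n * (1 / sqrt (1 + y\<^sup>2) - (\<Sum>m<n. (-1) ^ m * binom_coeff m * (y\<^sup>2) ^ m))) (at y)"
      unfolding h_def
      by (intro DERIV_cmult DERIV_diff DERIV_sum)
        (auto intro!: derivative_eq_intros simp: add.commute)
    with inverse_sqrt_partial_sums[of "y\<^sup>2" n]
    show "\<exists>z. DERIV h y :> z \<and> 0 \<le> z" by auto
  qed
  then show ?thesis by (simp add: h_def)
qed

text \<open>
  Wallis' integrals, by the recursion that the derivative of \<open>- cos u * sin u ^ (n + 1)\<close> gives.
  In this form the value visibly cancels the Taylor coefficients of \<open>arsinh\<close>.
\<close>

lemma has_integral_sin_odd_power: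
  "((\<lambda>u. sin u ^ (2 * m + 1)) has_integral 1 / ((2 * real m + 1) * binom_coeff m)) {0..pi/2}"
proof (induction m)
  case 0
  have "(sin has_integral (- cos (pi/2) - - cos 0)) {0..pi/2}"
    by (rule fundamental_theorem_of_calculus)
      (auto simp: has_real_derivative_iff_has_vector_derivative[symmetric] intro!: derivative_eq_intros)
  then show ?case by simp
next
  case (Suc m)
  define n where "n = 2 * m + 1"
  have "((\<lambda>u. (real n + 2) * sin u ^ (n + 2) - (real n + 1) * sin u ^ n) has_integral
      (- cos (pi/2) * sin (pi/2) ^ (n + 1) - (- cos 0 * sin 0 ^ (n + 1)))) {0..pi/2}"
  proof (rule fundamental_theorem_of_calculus)
    fix x :: real
    have "((\<lambda>u. - cos u * sin u ^ (n + 1)) has_real_derivative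
       sin x * sin x ^ (n + 1) - cos x * (real (n + 1) * sin x ^ n * cos x)) (at x)"
      by (rule derivative_eq_intros refl | simp)+
    also have "sin x * sin x ^ (n + 1) - cos x * (real (n + 1) * sin x ^ n * cos x) =
       sin x ^ (n + 2) - (real n + 1) * sin x ^ n * (cos x)\<^sup>2"
      by (simp add: power2_eq_square algebra_simps)
    also have "\<dots> = (real n + 2) * sin x ^ (n + 2) - (real n + 1) * sin x ^ n"
      unfolding cos_squared_eq by (simp add: algebra_simps power2_eq_square)
    finally show "((\<lambda>u. - cos u * sin u ^ (n + 1)) has_vector_derivative
        (real n + 2) * sin x ^ (n + 2) - (real n + 1) * sin x ^ n) (at x within {0..pi/2})"
      by (simp add: has_real_derivative_iff_has_vector_derivative[symmetric] has_field_derivative_at_within)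
  qed simp
  then have "((\<lambda>u. (real n + 2) * sin u ^ (n + 2) - (real n + 1) * sin u ^ n) has_integral 0) {0..pi/2}"
    by simp
  from has_integral_add[OF this has_integral_mult_right[OF Suc, of "real n + 1"]]
  have int2: "((\<lambda>u. (real n + 2) * sin u ^ (n + 2)) has_integral
      ((real n + 1) * (1 / ((2 * real m + 1) * binom_coeff m)))) {0..pi/2}"
    by (simp add: n_def)
  have "real n + 2 \<noteq> 0" by linarith
  then have cancel: "1 / (real n + 2) * ((real n + 2) * x) = x" for x by simp
  have "((\<lambda>u. sin u ^ (n + 2)) has_integral
     (1 / (real n + 2) * ((real n + 1) * (1 / ((2 * real m + 1) * binom_coeff m))))) {0..pi/2}"
    using has_integral_mult_right[OF int2, of "1 / (real n + 2)"] unfolding cancel .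
  also have "1 / (real n + 2) * ((real n + 1) * (1 / ((2 * real m + 1) * binom_coeff m))) =
      1 / ((2 * real (Suc m) + 1) * binom_coeff (Suc m))"
    using binom_coeff_pos[of m] by (simp add: n_def divide_simps)
  finally show ?case by (simp add: n_def)
qed

text \<open>
  Catalan's constant.
\<close>

definition arsinh_sin_integral :: real where
  "arsinh_sin_integral = integral {0..pi/2} (\<lambda>u. arsinh (sin u))"

lemma continuous_on_arsinh_sin: "continuous_on S (\<lambda>u::real. arsinh (sin u))"
  by (intro continuous_intros)

text \<open>
  Integrating the bounds for \<open>arsinh (sin u)\<close> term by term turns them into the partial sums of the
  series of Catalan's constant.  As the bounds hold for each \<open>n\<close>, no interchange of an infinite
  sum with the integral is involved.
\<close>

lemma arsinh_sin_integral_partial_sums: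
  "0 \<le> (-1) ^ n * (arsinh_sin_integral - (\<Sum>m<n. (-1) ^ m / (2 * real m + 1)\<^sup>2))"
proof -
  define P where "P s = (\<Sum>m<n. (-1) ^ m * binom_coeff m * s ^ (2 * m + 1) / (2 * real m + 1))" for s :: real
  have "((\<lambda>u. P (sin u)) has_integral (\<Sum>m<n. (-1) ^ m / (2 * real m + 1)\<^sup>2)) {0..pi/2}"
    unfolding P_def
  proof (rule has_integral_sum)
    fix m
    have "((\<lambda>u. ((-1) ^ m * binom_coeff m / (2 * real m + 1)) * sin u ^ (2 * m + 1)) has_integral
        ((-1) ^ m * binom_coeff m / (2 * real m + 1)) * (1 / ((2 * real m + 1) * binom_coeff m))) {0..pi/2}"
      by (rule has_integral_mult_right[OF has_integral_sin_odd_power])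
    then show "((\<lambda>u. (-1) ^ m * binom_coeff m * sin u ^ (2 * m + 1) / (2 * real m + 1)) has_integral
        (-1) ^ m / (2 * real m + 1)\<^sup>2) {0..pi/2}"
      using binom_coeff_pos[of m] by (simp add: power2_eq_square)
  qed simp
  moreover have "((\<lambda>u. arsinh (sin u)) has_integral arsinh_sin_integral) {0..pi/2}"
    unfolding arsinh_sin_integral_def
    by (intro integrable_integral integrable_continuous_real continuous_on_arsinh_sin)
  ultimately have "((\<lambda>u. (-1) ^ n * (arsinh (sin u) - P (sin u))) has_integral
      (-1) ^ n * (arsinh_sin_integral - (\<Sum>m<n. (-1) ^ m / (2 * real m + 1)\<^sup>2))) {0..pi/2}"
    by (intro has_integral_mult_right has_integral_diff)
  then show ?thesis
  proof (rule has_integral_nonneg)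
    fix u :: real assume "u \<in> {0..pi/2}"
    then have "0 \<le> sin u" by (intro sin_ge_zero) auto
    then show "0 \<le> (-1) ^ n * (arsinh (sin u) - P (sin u))"
      unfolding P_def by (rule arsinh_partial_sums)
  qed
qed

text \<open>
  The upper bound has to be accurate to about \<open>0.00002\<close>, since the growth rate \<open>3.20991\<dots>\<close> is
  close to 3.210; this takes 101 terms.  The lower bound has much more room.
\<close>

lemma arsinh_sin_integral_bounds:
  "0.9158 \<le> arsinh_sin_integral" "arsinh_sin_integral \<le> 0.9159782"
proof -
  have "(\<Sum>m<40. (-1) ^ m / (2 * real m + 1)\<^sup>2) \<le> arsinh_sin_integral"
    using arsinh_sin_integral_partial_sums[of 40] by simp
  moreover have "0.9158 \<le> (\<Sum>m<40. (-1) ^ m / (2 * real m + 1)\<^sup>2)"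
    by (simp add: numeral_eq_Suc)
  ultimately show "0.9158 \<le> arsinh_sin_integral" by linarith
next
  have "arsinh_sin_integral \<le> (\<Sum>m<101. (-1) ^ m / (2 * real m + 1)\<^sup>2)"
    using arsinh_sin_integral_partial_sums[of 101] by simp
  moreover have "(\<Sum>m<101. (-1) ^ m / (2 * real m + 1)\<^sup>2) \<le> 0.9159782"
    by (simp add: numeral_eq_Suc)
  ultimately show "arsinh_sin_integral \<le> 0.9159782" by linarith
qed

lemma sum_lessThan_9: "(\<Sum>k<9. f k) = f 0 + f 1 + f 2 + f 3 + f 4 + f 5 + f 6 + f 7 + (f 8 :: real)" for f :: "nat => real"
  by (simp add: eval_nat_numeral)
lemma ln_3209_le: "ln (3.209::real) \<le> 4 * 0.9158 / 3.1415926535899"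
proof -
  have "ln (3.209::real) \<le> (\<Sum>k<9. 2*((3.209-1)/(3.209+1))^(2*k+1) / of_nat (2*k+1)) + 
     2 * (((3.209-1)/(3.209+1))^(2*9+1) / (1 - ((3.209-1)/(3.209+1))^2) / of_nat (2*9+1))"
    using ln_approx_bounds[of "3.209" 9] by simp
  also have "\<dots> \<le> 4 * 0.9158 / 3.1415926535899" unfolding sum_lessThan_9 by (simp add: power_divide)
  finally show ?thesis .
qed
lemma less_ln_321: "4 * 0.9159782 / 3.141592653588 < ln (3.21::real)"
proof -
  have "4 * 0.9159782 / 3.141592653588 < (\<Sum>k<9. 2*((3.21-1)/(3.21+1))^(2*k+1) / real (2*k+1))" 
    unfolding sum_lessThan_9 by (simp add: power_divide)
  also have "\<dots> \<le> ln (3.21::real)"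
    using ln_approx_bounds[of "3.21" 9] by simp
  finally show ?thesis .
qed

definition schnyder_growth_rate :: real where
  "schnyder_growth_rate = exp (4 * arsinh_sin_integral / pi)"

lemma schnyder_growth_rate_bounds: "3.209 \<le> schnyder_growth_rate" "schnyder_growth_rate < 3.210"
proof -
  have "ln 3.209 \<le> 4 * 0.9158 / (3.1415926535899 :: real)" by (rule ln_3209_le)
  also have "\<dots> \<le> 4 * arsinh_sin_integral / pi"
    using arsinh_sin_integral_bounds(1) pi_approx(2) by (intro frac_le) auto
  finally have "exp (ln 3.209) \<le> schnyder_growth_rate"
    unfolding schnyder_growth_rate_def by (simp only: exp_le_cancel_iff)
  then show "3.209 \<le> schnyder_growth_rate" by simp
next
  have "4 * arsinh_sin_integral / pi \<le> 4 * 0.9159782 / (3.141592653588 :: real)"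
    using arsinh_sin_integral_bounds pi_approx(1) by (intro frac_le) auto
  also have "\<dots> < ln 3.21" by (rule less_ln_321)
  finally have "schnyder_growth_rate < exp (ln 3.21)"
    unfolding schnyder_growth_rate_def by (simp only: exp_less_cancel_iff)
  then show "schnyder_growth_rate < 3.210" by simp
qed

section \<open>The growth of a product of sines and cosines\<close>

text \<open>
  \<open>U\<^sub>n(x / 2)\<close> for the Chebyshev polynomials \<open>U\<^sub>n\<close> of the second kind; this scaling makes the
  polynomials monic.
\<close>

fun chebyshev_U :: "nat \<Rightarrow> real poly" where
  "chebyshev_U 0 = 1"
| "chebyshev_U (Suc 0) = [:0, 1:]"
| "chebyshev_U (Suc (Suc n)) = [:0, 1:] * chebyshev_U (Suc n) - chebyshev_U n"

lemma chebyshev_U_cos: "poly (chebyshev_U n) (2 * cos x) * sin x = sin (real (n + 1) * x)"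
proof (induction n rule: chebyshev_U.induct)
  case (3 n)
  define y where "y = real (n + 2) * x"
  have "sin (y + x) + sin (y - x) = 2 * cos x * sin y"
    by (simp add: sin_add sin_diff)
  moreover have "y + x = real (Suc (Suc n) + 1) * x" "y - x = real (n + 1) * x"
      "y = real (Suc n + 1) * x"
    by (simp_all add: y_def algebra_simps)
  ultimately show ?case using 3 by (simp add: algebra_simps)
qed (auto simp: sin_double)

lemma chebyshev_U_cosh: "poly (chebyshev_U n) (2 * cosh x) * sinh x = sinh (real (n + 1) * x)"
proof (induction n rule: chebyshev_U.induct)
  case (3 n)
  define y where "y = real (n + 2) * x"
  have "sinh (y + x) + sinh (y - x) = 2 * cosh x * sinh y"
    by (simp add: sinh_add sinh_diff)
  moreover have "y + x = real (Suc (Suc n) + 1) * x" "y - x = real (n + 1) * x"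
      "y = real (Suc n + 1) * x"
    by (simp_all add: y_def algebra_simps)
  ultimately show ?case using 3 by (simp add: algebra_simps)
qed (auto simp: sinh_double)

lemma chebyshev_U_degree: "degree (chebyshev_U n) \<le> n \<and> coeff (chebyshev_U n) n = 1"
proof (induction n rule: chebyshev_U.induct)
  case (3 n)
  have "degree ([:0, 1:] * chebyshev_U (Suc n)) \<le> Suc (Suc n)"
    using 3 by (intro order.trans[OF degree_mult_le]) auto
  moreover have "coeff (chebyshev_U n) (Suc (Suc n)) = 0"
    using 3 by (intro coeff_eq_0) auto
  ultimately show ?case using 3
    by (auto intro!: degree_diff_le)
qed auto

lemma pi_fraction_bounds:
  assumes "0 < b" "b < m"
  shows "0 < pi * real b / real m" "pi * real b / real m < pi"
  using assms by (auto simp: divide_less_eq mult.commute)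

text \<open>
  Both sides are monic of degree \<open>n\<close>, and by the formula for cosines the left-hand side vanishes at
  the \<open>n\<close> distinct roots of the right-hand side.
\<close>

lemma chebyshev_U_factorization:
  "chebyshev_U n = (\<Prod>b\<in>{1..n}. [:- 2 * cos (pi * real b / real (n + 1)), 1:])"
    (is "_ = ?P")
proof (rule poly_eqI_degree_lead_coeff)
  let ?c = "\<lambda>b. 2 * cos (pi * real b / real (n + 1))"
  have deg: "degree ?P = n"
    by (subst degree_prod_sum_eq) auto
  have "lead_coeff ?P = 1" by (simp add: lead_coeff_prod)
  then show "coeff (chebyshev_U n) n = coeff ?P n"
    using chebyshev_U_degree[of n] deg by simp
  have "inj_on ?c {1..n}"
  proof (rule inj_onI)
    fix a b assume ab: "a \<in> {1..n}" "b \<in> {1..n}" and eq: "?c a = ?c b"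
    have bd: "0 \<le> pi * real c / real (n + 1) \<and> pi * real c / real (n + 1) \<le> pi" if "c \<in> {1..n}" for c
      using that by (simp add: divide_le_eq)
    have "pi * real a / real (n + 1) = pi * real b / real (n + 1)"
      by (rule cos_inj_pi) (use bd[OF ab(1)] bd[OF ab(2)] eq in simp_all)
    then show "a = b" by (simp del: of_nat_add)
  qed
  then show "n \<le> card (?c ` {1..n})" by (simp add: card_image)
  show "degree (chebyshev_U n) \<le> n" "degree ?P \<le> n"
    using chebyshev_U_degree deg by auto
  fix z assume "z \<in> ?c ` {1..n}"
  then obtain b where b: "b \<in> {1..n}" "z = ?c b" by auto
  have "sin (pi * real b / real (n + 1)) > 0"
    using b pi_fraction_bounds[of b "n + 1"] by (intro sin_gt_zero) auto
  moreover have "poly (chebyshev_U n) z * sin (pi * real b / real (n + 1)) = sin (real b * pi)"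
    unfolding b chebyshev_U_cos by (simp add: mult.commute del: of_nat_add)
  ultimately have "poly (chebyshev_U n) z = 0" by simp
  moreover have "poly ?P z = 0" using b by (auto simp: poly_prod)
  ultimately show "poly (chebyshev_U n) z = poly ?P z" by simp
qed

text \<open>
  \<open>sinh ((n + 1) t) / sinh t\<close> is the sum of the \<open>n + 1\<close> exponentials \<open>exp ((n - 2 m) t)\<close> with
  \<open>0 \<le> m \<le> n\<close>, the largest of which is \<open>exp (n t)\<close>.
\<close>

lemma sinh_quotient_bounds:
  fixes t :: real
  assumes "0 < t"
  shows "exp (real n * t) * sinh t \<le> sinh (real (n + 1) * t)"
    and "sinh (real (n + 1) * t) \<le> real (n + 1) * exp (real n * t) * sinh t"
proof -
  have s: "sinh t > 0" using assms by simp
  have c: "cosh t \<ge> sinh t" by (simp add: sinh_le_cosh_real)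
  have add: "sinh (real (n + 1) * t) = sinh (real n * t) * cosh t + cosh (real n * t) * sinh t" for n
    by (simp add: distrib_right sinh_add)
  have "sinh (real n * t) * sinh t \<le> sinh (real n * t) * cosh t"
    using assms c by (intro mult_left_mono) auto
  then show "exp (real n * t) * sinh t \<le> sinh (real (n + 1) * t)"
    unfolding add by (simp add: sinh_plus_cosh[symmetric] algebra_simps)
  show "sinh (real (n + 1) * t) \<le> real (n + 1) * exp (real n * t) * sinh t"
  proof (induction n)
    case (Suc n)
    have e: "cosh x \<le> exp x" if "x \<ge> 0" for x :: real
      using that by (simp add: cosh_def)
    have "sinh (real (n + 1) * t) * cosh t \<le> (real (n + 1) * exp (real n * t) * sinh t) * exp t"
      using Suc assms s by (intro mult_mono e) auto
    moreover have "cosh (real (n + 1) * t) * sinh t \<le> exp (real (n + 1) * t) * sinh t"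
      using assms s by (intro mult_right_mono e) auto
    moreover have "exp (real (n + 1) * t) = exp (real n * t) * exp t"
      by (simp add: distrib_right exp_add)
    ultimately show ?case
      using add[of "Suc n"] by (simp add: algebra_simps)
  qed simp
qed

text \<open>
  The product of the eigenvalues of the Laplacian of the \<open>k \<times> l\<close> grid with Dirichlet boundary.
\<close>

definition laplacian_product :: "nat \<Rightarrow> nat \<Rightarrow> real" where
  "laplacian_product k l =
     (\<Prod>a\<in>{1..k}. \<Prod>b\<in>{1..l}. 4 - 2 * cos (pi * real a / real (k + 1)) - 2 * cos (pi * real b / real (l + 1)))"

definition arsinh_sin_sum :: "nat \<Rightarrow> real" where
  "arsinh_sin_sum k = (\<Sum>a\<in>{1..k}. arsinh (sin (pi * real a / (2 * real (k + 1)))))"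

text \<open>
  Since \<open>2 - cos x = 1 + 2 (sin (x / 2))\<^sup>2\<close>, this number is \<open>cosh t\<close> for \<open>t = 2 arsinh (sin (x / 2))\<close>.
  So for fixed \<open>a\<close> the product over \<open>b\<close> is a Chebyshev polynomial at \<open>2 cosh t\<close>.
\<close>

lemma laplacian_product_bounds:
  "exp (2 * real l * arsinh_sin_sum k) \<le> laplacian_product k l"
  "laplacian_product k l \<le> real (l + 1) ^ k * exp (2 * real l * arsinh_sin_sum k)"
proof -
  define t where "t a = 2 * arsinh (sin (pi * real a / (2 * real (k + 1))))" for a
  define p where "p a = (\<Prod>b\<in>{1..l}. 4 - 2 * cos (pi * real a / real (k + 1)) - 2 * cos (pi * real b / real (l + 1)))" for a
  have p: "exp (real l * t a) \<le> p a \<and> p a \<le> real (l + 1) * exp (real l * t a)" if a: "a \<in> {1..k}" for a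
  proof -
    define x where "x = pi * real a / (2 * real (k + 1))"
    have "sin x > 0"
      using a pi_fraction_bounds[of a "2 * (k + 1)"] by (intro sin_gt_zero) (auto simp: x_def)
    then have t: "t a > 0" by (simp add: t_def x_def)
    have "cosh (t a) = 2 * (sinh (arsinh (sin x)))\<^sup>2 + 1"
      unfolding t_def x_def by (simp add: cosh_double cosh_square_eq)
    also have "\<dots> = 2 - cos (2 * x)" by (simp add: cos_double_sin)
    also have "2 * x = pi * real a / real (k + 1)" by (simp add: x_def divide_simps)
    finally have ct: "2 * cosh (t a) = 4 - 2 * cos (pi * real a / real (k + 1))" by simp
    have "p a = poly (chebyshev_U l) (2 * cosh (t a))"
      unfolding p_def chebyshev_U_factorization poly_prod ct by (intro prod.cong) auto
    then have "p a * sinh (t a) = sinh (real (l + 1) * t a)"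
      by (simp only: chebyshev_U_cosh)
    with sinh_quotient_bounds[OF t, of l] t show ?thesis
      by (metis mult_le_cancel_right_pos sinh_real_pos_iff)
  qed
  have e: "exp (2 * real l * arsinh_sin_sum k) = (\<Prod>a\<in>{1..k}. exp (real l * t a))"
    by (simp add: exp_sum[symmetric] arsinh_sin_sum_def t_def sum_distrib_left mult.assoc mult.left_commute)
  have lp: "laplacian_product k l = (\<Prod>a\<in>{1..k}. p a)" by (simp add: laplacian_product_def p_def)
  show "exp (2 * real l * arsinh_sin_sum k) \<le> laplacian_product k l"
    unfolding e lp using p by (intro prod_mono) auto
  have "laplacian_product k l \<le> (\<Prod>a\<in>{1..k}. real (l + 1) * exp (real l * t a))"
    unfolding lp using p by (intro prod_mono) (force intro: order.trans[OF exp_ge_zero])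
  also have "\<dots> = real (l + 1) ^ k * exp (2 * real l * arsinh_sin_sum k)"
    by (simp add: prod.distrib e)
  finally show "laplacian_product k l \<le> real (l + 1) ^ k * exp (2 * real l * arsinh_sin_sum k)" .
qed

lemma arsinh_sin_mono: "0 \<le> x \<Longrightarrow> x \<le> y \<Longrightarrow> y \<le> pi / 2 \<Longrightarrow> arsinh (sin x) \<le> arsinh (sin y :: real)"
  using sin_monotone_2pi_le[of x y] by (simp add: not_less[symmetric])

text \<open>
  A Riemann sum of an increasing function differs from the integral by at most the step size times
  the largest value of the function.
\<close>

lemma arsinh_sin_sum_bounds:
  fixes k :: nat
  defines "h \<equiv> pi / (2 * real (k + 1))"
  shows "arsinh_sin_integral - h * arsinh 1 \<le> h * arsinh_sin_sum k"
    and "h * arsinh_sin_sum k \<le> arsinh_sin_integral"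
proof -
  define g :: "real \<Rightarrow> real" where "g u = arsinh (sin u)" for u
  define G where "G x = integral {0..x} g" for x
  have h: "h > 0" "real (k + 1) * h = pi / 2" by (simp_all add: h_def field_simps)
  have G: "(G has_real_derivative g x) (at x within {0..pi/2})" if "x \<in> {0..pi/2}" for x
    unfolding G_def by (rule integral_has_real_derivative) (use that in \<open>auto simp: g_def continuous_on_arsinh_sin\<close>)
  have step: "h * g (real a * h) \<le> G (real (a + 1) * h) - G (real a * h) \<and>
       G (real (a + 1) * h) - G (real a * h) \<le> h * g (real (a + 1) * h)" if "a \<le> k" for a
  proof -
    have le: "real (a + 1) * h \<le> pi / 2"
      using that h by (metis add_le_mono1 mult_right_mono of_nat_le_iff order_less_imp_le)
    have lt: "real a * h < real (a + 1) * h" using h by simp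
    have zero: "0 \<le> real a * h" using h by simp
    have "\<exists>z\<in>{real a * h<..<real (a + 1) * h}.
        G (real (a + 1) * h) - G (real a * h) = g z * (real (a + 1) * h - real a * h)"
    proof (rule mvt_simple[OF lt])
      fix x assume x: "real a * h \<le> x" "x \<le> real (a + 1) * h"
      show "(G has_derivative (\<lambda>d. g x * d)) (at x within {real a * h..real (a + 1) * h})"
        using x le zero by (intro has_derivative_subset[OF G[unfolded has_field_derivative_def]]) auto
    qed
    then obtain z where z: "real a * h < z" "z < real (a + 1) * h"
      "G (real (a + 1) * h) - G (real a * h) = h * g z" by (auto simp: algebra_simps)
    have "g (real a * h) \<le> g z" "g z \<le> g (real (a + 1) * h)"
      unfolding g_def using z le zero by (auto intro!: arsinh_sin_mono simp del: of_nat_add)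
    then show ?thesis unfolding z(3) using h by simp
  qed
  have S: "h * arsinh_sin_sum k = (\<Sum>a\<in>{1..k}. h * g (real a * h))"
    by (simp add: arsinh_sin_sum_def sum_distrib_left g_def h_def mult.commute)
  have G0: "G 0 = 0" by (simp add: G_def)
  have Gk: "G (real (k + 1) * h) = arsinh_sin_integral"
    unfolding h(2) by (simp add: G_def arsinh_sin_integral_def g_def[abs_def])
  have tele: "(\<Sum>a<n. G (real (a + 1) * h) - G (real a * h)) = G (real n * h)" for n
    using sum_lessThan_telescope[of "\<lambda>a. G (real a * h)" n] by (simp add: G0 add.commute)
  have g0: "g 0 = 0" by (simp add: g_def)
  have "h * arsinh_sin_sum k = (\<Sum>a<k + 1. h * g (real a * h))"
    unfolding S by (simp add: lessThan_Suc_atMost atMost_atLeast0 sum.atLeast_Suc_atMost[of 0] g0)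
  also have "\<dots> \<le> (\<Sum>a<k + 1. G (real (a + 1) * h) - G (real a * h))"
    using step by (intro sum_mono) auto
  also have "\<dots> = arsinh_sin_integral" using tele[of "k + 1"] Gk by simp
  finally show "h * arsinh_sin_sum k \<le> arsinh_sin_integral" .
  have "arsinh_sin_integral = (\<Sum>a<k + 1. G (real (a + 1) * h) - G (real a * h))"
    using tele[of "k + 1"] Gk by simp
  also have "\<dots> \<le> (\<Sum>a<k + 1. h * g (real (a + 1) * h))"
    using step by (intro sum_mono) auto
  also have "\<dots> = (\<Sum>a\<in>{1..k}. h * g (real a * h)) + h * g (real (k + 1) * h)"
    by (simp add: sum.atLeast1_atMost_eq)
  also have "g (real (k + 1) * h) = arsinh 1" unfolding h(2) by (simp add: g_def)
  finally show "arsinh_sin_integral - h * arsinh 1 \<le> h * arsinh_sin_sum k"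
    unfolding S by simp
qed

lemma arsinh_sin_sum_asymptotics:
  "(\<lambda>k. 2 * arsinh_sin_sum k / real k) \<longlonglongrightarrow> 4 * arsinh_sin_integral / pi"
proof -
  have lim: "(\<lambda>k. pi / (2 * real (k + 1)) * arsinh_sin_sum k) \<longlonglongrightarrow> arsinh_sin_integral"
  proof (rule tendsto_sandwich)
    show "\<forall>\<^sub>F k in sequentially. arsinh_sin_integral - pi / (2 * real (k + 1)) * arsinh 1
        \<le> pi / (2 * real (k + 1)) * arsinh_sin_sum k"
      using arsinh_sin_sum_bounds(1) by (intro always_eventually) blast
    show "\<forall>\<^sub>F k in sequentially. pi / (2 * real (k + 1)) * arsinh_sin_sum k \<le> arsinh_sin_integral"
      using arsinh_sin_sum_bounds(2) by (intro always_eventually) blast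
    show "(\<lambda>k. arsinh_sin_integral - pi / (2 * real (k + 1)) * arsinh 1) \<longlonglongrightarrow> arsinh_sin_integral"
      by real_asymp
  qed simp
  have one: "(\<lambda>k. real (k + 1) / real k) \<longlonglongrightarrow> 1" by real_asymp
  have "(\<lambda>k. 4 / pi * (real (k + 1) / real k) * (pi / (2 * real (k + 1)) * arsinh_sin_sum k))
      \<longlonglongrightarrow> 4 / pi * 1 * arsinh_sin_integral"
    by (intro tendsto_mult lim tendsto_const one)
  also have "4 / pi * 1 * arsinh_sin_integral = 4 * arsinh_sin_integral / pi" by simp
  finally show ?thesis
  proof (rule Lim_transform_eventually)
    show "\<forall>\<^sub>F k in sequentially. 4 / pi * (real (k + 1) / real k) * (pi / (2 * real (k + 1)) * arsinh_sin_sum k)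
        = 2 * arsinh_sin_sum k / real k"
      by (rule eventually_mono[OF eventually_gt_at_top[of 0]]) (simp add: divide_simps)
  qed
qed

text \<open>
  Replacing \<open>k\<close> and \<open>l\<close> by \<open>k - 2\<close> and \<open>l - 2\<close> does not affect the rate, as
  \<open>(k - 2) (l - 2) / (k l)\<close> tends to 1.
\<close>

lemma sandwich_growth_rate:
  fixes S :: "nat \<Rightarrow> nat \<Rightarrow> real"
  assumes lower: "\<And>k l. 3 \<le> k \<Longrightarrow> 3 \<le> l \<Longrightarrow> laplacian_product (k - 2) (l - 2) \<le> S k l"
    and upper: "\<And>k l. 3 \<le> k \<Longrightarrow> 3 \<le> l \<Longrightarrow> S k l \<le> laplacian_product k l"
  shows "((\<lambda>(k, l). S k l powr (1 / real (k * l))) \<longlongrightarrow> schnyder_growth_rate)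
    (sequentially \<times>\<^sub>F sequentially)"
proof -
  define c where "c = 4 * arsinh_sin_integral / pi"
  define T where "T k = 2 * arsinh_sin_sum k" for k
  let ?F = "sequentially \<times>\<^sub>F sequentially :: (nat \<times> nat) filter"
  have ev: "\<forall>\<^sub>F p in ?F. 3 \<le> fst p \<and> 3 \<le> snd p"
    by (auto simp: eventually_prod_sequentially)
  have f: "filterlim fst sequentially ?F" and s: "filterlim snd sequentially ?F"
    by (simp_all add: filterlim_fst filterlim_snd)
  have T: "(\<lambda>k. T k / real k) \<longlonglongrightarrow> c"
    using arsinh_sin_sum_asymptotics by (simp add: T_def c_def)
  have "((\<lambda>p. T (fst p) / real (fst p) + ln (real (snd p + 1)) / real (snd p)) \<longlongrightarrow> c + 0) ?F"
  proof (rule tendsto_add)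
    show "((\<lambda>p. T (fst p) / real (fst p)) \<longlongrightarrow> c) ?F" by (rule filterlim_compose[OF T f])
    have "(\<lambda>l. ln (real (l + 1)) / real l) \<longlonglongrightarrow> 0" by real_asymp
    then show "((\<lambda>p. ln (real (snd p + 1)) / real (snd p)) \<longlongrightarrow> 0) ?F" by (rule filterlim_compose[OF _ s])
  qed
  then have U: "((\<lambda>p. T (fst p) / real (fst p) + ln (real (snd p + 1)) / real (snd p)) \<longlongrightarrow> c) ?F" by simp
  have "((\<lambda>p. T (fst p - 2) / real (fst p) * (real (snd p - 2) / real (snd p))) \<longlongrightarrow> c * 1) ?F"
  proof (rule tendsto_mult)
    have "(\<lambda>k. real k / real (k + 2)) \<longlonglongrightarrow> 1" by real_asymp
    with T have "(\<lambda>k. T k / real k * (real k / real (k + 2))) \<longlonglongrightarrow> c * 1"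
      by (rule tendsto_mult)
    then have "(\<lambda>k. T k / real k * (real k / real (k + 2))) \<longlonglongrightarrow> c" by simp
    then have "(\<lambda>k. T k / real (k + 2)) \<longlonglongrightarrow> c"
      by (rule Lim_transform_eventually)
        (rule eventually_mono[OF eventually_gt_at_top[of 0]], simp add: field_simps)
    then have "(\<lambda>k. T (k + 2 - 2) / real (k + 2)) \<longlonglongrightarrow> c" by simp
    then have "(\<lambda>k. T (k - 2) / real k) \<longlonglongrightarrow> c" by (rule LIMSEQ_offset)
    then show "((\<lambda>p. T (fst p - 2) / real (fst p)) \<longlongrightarrow> c) ?F" by (rule filterlim_compose[OF _ f])
    have "(\<lambda>l. real (l - 2) / real l) \<longlonglongrightarrow> 1"
      by (rule LIMSEQ_offset[of _ 2]) (simp, real_asymp)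
    then show "((\<lambda>p. real (snd p - 2) / real (snd p)) \<longlongrightarrow> 1) ?F" by (rule filterlim_compose[OF _ s])
  qed
  then have L: "((\<lambda>p. T (fst p - 2) / real (fst p) * (real (snd p - 2) / real (snd p))) \<longlongrightarrow> c) ?F" by simp
  have bounds: "0 < S k l \<and> ln (S k l) / real (k * l) \<le> T k / real k + ln (real (l + 1)) / real l \<and>
      T (k - 2) / real k * (real (l - 2) / real l) \<le> ln (S k l) / real (k * l)"
    if kl: "3 \<le> k" "3 \<le> l" for k l
  proof -
    have lo: "exp (real (l - 2) * T (k - 2)) \<le> S k l"
      using laplacian_product_bounds(1)[of "l - 2" "k - 2"] lower[OF kl]
      by (simp add: T_def mult_ac)
    then have pos: "0 < S k l" by (rule less_le_trans[OF exp_gt_zero])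
    have "real (l - 2) * T (k - 2) \<le> ln (S k l)"
      using lo pos by (simp add: ln_ge_iff)
    then have "real (l - 2) * T (k - 2) / real (k * l) \<le> ln (S k l) / real (k * l)"
      by (rule divide_right_mono) simp
    moreover have "S k l \<le> real (l + 1) ^ k * exp (real l * T k)"
      using laplacian_product_bounds(2)[of k l] upper[OF kl] by (simp add: T_def mult_ac)
    then have "ln (S k l) \<le> ln (real (l + 1) ^ k * exp (real l * T k))"
      using pos by simp
    then have "ln (S k l) \<le> real k * ln (real (l + 1)) + real l * T k"
      by (simp add: ln_mult ln_realpow)
    then have "ln (S k l) / real (k * l) \<le> (real k * ln (real (l + 1)) + real l * T k) / real (k * l)"
      by (rule divide_right_mono) simp
    moreover have "(real k * ln (real (l + 1)) + real l * T k) / real (k * l) = T k / real k + ln (real (l + 1)) / real l"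
      using kl by (simp add: field_simps)
    ultimately show ?thesis using pos by (simp add: mult_ac)
  qed
  have "((\<lambda>p. ln (S (fst p) (snd p)) / real (fst p * snd p)) \<longlongrightarrow> c) ?F"
    by (rule tendsto_sandwich[OF _ _ L U]; rule eventually_mono[OF ev]; use bounds in blast)
  from tendsto_exp[OF this]
  have "((\<lambda>p. exp (ln (S (fst p) (snd p)) / real (fst p * snd p))) \<longlongrightarrow> schnyder_growth_rate) ?F"
    by (simp add: schnyder_growth_rate_def c_def)
  then show ?thesis
  proof (rule Lim_transform_eventually)
    show "\<forall>\<^sub>F p in ?F. exp (ln (S (fst p) (snd p)) / real (fst p * snd p)) =
        (case p of (k, l) \<Rightarrow> S k l powr (1 / real (k * l)))"
      by (rule eventually_mono[OF ev]) (use bounds in \<open>auto simp: powr_def split: prod.splits; fastforce\<close>)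
  qed
qed

section \<open>The matrix-tree theorem and the Laplacian of the grid\<close>

text \<open>
  On a finite set \<open>V\<close> this means that the iteration of \<open>g\<close> leaves \<open>V\<close> from every starting point.
\<close>

definition escaping :: "'v set \<Rightarrow> ('v \<Rightarrow> 'v) \<Rightarrow> bool" where
  "escaping V g \<longleftrightarrow> (\<forall>C\<subseteq>V. g ` C \<subseteq> C \<longrightarrow> C = {})"

text \<open>
  A permutation contributes to the Leibniz formula only if it moves points along \<open>g\<close>; the set of
  moved points is then invariant under \<open>g\<close>.  So if \<open>g\<close> is escaping, only the identity contributes.
  Otherwise the indicator function of the largest invariant set lies in the kernel.
\<close>

lemma det_functional_laplacian:
  fixes e :: "nat \<Rightarrow> 'v" and g :: "'v \<Rightarrow> 'v"
  assumes e: "bij_betw e {0..<n} V" and loopless: "\<And>v. v \<in> V \<Longrightarrow> g v \<noteq> v"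
  shows "Determinant.det (Matrix.mat n n (\<lambda>(i, j). of_bool (i = j) - of_bool (g (e i) = e j))) =
    (of_bool (escaping V g) :: real)" (is "Determinant.det ?M = _")
proof (cases "escaping V g")
  case True
  have inj: "inj_on e {0..<n}" and im: "e ` {0..<n} = V" using e by (auto simp: bij_betw_def)
  let ?t = "\<lambda>p. signof p * (\<Prod>i = 0..<n. ?M $$ (i, p i))"
  have zero: "?t p = 0" if p: "p permutes {0..<n}" and ne: "p \<noteq> id" for p
  proof (rule ccontr)
    assume "?t p \<noteq> 0"
    then have nz: "?M $$ (i, p i) \<noteq> 0" if "i < n" for i
      using that by (auto simp: prod_zero_iff)
    have pn: "p i < n" if "i < n" for i
      using permutes_in_image[OF p, of i] that by simp
    let ?C = "e ` {i \<in> {0..<n}. p i \<noteq> i}"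
    have "g ` ?C \<subseteq> ?C"
    proof safe
      fix i assume i: "i \<in> {0..<n}" "p i \<noteq> i"
      then have "g (e i) = e (p i)"
        using nz[of i] pn[of i] by (auto split: if_splits)
      moreover have "p (p i) \<noteq> p i"
        using i permutes_inj[OF p] by (auto dest: injD)
      ultimately show "g (e i) \<in> ?C" using pn[of i] i by auto
    qed
    moreover have "?C \<subseteq> V" using im by auto
    ultimately have "?C = {}" using True unfolding escaping_def by blast
    moreover have "p i = i" if "i \<notin> {0..<n}" for i
      using permutes_not_in[OF p that] .
    ultimately have "p = id" by (intro ext) auto
    with ne show False by simp
  qed
  have "Determinant.det ?M = (\<Sum>p\<in>{p. p permutes {0..<n}}. ?t p)"
    by (rule det_def') simp
  also have "\<dots> = (\<Sum>p\<in>{id}. ?t p)"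
  proof (rule sum.mono_neutral_right)
    show "\<forall>p\<in>{p. p permutes {0..<n}} - {id}. ?t p = 0" using zero by blast
  qed (auto simp: finite_permutations permutes_id)
  also have "\<dots> = (\<Prod>i = 0..<n. 1)"
    using loopless im by (auto intro!: prod.cong)
  finally show ?thesis using True by simp
next
  case False
  have inj: "inj_on e {0..<n}" and im: "e ` {0..<n} = V" using e by (auto simp: bij_betw_def)
  define W where "W = \<Union>{C. C \<subseteq> V \<and> g ` C \<subseteq> C}"
  have "g ` W \<subseteq> W" "W \<subseteq> V" unfolding W_def by blast+
  obtain w where w: "w \<in> W" using False unfolding W_def escaping_def by blast
  have iff: "g v \<in> W \<longleftrightarrow> v \<in> W" if "v \<in> V" for v
  proof
    assume "g v \<in> W"
    with \<open>g ` W \<subseteq> W\<close> \<open>W \<subseteq> V\<close> that have "insert v W \<subseteq> V \<and> g ` insert v W \<subseteq> insert v W" by auto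
    then show "v \<in> W" unfolding W_def by blast
  qed (use \<open>g ` W \<subseteq> W\<close> in auto)
  define x :: "real Matrix.vec" where "x = Matrix.vec n (\<lambda>i. of_bool (e i \<in> W))"
  obtain i where i: "i < n" "e i = w" using w \<open>W \<subseteq> V\<close> im by auto
  have "x \<noteq> 0\<^sub>v n"
  proof
    assume "x = 0\<^sub>v n"
    then have "Matrix.vec_index x i = 0" using i by simp
    then show False using i w by (simp add: x_def)
  qed
  moreover have "?M *\<^sub>v x = 0\<^sub>v n"
  proof
    fix i assume "i < dim_vec (0\<^sub>v n :: real Matrix.vec)"
    then have i: "i < n" by simp
    then have eV: "e i \<in> V" using im by auto
    have "Matrix.vec_index (?M *\<^sub>v x) i =
        (\<Sum>j = 0..<n. (of_bool (i = j) - of_bool (g (e i) = e j)) * of_bool (e j \<in> W))"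
      using i by (simp add: scalar_prod_def x_def)
    also have "\<dots> = (\<Sum>j = 0..<n. of_bool (i = j) * of_bool (e j \<in> W)) -
        (\<Sum>j = 0..<n. of_bool (g (e i) = e j) * of_bool (e j \<in> W))"
      by (simp add: left_diff_distrib sum_subtractf)
    also have "(\<Sum>j = 0..<n. of_bool (i = j) * of_bool (e j \<in> W)) = (of_bool (e i \<in> W) :: real)"
      using i by (subst sum.remove[of _ i]) (auto intro!: sum.neutral)
    also have "(\<Sum>j = 0..<n. of_bool (g (e i) = e j) * of_bool (e j \<in> W)) = (\<Sum>v\<in>V. of_bool (g (e i) = v) * (of_bool (v \<in> W) :: real))"
      by (rule sum.reindex_bij_betw[OF e, of "\<lambda>v. of_bool (g (e i) = v) * of_bool (v \<in> W)"])
    also have "\<dots> = of_bool (g (e i) \<in> W)"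
    proof (cases "g (e i) \<in> W")
      case True
      then have "g (e i) \<in> V" using \<open>W \<subseteq> V\<close> by auto
      then show ?thesis using True bij_betw_finite[OF e]
        by (subst sum.remove[of _ "g (e i)"]) (auto intro!: sum.neutral)
    qed (auto intro!: sum.neutral)
    finally show "Matrix.vec_index (?M *\<^sub>v x) i = Matrix.vec_index (0\<^sub>v n) i"
      using iff[OF eV] i by simp
  qed (simp add: x_def)
  ultimately have "Determinant.det ?M = 0"
    by (subst det_0_iff_vec_prod_zero[of _ n]) (auto intro!: exI[of _ x] simp: x_def)
  then show ?thesis using False by simp
qed

text \<open>
  The matrix-tree theorem for trees whose root is the outside of \<open>V\<close>.  Every row of the matrix is a
  sum over the possible steps \<open>m\<close>, so the determinant expands into a sum over the choices of one
  step for each vertex, and each choice contributes 0 or 1 by the previous lemma.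
\<close>

theorem det_laplacian_counts_escaping:
  fixes e :: "nat \<Rightarrow> 'v" and mv :: "'v \<Rightarrow> 'd::finite \<Rightarrow> 'v"
  assumes e: "bij_betw e {0..<n} V" and loopless: "\<And>v m. v \<in> V \<Longrightarrow> mv v m \<noteq> v"
  shows "Determinant.det (Matrix.mat n n (\<lambda>(i, j). \<Sum>m\<in>UNIV. of_bool (i = j) - of_bool (mv (e i) m = e j))) =
    real (card {d \<in> V \<rightarrow>\<^sub>E UNIV. escaping V (\<lambda>v. mv v (d v))})" (is "Determinant.det ?M = real (card ?T)")
proof -
  have im: "e ` {0..<n} = V" and inj: "inj_on e {0..<n}" using e by (auto simp: bij_betw_def)
  define e' where "e' = inv_into {0..<n} e"
  have e': "e' (e i) = i" if "i < n" for i
    using that inj by (simp add: e'_def inv_into_f_f)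
  have e'V: "e' v \<in> {0..<n} \<and> e (e' v) = v" if "v \<in> V" for v
    using that im unfolding e'_def by (metis f_inv_into_f inv_into_into)
  define f where "f i m j = (of_bool (i = j) - of_bool (mv (e i) m = e j) :: real)" for i m j
  define G where "G = ({0..<n} \<rightarrow>\<^sub>E (UNIV :: 'd set))"
  have finG: "finite G" unfolding G_def by (intro finite_PiE) auto
  have "Determinant.det ?M = (\<Sum>p\<in>{p. p permutes {0..<n}}. signof p * (\<Prod>i = 0..<n. ?M $$ (i, p i)))"
    by (rule det_def') simp
  also have "\<dots> = (\<Sum>p\<in>{p. p permutes {0..<n}}. signof p * (\<Sum>g\<in>G. \<Prod>i = 0..<n. f i (g i) (p i)))"
  proof (rule sum.cong[OF refl])
    fix p assume "p \<in> {p. p permutes {0..<n}}"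
    then have "p i < n" if "i < n" for i
      using permutes_in_image[of p "{0..<n}" i] that by simp
    then have "(\<Prod>i = 0..<n. ?M $$ (i, p i)) = (\<Prod>i = 0..<n. \<Sum>m\<in>UNIV. f i m (p i))"
      by (intro prod.cong) (auto simp: f_def)
    also have "\<dots> = (\<Sum>g\<in>G. \<Prod>i = 0..<n. f i (g i) (p i))"
      unfolding G_def by (rule prod_sum_PiE) auto
    finally show "signof p * (\<Prod>i = 0..<n. ?M $$ (i, p i)) = signof p * (\<Sum>g\<in>G. \<Prod>i = 0..<n. f i (g i) (p i))"
      by simp
  qed
  also have "\<dots> = (\<Sum>g\<in>G. \<Sum>p\<in>{p. p permutes {0..<n}}. signof p * (\<Prod>i = 0..<n. f i (g i) (p i)))"
    by (simp add: sum_distrib_left sum.swap[of _ G])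
  also have "\<dots> = (\<Sum>g\<in>G. of_bool (escaping V (\<lambda>v. mv v (g (e' v)))))"
  proof (rule sum.cong[OF refl])
    fix g assume "g \<in> G"
    let ?N = "Matrix.mat n n (\<lambda>(i, j). of_bool (i = j) - of_bool (mv (e i) (g (e' (e i))) = e j)) :: real Matrix.mat"
    have "Determinant.det ?N = (\<Sum>p\<in>{p. p permutes {0..<n}}. signof p * (\<Prod>i = 0..<n. ?N $$ (i, p i)))"
      by (rule det_def') simp
    also have "\<dots> = (\<Sum>p\<in>{p. p permutes {0..<n}}. signof p * (\<Prod>i = 0..<n. f i (g i) (p i)))"
    proof (rule sum.cong[OF refl])
      fix p assume "p \<in> {p. p permutes {0..<n}}"
      then have "p i < n" if "i < n" for i
        using permutes_in_image[of p "{0..<n}" i] that by simp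
      then have "(\<Prod>i = 0..<n. ?N $$ (i, p i)) = (\<Prod>i = 0..<n. f i (g i) (p i))"
        by (intro prod.cong) (auto simp: f_def e')
      then show "signof p * (\<Prod>i = 0..<n. ?N $$ (i, p i)) = signof p * (\<Prod>i = 0..<n. f i (g i) (p i))"
        by simp
    qed
    finally show "(\<Sum>p\<in>{p. p permutes {0..<n}}. signof p * (\<Prod>i = 0..<n. f i (g i) (p i))) =
        of_bool (escaping V (\<lambda>v. mv v (g (e' v))))"
      using det_functional_laplacian[OF e, of "\<lambda>v. mv v (g (e' v))"] loopless by simp
  qed
  also have "\<dots> = real (card {g \<in> G. escaping V (\<lambda>v. mv v (g (e' v)))})"
    using finG by (simp add: of_bool_def sum.If_cases Int_def)
  also have "card {g \<in> G. escaping V (\<lambda>v. mv v (g (e' v)))} = card ?T"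
  proof (rule bij_betw_same_card, rule bij_betw_byWitness)
    have esc: "escaping V g \<longleftrightarrow> escaping V h" if "\<And>v. v \<in> V \<Longrightarrow> g v = h v" for g h :: "'v \<Rightarrow> 'v"
      unfolding escaping_def using that by (intro all_cong1 imp_cong arg_cong2[of _ _ _ _ "(\<longrightarrow>)"] refl) (auto simp: subset_iff)
    let ?f = "\<lambda>g. restrict (g \<circ> e') V" and ?h = "\<lambda>d. restrict (d \<circ> e) {0..<n}"
    show "\<forall>g\<in>{g \<in> G. escaping V (\<lambda>v. mv v (g (e' v)))}. ?h (?f g) = g"
      using e' im by (auto simp: G_def fun_eq_iff PiE_def extensional_def restrict_def)
    show "\<forall>d\<in>?T. ?f (?h d) = d"
      using e'V by (auto simp: fun_eq_iff PiE_def extensional_def restrict_def)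
    show "?f ` {g \<in> G. escaping V (\<lambda>v. mv v (g (e' v)))} \<subseteq> ?T"
    proof safe
      fix g assume "escaping V (\<lambda>v. mv v (g (e' v)))"
      then show "escaping V (\<lambda>v. mv v (?f g v))"
        by (subst esc[of _ "\<lambda>v. mv v (g (e' v))"]) auto
    qed auto
    show "?h ` ?T \<subseteq> {g \<in> G. escaping V (\<lambda>v. mv v (g (e' v)))}"
    proof safe
      fix d assume "d \<in> V \<rightarrow>\<^sub>E UNIV" "escaping V (\<lambda>v. mv v (d v))"
      then show "escaping V (\<lambda>v. mv v (?h d (e' v)))"
        using e'V by (subst esc[of _ "\<lambda>v. mv v (d v)"]) auto
    qed (auto simp: G_def)
  qed
  finally show ?thesis .
qed

text \<open>
  The unit steps upwards, to the right, downwards and to the left.  The first coordinate is the row,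
  counted from the top.  As directions are taken modulo 4, \<open>m + 1\<close> is the next direction in clockwise
  order and \<open>m + 2\<close> is the opposite direction.
\<close>

definition dvec :: "4 \<Rightarrow> int \<times> int" where
  "dvec m = (if m = 0 then (-1, 0) else if m = 1 then (0, 1) else if m = 2 then (1, 0) else (0, -1))"

lemma dvec_simps [simp]:
  "dvec 0 = (-1, 0)" "dvec 1 = (0, 1)" "dvec 2 = (1, 0)" "dvec 3 = (0, -1)"
  by (simp_all add: dvec_def)

lemma exhaust_4: "m = 0 \<or> m = 1 \<or> m = 2 \<or> m = (3::4)"
proof (cases m)
  case (of_int z)
  then have "z = 0 \<or> z = 1 \<or> z = 2 \<or> z = 3" by auto
  then show ?thesis using of_int by auto
qed

lemma UNIV_4: "(UNIV :: 4 set) = {0, 1, 2, 3}"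
  using exhaust_4 by auto

definition grid_box :: "nat \<Rightarrow> nat \<Rightarrow> (int \<times> int) set" where
  "grid_box k l = {1..int k} \<times> {1..int l}"

definition escaping_walks :: "nat \<Rightarrow> nat \<Rightarrow> (int \<times> int \<Rightarrow> 4) set" where
  "escaping_walks k l = {d \<in> grid_box k l \<rightarrow>\<^sub>E UNIV. escaping (grid_box k l) (\<lambda>v. v + dvec (d v))}"

text \<open>
  The eigenvectors of a path with \<open>m\<close> vertices with zero boundary values at \<open>0\<close> and \<open>m + 1\<close>.
\<close>

definition sine_mode :: "nat \<Rightarrow> int \<Rightarrow> int \<Rightarrow> real" where
  "sine_mode m x a = sin (pi * real_of_int x * real_of_int a / real (m + 1))"

lemma sine_mode_commute: "sine_mode m x a = sine_mode m a x"
  by (simp add: sine_mode_def mult_ac)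

lemma sine_mode_boundary: "sine_mode m 0 a = 0" "sine_mode m (int m + 1) a = 0"
proof -
  have "pi * real_of_int (int m + 1) * real_of_int a / real (m + 1) = real_of_int a * pi"
    by (simp add: field_simps)
  then show "sine_mode m (int m + 1) a = 0"
    unfolding sine_mode_def by (metis sin_zero_iff_int2)
qed (simp add: sine_mode_def)

lemma sine_mode_eigen:
  "sine_mode m (x - 1) a + sine_mode m (x + 1) a =
     2 * cos (pi * real_of_int a / real (m + 1)) * sine_mode m x a"
proof -
  define M y z where "M = real (m + 1)" and "y = pi * real_of_int x * real_of_int a / M" and "z = pi * real_of_int a / M"
  have "pi * real_of_int (x - 1) * real_of_int a / real (m + 1) = y - z"
       "pi * real_of_int (x + 1) * real_of_int a / real (m + 1) = y + z"
    unfolding M_def[symmetric] y_def z_def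
    by (simp_all add: algebra_simps add_divide_distrib diff_divide_distrib)
  then show ?thesis
    unfolding sine_mode_def M_def[symmetric] y_def[symmetric] z_def[symmetric]
    by (simp add: sin_add sin_diff)
qed

lemma sum_atLeast1_int: "(\<Sum>x\<in>{1..int m}. f x) = (\<Sum>x<m. f (int x + 1))"
  by (rule sum.reindex_bij_witness[of _ "\<lambda>x. int x + 1" "\<lambda>x. nat (x - 1)"]) auto

lemma prod_atLeast1_int: "(\<Prod>x\<in>{1..int m}. f x) = (\<Prod>x\<in>{1..m}. f (int x))"
  by (rule prod.reindex_bij_witness[of _ int nat]) auto

text \<open>
  Eigenvectors of a symmetric matrix for different eigenvalues are orthogonal: the difference of the
  eigenvalues times the inner product telescopes to boundary terms, which vanish.
\<close>

lemma sine_mode_orthogonal: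
  assumes ab: "a \<in> {1..int m}" "b \<in> {1..int m}"
  shows "(\<Sum>x\<in>{1..int m}. sine_mode m x a * sine_mode m x b) = 0 \<longleftrightarrow> a \<noteq> b"
proof (cases "a = b")
  case True
  have "0 < pi * real_of_int a / real (m + 1)" "pi * real_of_int a / real (m + 1) < pi"
    using ab by (auto simp: divide_less_eq)
  then have "sine_mode m 1 a > 0" unfolding sine_mode_def by (intro sin_gt_zero) auto
  then have "(\<Sum>x\<in>{1..int m}. sine_mode m x a * sine_mode m x a) > 0"
    using ab by (intro sum_pos2[of _ 1]) auto
  then show ?thesis using True by simp
next
  case False
  let ?c = "\<lambda>a. cos (pi * real_of_int a / real (m + 1))"
  define W where "W x = sine_mode m (int x + 1) a * sine_mode m (int x) b - sine_mode m (int x) a * sine_mode m (int x + 1) b" for x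
  have "W (Suc x) - W x = (2 * ?c a - 2 * ?c b) * (sine_mode m (int x + 1) a * sine_mode m (int x + 1) b)" for x
  proof -
    have rec: "sine_mode m (int x + 2) a = 2 * ?c a * sine_mode m (int x + 1) a - sine_mode m (int x) a"
         "sine_mode m (int x + 2) b = 2 * ?c b * sine_mode m (int x + 1) b - sine_mode m (int x) b"
      using sine_mode_eigen[of m "int x + 1" a] sine_mode_eigen[of m "int x + 1" b] by (simp_all add: algebra_simps)
    have shift: "int (Suc x) + 1 = int x + 2" "int (Suc x) = int x + 1" by simp_all
    have "(2 * c * p - q) * r - p * (2 * d * r - s) - (p * s - q * r) = (2 * c - 2 * d) * (p * r)"
      for c d p q r s :: real by (simp add: algebra_simps)
    then show ?thesis unfolding W_def unfolding shift(1) unfolding shift(2) rec by (simp only:)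
  qed
  then have "(2 * ?c a - 2 * ?c b) * (\<Sum>x\<in>{1..int m}. sine_mode m x a * sine_mode m x b) = (\<Sum>x<m. W (Suc x) - W x)"
    unfolding sum_atLeast1_int sum_distrib_left by simp
  also have "\<dots> = 0"
    unfolding sum_lessThan_telescope by (simp add: W_def sine_mode_boundary)
  finally have "2 * ?c a - 2 * ?c b = 0 \<or> (\<Sum>x\<in>{1..int m}. sine_mode m x a * sine_mode m x b) = 0" by simp
  moreover have "?c a \<noteq> ?c b"
  proof
    assume eq: "?c a = ?c b"
    have bd: "0 \<le> pi * real_of_int c / real (m + 1) \<and> pi * real_of_int c / real (m + 1) \<le> pi" if "c \<in> {1..int m}" for c
      using that by (auto simp: divide_le_eq)
    have "pi * real_of_int a / real (m + 1) = pi * real_of_int b / real (m + 1)"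
      by (rule cos_inj_pi) (use bd[OF ab(1)] bd[OF ab(2)] eq in simp_all)
    with False show False by (simp del: of_nat_add)
  qed
  ultimately show ?thesis using False by simp
qed

text \<open>
  The products of two sine modes are eigenvectors of the Laplacian \<open>L\<close>, so \<open>L * Q = Q * D\<close> for the
  symmetric matrix \<open>Q\<close> of these eigenvectors and a diagonal matrix \<open>D\<close>.  By orthogonality \<open>Q * Q\<close> is
  diagonal with nonzero diagonal entries; hence \<open>Q\<close> is invertible and \<open>L\<close> and \<open>D\<close> have the same
  determinant.
\<close>

theorem card_escaping_walks: "real (card (escaping_walks k l)) = laplacian_product k l"
proof -
  define n where "n = k * l"
  define e where "e u = (int (u div l) + 1, int (u mod l) + 1)" for u
  have e: "bij_betw e {0..<n} (grid_box k l)"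
  proof (rule bij_betw_byWitness[where f' = "\<lambda>(x, y). nat (x - 1) * l + nat (y - 1)"])
    show "\<forall>u\<in>{0..<n}. (case e u of (x, y) \<Rightarrow> nat (x - 1) * l + nat (y - 1)) = u"
      by (auto simp: e_def)
    show "\<forall>v\<in>grid_box k l. e (case v of (x, y) \<Rightarrow> nat (x - 1) * l + nat (y - 1)) = v"
      by (auto simp: e_def grid_box_def)
    show "e ` {0..<n} \<subseteq> grid_box k l"
    proof (rule image_subsetI)
      fix u assume u: "u \<in> {0..<n}"
      then have "l > 0" by (cases l) (auto simp: n_def)
      then have "u mod l < l" "u div l < k"
        using u by (auto simp: n_def less_mult_imp_div_less)
      then show "e u \<in> grid_box k l" by (auto simp: e_def grid_box_def)
    qed
    show "(\<lambda>(x, y). nat (x - 1) * l + nat (y - 1)) ` grid_box k l \<subseteq> {0..<n}"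
    proof (rule image_subsetI)
      fix v assume "v \<in> grid_box k l"
      obtain x y where v: "v = (x, y)" by fastforce
      with \<open>v \<in> grid_box k l\<close> have "nat (x - 1) \<le> k - 1" "nat (y - 1) < l" "k > 0" by (auto simp: grid_box_def)
      then have "nat (x - 1) * l + nat (y - 1) < (k - 1) * l + l"
        by (intro add_le_less_mono mult_right_mono) auto
      also have "\<dots> = n" using \<open>k > 0\<close> by (cases k) (auto simp: n_def)
      finally show "(case v of (x, y) \<Rightarrow> nat (x - 1) * l + nat (y - 1)) \<in> {0..<n}" by (simp add: v)
    qed
  qed
  have sum_e: "(\<Sum>j = 0..<n. f (e j)) = (\<Sum>v\<in>grid_box k l. f v)" for f :: "int \<times> int \<Rightarrow> real"
    by (rule sum.reindex_bij_betw[OF e])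
  have prod_e: "(\<Prod>j = 0..<n. f (e j)) = (\<Prod>v\<in>grid_box k l. f v)" for f :: "int \<times> int \<Rightarrow> real"
    by (rule prod.reindex_bij_betw[OF e])
  have inj: "e i = e j \<longleftrightarrow> i = j" if "i < n" "j < n" for i j
    using bij_betw_imp_inj_on[OF e] that by (auto dest: inj_onD)
  have ebox: "e i \<in> grid_box k l" if "i < n" for i
    using bij_betw_imp_surj_on[OF e] that by auto
  define \<phi> where "\<phi> v w = sine_mode k (fst v) (fst w) * sine_mode l (snd v) (snd w)" for v w
  define \<nu> where "\<nu> w = 4 - 2 * cos (pi * real_of_int (fst w) / real (k + 1)) - 2 * cos (pi * real_of_int (snd w) / real (l + 1))" for w :: "int \<times> int"
  define L where "L = Matrix.mat n n (\<lambda>(i, j). \<Sum>m\<in>UNIV. of_bool (i = j) - (of_bool (e i + dvec m = e j) :: real))"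
  define Q where "Q = Matrix.mat n n (\<lambda>(i, j). \<phi> (e i) (e j))"
  define D where "D = Matrix.mat n n (\<lambda>(i, j). of_bool (i = j) * \<nu> (e j))"
  have carrier: "L \<in> carrier_mat n n" "Q \<in> carrier_mat n n" "D \<in> carrier_mat n n"
    by (simp_all add: L_def Q_def D_def)
  (* A step out of the box leads to a zero of the sines, so the truncated sums are the full ones. *)
  have outside: "\<phi> (v + dvec m) w = 0" if "v \<in> grid_box k l" "v + dvec m \<notin> grid_box k l" for v m w
  proof -
    have "fst (v + dvec m) = 0 \<or> fst (v + dvec m) = int k + 1 \<or> snd (v + dvec m) = 0 \<or> snd (v + dvec m) = int l + 1"
      using that exhaust_4[of m] by (cases v) (auto simp: grid_box_def)
    then show ?thesis unfolding \<phi>_def by (elim disjE) (simp_all add: sine_mode_boundary)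
  qed
  have "L * Q = Q * D"
  proof (rule eq_matI)
    fix i j assume "i < dim_row (Q * D)" "j < dim_col (Q * D)"
    then have ij: "i < n" "j < n" using carrier by auto
    have "(L * Q) $$ (i, j) = (\<Sum>t = 0..<n. (\<Sum>m\<in>UNIV. of_bool (i = t) - of_bool (e i + dvec m = e t)) * \<phi> (e t) (e j))"
      using ij by (simp add: L_def Q_def scalar_prod_def)
    also have "\<dots> = (\<Sum>t = 0..<n. (\<Sum>m\<in>UNIV. of_bool (e i = e t) - of_bool (e i + dvec m = e t)) * \<phi> (e t) (e j))"
      using ij by (intro sum.cong refl) (simp add: inj)
    also have "\<dots> = (\<Sum>v\<in>grid_box k l. (\<Sum>m\<in>UNIV. of_bool (e i = v) - of_bool (e i + dvec m = v)) * \<phi> v (e j))"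
      by (rule sum_e)
    also have "\<dots> = (\<Sum>m\<in>UNIV. \<Sum>v\<in>grid_box k l. of_bool (e i = v) * \<phi> v (e j) - of_bool (e i + dvec m = v) * \<phi> v (e j))"
      unfolding sum_distrib_right by (subst sum.swap) (simp add: left_diff_distrib)
    also have "\<dots> = (\<Sum>m\<in>UNIV. \<phi> (e i) (e j) - \<phi> (e i + dvec m) (e j))"
    proof (rule sum.cong[OF refl])
      fix m :: 4
      have fin: "finite (grid_box k l)" by (simp add: grid_box_def)
      have pick: "(\<Sum>v\<in>grid_box k l. of_bool (u = v) * f v) = (if u \<in> grid_box k l then f u else 0)" for u and f :: "int \<times> int \<Rightarrow> real"
        using fin by (simp add: of_bool_def if_distrib[of "\<lambda>x. x * _"] sum.delta cong: if_cong)
      show "(\<Sum>v\<in>grid_box k l. of_bool (e i = v) * \<phi> v (e j) - of_bool (e i + dvec m = v) * \<phi> v (e j)) =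
          \<phi> (e i) (e j) - \<phi> (e i + dvec m) (e j)"
        unfolding sum_subtractf pick using ebox[OF ij(1)] outside[of "e i" m "e j"] by auto
    qed
    also have "\<dots> = \<nu> (e j) * \<phi> (e i) (e j)"
    proof -
      obtain x y where xy: "e i = (x, y)" by fastforce
      obtain a b where ab: "e j = (a, b)" by fastforce
      have "(\<Sum>m\<in>UNIV. \<phi> (e i) (e j) - \<phi> (e i + dvec m) (e j)) = 4 * (sine_mode k x a * sine_mode l y b) -
          (sine_mode k (x - 1) a + sine_mode k (x + 1) a) * sine_mode l y b -
          sine_mode k x a * (sine_mode l (y - 1) b + sine_mode l (y + 1) b)"
        unfolding UNIV_4 \<phi>_def xy ab by (simp add: distrib_left distrib_right)
      also have "\<dots> = \<nu> (e j) * \<phi> (e i) (e j)"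
        unfolding sine_mode_eigen \<phi>_def \<nu>_def xy ab by (simp add: left_diff_distrib)
      finally show ?thesis .
    qed
    also have "\<dots> = (\<Sum>t = 0..<n. of_bool (t = j) * (\<phi> (e i) (e t) * \<nu> (e j)))"
      using ij by (simp add: of_bool_def if_distrib[of "\<lambda>x. x * _"] sum.delta mult.commute cong: if_cong)
    also have "\<dots> = (Q * D) $$ (i, j)"
      using ij by (simp add: D_def Q_def scalar_prod_def mult_ac)
    finally show "(L * Q) $$ (i, j) = (Q * D) $$ (i, j)" .
  qed (use carrier in auto)
  then have "Determinant.det L * Determinant.det Q = Determinant.det Q * Determinant.det D"
    using carrier by (metis det_mult)
  moreover have "Determinant.det Q \<noteq> 0"
  proof -
    have QQ: "(Q * Q) $$ (i, j) = (\<Sum>x\<in>{1..int k}. sine_mode k x (fst (e i)) * sine_mode k x (fst (e j))) *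
        (\<Sum>y\<in>{1..int l}. sine_mode l y (snd (e i)) * sine_mode l y (snd (e j)))" if "i < n" "j < n" for i j
    proof -
      have "(Q * Q) $$ (i, j) = (\<Sum>t = 0..<n. \<phi> (e i) (e t) * \<phi> (e t) (e j))"
        using that by (simp add: Q_def scalar_prod_def)
      also have "\<dots> = (\<Sum>v\<in>grid_box k l. \<phi> (e i) v * \<phi> v (e j))"
        by (rule sum_e)
      also have "\<dots> = (\<Sum>x\<in>{1..int k}. \<Sum>y\<in>{1..int l}. (sine_mode k x (fst (e i)) * sine_mode k x (fst (e j))) *
          (sine_mode l y (snd (e i)) * sine_mode l y (snd (e j))))"
        unfolding grid_box_def sum.cartesian_product
        by (intro sum.cong) (auto simp: \<phi>_def sine_mode_commute[of _ "fst (e i)"] sine_mode_commute[of _ "snd (e i)"])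
      also have "\<dots> = (\<Sum>x\<in>{1..int k}. sine_mode k x (fst (e i)) * sine_mode k x (fst (e j))) *
          (\<Sum>y\<in>{1..int l}. sine_mode l y (snd (e i)) * sine_mode l y (snd (e j)))"
        by (rule sum_product[symmetric])
      finally show ?thesis .
    qed
    have co: "fst (e i) \<in> {1..int k}" "snd (e i) \<in> {1..int l}" if "i < n" for i
      using ebox[OF that] by (auto simp: grid_box_def mem_Times_iff)
    have QQ0: "(Q * Q) $$ (i, j) = 0 \<longleftrightarrow> i \<noteq> j" if "i < n" "j < n" for i j
      unfolding QQ[OF that] mult_eq_0_iff sine_mode_orthogonal[OF co(1)[OF that(1)] co(1)[OF that(2)]]
        sine_mode_orthogonal[OF co(2)[OF that(1)] co(2)[OF that(2)]]
      using inj[OF that] by (auto simp: prod_eq_iff)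
    have QQc: "Q * Q \<in> carrier_mat n n" using carrier by auto
    have "Determinant.det (Q * Q) = prod_list (diag_mat (Q * Q))"
      using QQ0 carrier(2) by (intro det_upper_triangular[OF _ QQc] upper_triangularI) auto
    also have "\<dots> = (\<Prod>i = 0..<n. (Q * Q) $$ (i, i))"
      using carrier(2) by (simp add: prod_list_diag_prod)
    also have "\<dots> \<noteq> 0" using QQ0 by simp
    finally have "Determinant.det (Q * Q) \<noteq> 0" .
    then show ?thesis using det_mult[OF carrier(2) carrier(2)] by auto
  qed
  ultimately have "Determinant.det L = Determinant.det D" by simp
  also have "\<dots> = prod_list (diag_mat D)"
    using carrier by (intro det_upper_triangular[of _ n] upper_triangularI) (auto simp: D_def)
  also have "\<dots> = (\<Prod>i = 0..<n. \<nu> (e i))"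
    by (simp add: prod_list_diag_prod D_def)
  also have "\<dots> = (\<Prod>v\<in>grid_box k l. \<nu> v)" by (rule prod_e)
  also have "\<dots> = (\<Prod>x\<in>{1..int k}. \<Prod>y\<in>{1..int l}. \<nu> (x, y))"
    unfolding grid_box_def by (simp add: prod.cartesian_product)
  also have "\<dots> = laplacian_product k l"
    unfolding prod_atLeast1_int laplacian_product_def \<nu>_def by simp
  finally have "Determinant.det L = laplacian_product k l" .
  moreover have "Determinant.det L = real (card (escaping_walks k l))"
    unfolding L_def escaping_walks_def
  proof (rule det_laplacian_counts_escaping[OF e])
    fix v m show "v + dvec m \<noteq> v"
      using exhaust_4[of m] by (cases v) (auto simp: zero_prod_def)
  qed
  ultimately show ?thesis by simp
qed

section \<open>Matchings between the cells and the edges of the grid\<close>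

lemma numeral_mod_4 [simp]: "(4::4) = 0" "(5::4) = 1" "(6::4) = 2" "(-1::4) = 3" "(-2::4) = 2" "(-3::4) = 1"
  by simp_all

lemma all_4: "(\<forall>m::4. P m) \<longleftrightarrow> P 0 \<and> P 1 \<and> P 2 \<and> P 3"
  by (metis exhaust_4)

lemma dvec_opposite: "dvec (m + 2) = - dvec m"
  using exhaust_4[of m] by auto

lemma exists_image_fixed_subset:
  assumes "finite I" "I \<noteq> {}" "f ` I \<subseteq> I"
  shows "\<exists>C\<subseteq>I. C \<noteq> {} \<and> f ` C = C"
  using assms
proof (induction I rule: finite_psubset_induct)
  case (psubset I)
  show ?case
  proof (cases "f ` I = I")
    case False
    with psubset.prems(2) have "f ` I \<subset> I" by (simp add: psubset_eq)
    moreover have "f ` I \<noteq> {}" "f ` f ` I \<subseteq> f ` I"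
      using psubset.prems by (simp_all add: image_mono)
    ultimately obtain C where "C \<subseteq> f ` I" "C \<noteq> {}" "f ` C = C" using psubset.IH by metis
    with order.trans[OF \<open>C \<subseteq> f ` I\<close> psubset.prems(2)] show ?thesis by auto
  next
    case True
    with psubset.prems(1) show ?thesis by auto
  qed
qed

text \<open>
  The grid in doubled coordinates: a vertex is a point with even coordinates, a face is a point with
  odd coordinates, and an edge is a point whose coordinates have different parity.  Doing this makes
  vertices and faces two instances of the same notion, so that arguments about primal and dual
  cycles need to be given only once.
\<close>

definition rect :: "nat \<Rightarrow> nat \<Rightarrow> (int \<times> int) set" where
  "rect k l = {2..2 * int k} \<times> {2..2 * int l}"

text \<open>
  The vertices and the inner faces, without the bottom left vertex, which is the root of the trees.
\<close>

definition cells :: "nat \<Rightarrow> nat \<Rightarrow> (int \<times> int) set" where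
  "cells k l = {p \<in> rect k l. even (fst p + snd p)} - {(2 * int k, 2)}"

text \<open>
  If \<open>p\<close> points to an adjacent edge, then \<open>hop\<close> leads across this edge to the next cell of the same
  kind: from a vertex to a vertex, or from a face to a face.
\<close>

definition hop :: "(int \<times> int \<Rightarrow> 4) \<Rightarrow> int \<times> int \<Rightarrow> int \<times> int" where
  "hop \<delta> p = p + dvec (\<delta> p) + dvec (\<delta> p)"

lemma finite_cells: "finite (cells k l)"
  by (rule finite_subset[of _ "rect k l"]) (auto simp: cells_def rect_def)

lemma same_edge_cases:
  assumes "p + dvec m = q + dvec n" "even (fst p) = even (fst q)"
  shows "p = q \<and> m = n \<or> q = p + dvec m + dvec m \<and> n = m + 2"
proof -
  obtain x y x' y' where pq: "p = (x, y)" "q = (x', y')" by (meson surj_pair)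
  show ?thesis
    using exhaust_4[of m] exhaust_4[of n] assms unfolding pq by (elim disjE; simp; presburger)
qed

lemma hop_moves: "p + dvec m + dvec m \<noteq> p"
  using exhaust_4[of m] by (auto simp: prod_eq_iff)

lemma two_of_four_directions:
  assumes "a \<noteq> b" and "\<And>m::4. P m \<longleftrightarrow> m = a \<or> m = b"
  shows "(P 0 \<noteq> P 2) = (P 1 \<noteq> P 3)"
  unfolding assms(2) using assms(1) exhaust_4[of a] exhaust_4[of b] by (elim disjE) auto

text \<open>
  If no two cells point to the same edge, then there are no cycles of cells.  Suppose that \<open>C\<close> is a
  cycle (or a union of cycles) of cells of one kind, and let \<open>E\<close> be the set of edges that it uses.
  A cell of the other kind counts as inside if there is an odd number of edges in \<open>E\<close> below it in its
  column.  Every cell of the kind of \<open>C\<close> is incident with an even number of edges in \<open>E\<close>, so one gets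
  from inside to outside exactly by crossing edges in \<open>E\<close>.  Cells inside do not point to edges
  in \<open>E\<close>, because the cells in \<open>C\<close> already do; so hopping never leaves the inside and the inside
  contains a cycle.  It lies strictly above the lowest row that \<open>C\<close> reaches.  Repeating this with
  the roles of vertices and faces exchanged cannot go on forever.  The bottom left vertex is in the
  lowest row and thus never inside.
\<close>

lemma no_hop_cycle:
  assumes inj: "\<And>p q. p \<in> cells k l \<Longrightarrow> q \<in> cells k l \<Longrightarrow> p + dvec (\<delta> p) = q + dvec (\<delta> q) \<Longrightarrow> p = q"
    and "C \<subseteq> cells k l" "\<And>p. p \<in> C \<Longrightarrow> even (fst p) = \<kappa>" "hop \<delta> ` C = C"
  shows "C = {}"
proof -
  have "C = {}" if "C \<subseteq> cells k l" "\<forall>p\<in>C. even (fst p) = \<kappa>" "hop \<delta> ` C = C" "\<forall>p\<in>C. fst p \<le> int R" for R C \<kappa>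
    using that
  proof (induction R arbitrary: C \<kappa>)
    case 0
    then show ?case by (fastforce simp: cells_def rect_def)
  next
    case (Suc R)
    show ?case
    proof (rule ccontr)
      assume ne: "C \<noteq> {}"
      have fC: "finite C" using Suc.prems(1) finite_cells finite_subset by blast
      have inj_hop: "inj_on (hop \<delta>) C"
        using Suc.prems(3) fC by (intro eq_card_imp_inj_on) auto
      have evC: "even (fst p + snd p)" if "p \<in> C" for p
        using that Suc.prems(1) by (auto simp: cells_def)
      define E where "E = (\<lambda>p. p + dvec (\<delta> p)) ` C"
      have finE: "finite E" using fC by (simp add: E_def)
      have E_iff: "p + dvec m \<in> E \<longleftrightarrow> p \<in> C \<and> (m = \<delta> p \<or> (\<exists>q\<in>C. hop \<delta> q = p \<and> m = \<delta> q + 2))"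
        if p: "even (fst p) = \<kappa>" for p m
      proof
        assume "p + dvec m \<in> E"
        then obtain q where q: "q \<in> C" "q + dvec (\<delta> q) = p + dvec m" by (auto simp: E_def)
        then have "even (fst q) = even (fst p)" using p Suc.prems(2) by auto
        from same_edge_cases[OF q(2) this]
        show "p \<in> C \<and> (m = \<delta> p \<or> (\<exists>q\<in>C. hop \<delta> q = p \<and> m = \<delta> q + 2))"
        proof (elim disjE conjE)
          assume "p = q + dvec (\<delta> q) + dvec (\<delta> q)" "m = \<delta> q + 2"
          then show ?thesis using q(1) Suc.prems(3) by (auto simp: hop_def)
        qed (use q in auto)
      next
        assume *: "p \<in> C \<and> (m = \<delta> p \<or> (\<exists>q\<in>C. hop \<delta> q = p \<and> m = \<delta> q + 2))"
        then show "p + dvec m \<in> E"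
        proof (elim conjE disjE bexE)
          fix q assume q: "q \<in> C" "hop \<delta> q = p" "m = \<delta> q + 2"
          then have "p + dvec m = q + dvec (\<delta> q)" by (auto simp: hop_def dvec_opposite)
          with q(1) show ?thesis unfolding E_def by blast
        qed (auto simp: E_def)
      qed
      have degree: "((p + dvec 0 \<in> E) \<noteq> (p + dvec 2 \<in> E)) = ((p + dvec 1 \<in> E) \<noteq> (p + dvec 3 \<in> E))"
        if p: "even (fst p) = \<kappa>" for p
      proof (cases "p \<in> C")
        case True
        then obtain q where q: "q \<in> C" "hop \<delta> q = p" using Suc.prems(3) by force
        have neq: "\<delta> q + 2 \<noteq> \<delta> p"
        proof
          assume eq: "\<delta> q + 2 = \<delta> p"
          have "p + dvec (\<delta> q + 2) = q + dvec (\<delta> q)"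
            using q(2) by (auto simp: hop_def dvec_opposite)
          then have "p = q" using inj[of p q] True q Suc.prems(1) by (auto simp: eq)
          with q(2) show False by (simp add: hop_def hop_moves)
        qed
        have "p + dvec m \<in> E \<longleftrightarrow> m = \<delta> p \<or> m = \<delta> q + 2" for m
          unfolding E_iff[OF p] using True q inj_hop by (auto dest: inj_onD)
        with neq[symmetric] show ?thesis by (rule two_of_four_directions)
      next
        case False
        then show ?thesis by (simp add: E_iff[OF p] del: dvec_simps)
      qed
      have E_bounds: "x \<in> {2..2 * int k} \<and> y \<in> {2..2 * int l} \<and> odd (x + y) \<and> x \<le> int (Suc R)" if "(x, y) \<in> E" for x y
      proof -
        obtain p where p: "p \<in> C" "(x, y) = p + dvec (\<delta> p)"
          using \<open>(x, y) \<in> E\<close> unfolding E_def by blast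
        then have "hop \<delta> p \<in> C" using Suc.prems(3) by blast
        then have "p \<in> rect k l" "hop \<delta> p \<in> rect k l" "fst p \<le> int (Suc R)" "fst (hop \<delta> p) \<le> int (Suc R)"
          using p Suc.prems(1,4) by (auto simp: cells_def)
        then show ?thesis using p(2) evC[OF p(1)] exhaust_4[of "\<delta> p"]
          by (cases p) (auto simp: hop_def rect_def)
      qed
      (* Rows are counted from the top, so below means a larger first coordinate. *)
      define below where "below x y = {x'. x < x' \<and> (x', y) \<in> E}" for x y
      define ins where "ins x y = odd (card (below x y))" for x y
      have fin_below: "finite (below x y)" for x y
        by (rule finite_subset[OF _ finite_imageI[OF finE, of fst]]) (force simp: below_def)
      have vert: "ins x y = (ins (x + 2) y \<noteq> ((x + 1, y) \<in> E))" if "even (x + y)" for x y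
      proof -
        have "(x + 2, y) \<notin> E" using E_bounds that by fastforce
        then have "below x y = below (x + 2) y \<union> (if (x + 1, y) \<in> E then {x + 1} else {})"
          unfolding below_def by (auto simp: order_le_less) (smt (verit))+
        moreover have "x + 1 \<notin> below (x + 2) y" by (simp add: below_def)
        ultimately show ?thesis using fin_below by (auto simp: ins_def)
      qed
      have empty: "ins x y = False" if "below x y = {}" for x y
        using that by (simp add: ins_def)
      have hor: "(ins x y \<noteq> ins x (y + 2)) = ((x, y + 1) \<in> E)" if "even (x + y)" "even x \<noteq> \<kappa>" for x y
      proof -
        have "(ins x y \<noteq> ins x (y + 2)) = ((x, y + 1) \<in> E)"
          if "even (x + y)" "even x \<noteq> \<kappa>" "x + 2 * int n > 2 * int k" for n x
          using that
        proof (induction n arbitrary: x)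
          case 0
          then have "below x y = {}" "below x (y + 2) = {}" "(x, y + 1) \<notin> E"
            using E_bounds by (fastforce simp: below_def)+
          then show ?case using empty by simp
        next
          case (Suc n)
          have "(ins (x + 2) y \<noteq> ins (x + 2) (y + 2)) = ((x + 2, y + 1) \<in> E)"
            using Suc.prems by (intro Suc.IH) auto
          moreover have "((x, y + 1) \<in> E) \<noteq> ((x + 2, y + 1) \<in> E) \<longleftrightarrow> ((x + 1, y + 2) \<in> E) \<noteq> ((x + 1, y) \<in> E)"
          proof -
            have "(x + 1, y + 1) + dvec 0 = (x, y + 1)" "(x + 1, y + 1) + dvec 1 = (x + 1, y + 2)"
              "(x + 1, y + 1) + dvec 2 = (x + 2, y + 1)" "(x + 1, y + 1) + dvec 3 = (x + 1, y)" by simp_all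
            note degree[of "(x + 1, y + 1)", unfolded this]
            then show ?thesis using Suc.prems by auto
          qed
          ultimately show ?case
            using vert[of x y] vert[of x "y + 2"] Suc.prems(1) by auto
        qed
        from this[of x "nat (2 * int k + 1 - x)"] that show ?thesis by auto
      qed
      define I where "I = {(x, y). even (x + y) \<and> even x \<noteq> \<kappa> \<and> ins x y}"
      have I_cells: "I \<subseteq> cells k l" and I_rows: "\<forall>p\<in>I. fst p \<le> int R"
      proof -
        have "(x, y) \<in> cells k l \<and> x \<le> int R" if xy: "even (x + y)" "even x \<noteq> \<kappa>" "ins x y" for x y
        proof -
          obtain x' where x': "x < x'" "(x', y) \<in> E"
            using empty[of x y] xy(3) by (auto simp: below_def)
          have "x \<ge> 2"
          proof (rule ccontr)
            assume "\<not> x \<ge> 2"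
            have "ins x (y + 2 * int n)" for n
            proof (induction n)
              case (Suc n)
              have "(x, y + 2 * int n + 1) \<notin> E" using E_bounds \<open>\<not> x \<ge> 2\<close> by fastforce
              then show ?case using hor[of x "y + 2 * int n"] xy Suc by (simp add: algebra_simps)
            qed (use xy in simp)
            from this[of l] obtain x'' where "(x'', y + 2 * int l) \<in> E"
              using empty[of x "y + 2 * int l"] by (auto simp: below_def)
            then show False using E_bounds[OF x'(2)] E_bounds[of x'' "y + 2 * int l"] by auto
          qed
          then show ?thesis using E_bounds[OF x'(2)] x'(1) xy by (auto simp: cells_def rect_def)
        qed
        then show "I \<subseteq> cells k l" "\<forall>p\<in>I. fst p \<le> int R" by (auto simp: I_def)
      qed
      have hop_I: "hop \<delta> ` I \<subseteq> I"
      proof (rule image_subsetI)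
        fix p assume p: "p \<in> I"
        obtain x y where xy: "p = (x, y)" by fastforce
        have "p \<notin> C" using p Suc.prems(2) by (auto simp: I_def)
        have "p + dvec (\<delta> p) \<notin> E"
        proof
          assume "p + dvec (\<delta> p) \<in> E"
          then obtain q where "q \<in> C" "p + dvec (\<delta> p) = q + dvec (\<delta> q)" by (auto simp: E_def)
          with inj[of p q] p I_cells Suc.prems(1) \<open>p \<notin> C\<close> show False by auto
        qed
        moreover have "even (x + y)" "even x \<noteq> \<kappa>" "ins x y" using p by (auto simp: I_def xy)
        moreover have "ins (x - 2) y = (ins x y \<noteq> ((x - 1, y) \<in> E))" "ins x y = (ins (x + 2) y \<noteq> ((x + 1, y) \<in> E))"
          using vert[of "x - 2" y] vert[of x y] calculation(2) by simp_all
        moreover have "(ins x (y - 2) \<noteq> ins x y) = ((x, y - 1) \<in> E)" "(ins x y \<noteq> ins x (y + 2)) = ((x, y + 1) \<in> E)"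
          using hor[of x "y - 2"] hor[of x y] calculation(2,3) by simp_all
        ultimately show "hop \<delta> p \<in> I"
          using exhaust_4[of "\<delta> p"] unfolding I_def xy
          by (elim disjE) (simp_all add: hop_def add.commute[of 2 x] add.commute[of 2 y])
      qed
      have I_ne: "I \<noteq> {}"
      proof -
        obtain p where p: "p \<in> C" using ne by blast
        obtain x y where xy: "p = (x, y)" by fastforce
        have "p + dvec (\<delta> p) \<in> E" using p by (auto simp: E_def)
        then have "(x - 1, y) \<in> E \<or> (x, y + 1) \<in> E \<or> (x + 1, y) \<in> E \<or> (x, y - 1) \<in> E"
          using exhaust_4[of "\<delta> p"] unfolding xy by (elim disjE) simp_all
        moreover have par: "even x = \<kappa>" "even (x + y)" using p xy Suc.prems(2) evC by force+
        moreover have "(x + 1, y + 1) \<in> I \<or> (x - 1, y + 1) \<in> I" if "(x, y + 1) \<in> E"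
          using that vert[of "x - 1" "y + 1"] par by (auto simp: I_def add.commute[of 1 x] add.commute[of 1 y])
        moreover have "(x + 1, y - 1) \<in> I \<or> (x - 1, y - 1) \<in> I" if "(x, y - 1) \<in> E"
          using that vert[of "x - 1" "y - 1"] par by (auto simp: I_def add.commute[of 1 x] add.commute[of 1 y])
        moreover have "(x - 1, y + 1) \<in> I \<or> (x - 1, y - 1) \<in> I" if "(x - 1, y) \<in> E"
          using that hor[of "x - 1" "y - 1"] par by (auto simp: I_def add.commute[of 1 x] add.commute[of 1 y])
        moreover have "(x + 1, y + 1) \<in> I \<or> (x + 1, y - 1) \<in> I" if "(x + 1, y) \<in> E"
          using that hor[of "x + 1" "y - 1"] par by (auto simp: I_def add.commute[of 1 x] add.commute[of 1 y])
        ultimately have "\<exists>f. f \<in> I" by (elim disjE) auto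
        then show ?thesis by auto
      qed
      have "finite I" using I_cells finite_cells by (rule finite_subset)
      from exists_image_fixed_subset[OF this I_ne hop_I]
      obtain C' where "C' \<subseteq> I" "C' \<noteq> {}" "hop \<delta> ` C' = C'" by auto
      moreover have "C' = {}"
      proof (rule Suc.IH)
        show "C' \<subseteq> cells k l" using \<open>C' \<subseteq> I\<close> I_cells by (rule order.trans)
        show "\<forall>p\<in>C'. even (fst p) = (\<not> \<kappa>)" using \<open>C' \<subseteq> I\<close> by (auto simp: I_def)
        show "\<forall>p\<in>C'. fst p \<le> int R" using \<open>C' \<subseteq> I\<close> I_rows by blast
      qed fact
      ultimately show False by simp
    qed
  qed
  moreover have "\<forall>p\<in>C. fst p \<le> int (2 * k)"
    using assms(2) by (force simp: cells_def rect_def)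
  ultimately show ?thesis using assms(2-4) by metis
qed


lemma card_even_odd_coordinates:
  "card {x\<in>{2..2 * int k}. even x} = k" "card {x\<in>{2..2 * int k}. odd x} = k - 1"
proof -
  have "{x\<in>{2..2 * int k}. even x} = (\<lambda>i. 2 * i) ` {1..int k}"
  proof (intro equalityI subsetI)
    fix x assume "x \<in> {x\<in>{2..2 * int k}. even x}"
    then show "x \<in> (\<lambda>i. 2 * i) ` {1..int k}" by (intro image_eqI[of _ _ "x div 2"]) auto
  qed auto
  then show "card {x\<in>{2..2 * int k}. even x} = k" by (simp add: card_image inj_on_def)
  have "{x\<in>{2..2 * int k}. odd x} = (\<lambda>i. 2 * i + 1) ` {1..int k - 1}"
  proof (intro equalityI subsetI)
    fix x assume "x \<in> {x\<in>{2..2 * int k}. odd x}"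
    then show "x \<in> (\<lambda>i. 2 * i + 1) ` {1..int k - 1}"
      by (intro image_eqI[of _ _ "(x - 1) div 2"]) (auto elim!: oddE)
  qed auto
  then show "card {x\<in>{2..2 * int k}. odd x} = k - 1" by (simp add: card_image inj_on_def)
qed

text \<open>
  \<open>k l + (k - 1) (l - 1) - 1 = k (l - 1) + (k - 1) l\<close>.
\<close>

lemma card_cells_eq_edges:
  assumes "1 \<le> k" "1 \<le> l"
  shows "card (cells k l) = card {e \<in> rect k l. odd (fst e + snd e)}"
proof -
  let ?E = "\<lambda>n. {x\<in>{2..2 * int n}. even x}" and ?O = "\<lambda>n. {x\<in>{2..2 * int n}. odd x}"
  have fin: "finite (?E n)" "finite (?O n)" for n
    by (rule finite_subset[of _ "{2..2 * int n}"]; auto)+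
  have "insert (2 * int k, 2) (cells k l) = ?E k \<times> ?E l \<union> ?O k \<times> ?O l"
    using assms by (auto simp: cells_def rect_def)
  moreover have "card (?E k \<times> ?E l \<union> ?O k \<times> ?O l) = k * l + (k - 1) * (l - 1)"
    by (subst card_Un_disjoint)
      (use fin in \<open>auto simp only: finite_cartesian_product card_cartesian_product card_even_odd_coordinates\<close>)
  moreover have "(2 * int k, 2) \<notin> cells k l" by (simp add: cells_def)
  ultimately have c: "Suc (card (cells k l)) = k * l + (k - 1) * (l - 1)"
    using card_insert_disjoint[OF finite_cells, of "(2 * int k, 2)" k l] by metis
  have "{e \<in> rect k l. odd (fst e + snd e)} = ?E k \<times> ?O l \<union> ?O k \<times> ?E l"
    by (auto simp: rect_def)
  moreover have "card (?E k \<times> ?O l \<union> ?O k \<times> ?E l) = k * (l - 1) + (k - 1) * l"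
    by (subst card_Un_disjoint)
      (use fin in \<open>auto simp only: finite_cartesian_product card_cartesian_product card_even_odd_coordinates\<close>)
  moreover obtain k' l' where "k = Suc k'" "l = Suc l'" using assms by (metis Suc_le_D One_nat_def)
  ultimately show ?thesis using c by simp
qed

text \<open>
  The edges that are not used by a spanning tree form a spanning tree of the dual graph, rooted at
  the outer face.  If some faces could not reach the outer face without crossing tree edges, then the
  edges that separate these bad faces from the others would be tree edges, an even number of them
  at each vertex.  So from each vertex whose tree edge is separating one could go backwards along a
  separating tree edge, which is impossible in a finite forest.  Hence every face can point along a
  shortest path to the outer face.  No two cells point to the same edge then, and as there are as
  many cells as edges, all edges are used.
\<close>

lemma dual_orientation:
  assumes kl: "1 \<le> k" "1 \<le> l"
    and inrect: "\<And>p. p \<in> cells k l \<Longrightarrow> even (fst p) \<Longrightarrow> p + dvec (a p) \<in> rect k l"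
    and esc: "escaping {p \<in> cells k l. even (fst p)} (hop a)"
  obtains \<delta> where "\<And>p. p \<in> cells k l \<Longrightarrow> even (fst p) \<Longrightarrow> \<delta> p = a p"
    and "inj_on (\<lambda>p. p + dvec (\<delta> p)) (cells k l)"
    and "(\<lambda>p. p + dvec (\<delta> p)) ` cells k l = {e \<in> rect k l. odd (fst e + snd e)}"
proof -
  define V where "V = {p \<in> cells k l. even (fst p)}"
  define F where "F = {p \<in> cells k l. odd (fst p)}"
  define T where "T = (\<lambda>p. p + dvec (a p)) ` V"
  define step where "step S = S \<union> {f \<in> F. \<exists>m. f + dvec m \<notin> T \<and> f + dvec m + dvec m \<in> S}" for S
  (* Level n: the outside and the faces that reach it by crossing at most n edges, none in T. *)
  define level where "level n = (step ^^ n) (- F)" for n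
  have level_simps: "level 0 = - F" "level (Suc n) = step (level n)" for n
    by (simp_all add: level_def)
  have finV: "finite V" and finF: "finite F"
    using finite_cells by (simp_all add: V_def F_def)
  define Bad where "Bad = F - (\<Union>n. level n)"
  have Bad_step: "f + dvec m + dvec m \<in> Bad" if f: "f \<in> Bad" "f + dvec m \<notin> T" for f m
  proof (rule ccontr)
    assume "f + dvec m + dvec m \<notin> Bad"
    then obtain n where "f + dvec m + dvec m \<in> level n"
      using level_simps(1) by (auto simp: Bad_def)
    then have "f \<in> level (Suc n)" using f unfolding level_simps step_def Bad_def by blast
    then show False using f by (auto simp: Bad_def)
  qed
  define bd where "bd v m \<longleftrightarrow> (v + dvec m + dvec (m + 1) \<in> Bad) \<noteq> (v + dvec m + dvec (m - 1) \<in> Bad)" for v m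
  have opp: "dvec (m - 1) = - dvec (m + 1)" for m
    using exhaust_4[of m] by auto
  have bd_T: "v + dvec m \<in> T" if "bd v m" for v m
  proof (rule ccontr)
    assume nT: "v + dvec m \<notin> T"
    from that consider "v + dvec m + dvec (m + 1) \<in> Bad" "v + dvec m + dvec (m - 1) \<notin> Bad"
      | "v + dvec m + dvec (m - 1) \<in> Bad" "v + dvec m + dvec (m + 1) \<notin> Bad"
      unfolding bd_def by blast
    then show False
    proof cases
      case 1
      show ?thesis using Bad_step[of "v + dvec m + dvec (m + 1)" "m - 1"] 1 nT
        by (simp add: opp)
    next
      case 2
      show ?thesis using Bad_step[of "v + dvec m + dvec (m - 1)" "m + 1"] 2 nT
        by (simp add: opp)
    qed
  qed
  define U where "U = {v \<in> V. bd v (a v)}"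
  have "U \<subseteq> hop a ` U"
  proof
    fix v assume v: "v \<in> U"
    have "\<exists>m. m \<noteq> a v \<and> bd v m"
    proof (rule ccontr)
      define c where "c m \<longleftrightarrow> v + dvec m + dvec (m + 1) \<in> Bad" for m
      have c: "bd v m \<longleftrightarrow> c m \<noteq> c (m - 1)" for m
        by (simp add: bd_def c_def add.assoc add.commute[of "dvec m" "dvec (m - 1)"])
      assume "\<nexists>m. m \<noteq> a v \<and> bd v m"
      then have "\<forall>m. m = a v \<or> c m = c (m - 1)" using c by blast
      moreover have "c (a v) \<noteq> c (a v - 1)" using v c by (auto simp: U_def)
      ultimately show False
        unfolding all_4 using exhaust_4[of "a v"] by auto
    qed
    then obtain m where m: "m \<noteq> a v" "bd v m" by blast
    from bd_T[OF m(2)] obtain u where u: "u \<in> V" "v + dvec m = u + dvec (a u)" by (auto simp: T_def)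
    have ev: "even (fst v) = even (fst u)" using u(1) v by (auto simp: U_def V_def)
    have "u = v + dvec m + dvec m" "a u = m + 2"
      using same_edge_cases[OF u(2) ev] m(1) by auto
    moreover have "dvec (m + 2 + 1) = dvec (m - 1)" "dvec (m + 2 - 1) = dvec (m + 1)"
      using exhaust_4[of m] by auto
    ultimately have "hop a u = v" "bd u (a u)"
      using m(2) by (auto simp: hop_def bd_def dvec_opposite)
    then show "v \<in> hop a ` U" using u(1) by (force simp: U_def)
  qed
  moreover have "finite U" using finV by (simp add: U_def)
  ultimately have "U = hop a ` U"
    by (intro card_seteq) (auto simp: card_image_le)
  moreover have "U \<subseteq> V" by (auto simp: U_def)
  ultimately have "U = {}"
    using esc unfolding escaping_def V_def by blast
  have "Bad = {}"
  proof (rule ccontr)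
    assume ne: "Bad \<noteq> {}"
    have fin: "finite Bad" using finF by (simp add: Bad_def)
    then have "Max (snd ` Bad) \<in> snd ` Bad" using ne by (intro Max_in) auto
    then obtain f where f: "f \<in> Bad" "snd f = Max (snd ` Bad)" by auto
    have nb: "f + dvec 1 + dvec 1 \<notin> Bad"
    proof
      assume "f + dvec 1 + dvec 1 \<in> Bad"
      then have "snd (f + dvec 1 + dvec 1) \<le> snd f" unfolding f(2) using fin by (intro Max_ge imageI) auto
      then show False by simp
    qed
    with Bad_step f have "f + dvec 1 \<in> T" by blast
    then obtain v where v: "v \<in> V" "f + dvec 1 = v + dvec (a v)" by (auto simp: T_def)
    have "odd (fst f)" "even (fst v)" using f v(1) by (auto simp: Bad_def F_def V_def)
    obtain x y where xy: "v = (x, y)" by fastforce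
    obtain x' y' where xy': "f = (x', y')" by fastforce
    have "bd v (a v)"
      using exhaust_4[of "a v"] v(2) f(1) nb \<open>odd (fst f)\<close> \<open>even (fst v)\<close> unfolding xy xy'
      by (elim disjE) (auto simp: bd_def)
    with v(1) \<open>U = {}\<close> show False unfolding U_def by blast
  qed
  define rank where "rank f = (LEAST n. f \<in> level n)" for f
  have rank: "\<exists>m. f + dvec m \<notin> T \<and> rank (f + dvec m + dvec m) < rank f" if f: "f \<in> F" for f
  proof -
    from f \<open>Bad = {}\<close> obtain n where "f \<in> level n" by (auto simp: Bad_def)
    then have in_rank: "f \<in> level (rank f)" unfolding rank_def by (rule LeastI)
    have "f \<notin> level 0" using f by (simp add: level_simps)
    with in_rank obtain r where r: "rank f = Suc r" by (cases "rank f") auto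
    then have "f \<notin> level r" using not_less_Least[of r "\<lambda>n. f \<in> level n"] by (simp add: rank_def)
    with in_rank r obtain m where "f + dvec m \<notin> T" "f + dvec m + dvec m \<in> level r"
      by (auto simp: level_simps step_def)
    moreover from this have "rank (f + dvec m + dvec m) \<le> r" unfolding rank_def by (intro Least_le)
    ultimately show ?thesis using r by (auto intro!: exI[of _ m])
  qed
  define \<delta> where "\<delta> p = (if even (fst p) then a p else SOME m. p + dvec m \<notin> T \<and> rank (p + dvec m + dvec m) < rank p)" for p
  have \<delta>F: "p + dvec (\<delta> p) \<notin> T \<and> rank (p + dvec (\<delta> p) + dvec (\<delta> p)) < rank p" if "p \<in> F" for p
    using someI_ex[OF rank[OF that]] that by (simp add: \<delta>_def F_def)
  have \<delta>V: "\<delta> p = a p" if "p \<in> V" for p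
    using that by (simp add: \<delta>_def V_def)
  have VF: "p \<in> V \<or> p \<in> F" if "p \<in> cells k l" for p
    using that by (auto simp: V_def F_def)
  have inj: "inj_on (\<lambda>p. p + dvec (\<delta> p)) (cells k l)"
  proof (rule inj_onI, rule ccontr)
    fix p q assume pq: "p \<in> cells k l" "q \<in> cells k l" "p + dvec (\<delta> p) = q + dvec (\<delta> q)" "p \<noteq> q"
    consider "p \<in> V" "q \<in> V" | "p \<in> F" "q \<in> F" | "p \<in> V" "q \<in> F" | "p \<in> F" "q \<in> V"
      using VF pq by blast
    then show False
    proof cases
      case 1
      then have "even (fst p) = even (fst q)" by (auto simp: V_def)
      from same_edge_cases[OF pq(3) this] same_edge_cases[OF pq(3)[symmetric] this[symmetric]] pq(4)
      have "hop a p = q" "hop a q = p" using \<delta>V[OF 1(1)] \<delta>V[OF 1(2)] by (auto simp: hop_def)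
      then have "hop a ` {p, q} \<subseteq> {p, q}" by auto
      moreover have "{p, q} \<subseteq> {p \<in> cells k l. even (fst p)}" using 1 by (simp add: V_def)
      ultimately have "{p, q} = {}" using esc unfolding escaping_def by metis
      then show False by simp
    next
      case 2
      then have "even (fst p) = even (fst q)" by (auto simp: F_def)
      from same_edge_cases[OF pq(3) this] same_edge_cases[OF pq(3)[symmetric] this[symmetric]] pq(4)
      have "q = p + dvec (\<delta> p) + dvec (\<delta> p)" "p = q + dvec (\<delta> q) + dvec (\<delta> q)" by auto
      with \<delta>F[OF 2(1)] \<delta>F[OF 2(2)] show False by (metis order_less_asym)
    next
      case 3
      have "p + dvec (a p) \<in> T" unfolding T_def using 3(1) by (rule imageI)
      with \<delta>F[OF 3(2)] \<delta>V[OF 3(1)] pq(3) show False by simp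
    next
      case 4
      have "q + dvec (a q) \<in> T" unfolding T_def using 4(2) by (rule imageI)
      with \<delta>F[OF 4(1)] \<delta>V[OF 4(2)] pq(3) show False by simp
    qed
  qed
  have "(\<lambda>p. p + dvec (\<delta> p)) ` cells k l = {e \<in> rect k l. odd (fst e + snd e)}"
  proof (rule card_subset_eq)
    show "finite {e \<in> rect k l. odd (fst e + snd e)}" by (simp add: rect_def)
    show "card ((\<lambda>p. p + dvec (\<delta> p)) ` cells k l) = card {e \<in> rect k l. odd (fst e + snd e)}"
      using card_image[OF inj] card_cells_eq_edges[OF kl] by simp
    show "(\<lambda>p. p + dvec (\<delta> p)) ` cells k l \<subseteq> {e \<in> rect k l. odd (fst e + snd e)}"
    proof (rule image_subsetI)
      fix p assume p: "p \<in> cells k l"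
      have "p + dvec (\<delta> p) \<in> rect k l"
      proof (cases "even (fst p)")
        case True
        then show ?thesis using inrect[OF p True] by (simp add: \<delta>_def)
      next
        case False
        obtain x y where xy: "p = (x, y)" by fastforce
        have "odd x" "odd y" "2 \<le> x" "x \<le> 2 * int k" "2 \<le> y" "y \<le> 2 * int l"
          using p False by (auto simp: xy cells_def rect_def)
        then have "3 \<le> x" "x \<le> 2 * int k - 1" "3 \<le> y" "y \<le> 2 * int l - 1" by presburger+
        then show ?thesis using exhaust_4[of "\<delta> p"] by (auto simp: xy rect_def)
      qed
      moreover have "odd (fst (p + dvec (\<delta> p)) + snd (p + dvec (\<delta> p)))"
        using p exhaust_4[of "\<delta> p"] by (auto simp: cells_def)
      ultimately show "p + dvec (\<delta> p) \<in> {e \<in> rect k l. odd (fst e + snd e)}" by simp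
    qed
  qed
  then show thesis using that[of \<delta>] inj by (simp add: \<delta>_def)
qed


text \<open>
  On a rectangle, a closed discrete 1-form is exact.
\<close>

lemma discrete_potential:
  fixes H V :: "int \<Rightarrow> int \<Rightarrow> 'a::ab_group_add"
  assumes closed: "\<And>r c. 1 \<le> r \<Longrightarrow> r < m \<Longrightarrow> 1 \<le> c \<Longrightarrow> c < n \<Longrightarrow> H r c + V r (c + 1) = V r c + H (r + 1) c"
  obtains \<Lambda> where "\<Lambda> 1 1 = z"
    and "\<And>r c. 1 \<le> c \<Longrightarrow> \<Lambda> r (c + 1) = \<Lambda> r c + H r c"
    and "\<And>r c. 1 \<le> r \<Longrightarrow> r < m \<Longrightarrow> 1 \<le> c \<Longrightarrow> c \<le> n \<Longrightarrow> \<Lambda> (r + 1) c = \<Lambda> r c + V r c"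
proof -
  define \<Lambda> where "\<Lambda> r c = z + (\<Sum>i\<in>{1..<r}. V i 1) + (\<Sum>j\<in>{1..<c}. H r j)" for r c
  have insert: "{1..<i + 1} = insert i {1..<i}" if "1 \<le> i" for i :: int
    using that by auto
  have hor: "\<Lambda> r (c + 1) = \<Lambda> r c + H r c" if "1 \<le> c" for r c
    unfolding \<Lambda>_def insert[OF that] by simp
  have "\<Lambda> (r + 1) c = \<Lambda> r c + V r c" if "1 \<le> r" "r < m" "1 \<le> c" "c \<le> n" for r c
    using that(3,4)
  proof (induction c rule: int_ge_induct)
    case base
    then show ?case unfolding \<Lambda>_def insert[OF that(1)] by simp
  next
    case (step c)
    then have "\<Lambda> (r + 1) (c + 1) = \<Lambda> r c + (V r c + H (r + 1) c)" by (simp add: hor)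
    also have "V r c + H (r + 1) c = H r c + V r (c + 1)" using closed[of r c] that step by simp
    also have "\<Lambda> r c + \<dots> = \<Lambda> r (c + 1) + V r (c + 1)" using step by (simp add: hor)
    finally show ?case .
  qed
  moreover have "\<Lambda> 1 1 = z" by (simp add: \<Lambda>_def)
  ultimately show thesis using that hor by blast
qed

text \<open>
  The face on the left of the dart that leaves \<open>v\<close> in direction \<open>m\<close>, in doubled coordinates.
\<close>

definition left_face :: "int \<times> int \<Rightarrow> 4 \<Rightarrow> int \<times> int" where
  "left_face v m = v + v + dvec m + dvec (m - 1)"

text \<open>
  Three of the summands are 1, and \<open>3 = 0\<close> in the colors.  This is what makes the labels below well
  defined, both around cells and around edges.
\<close>

lemma of_bool_sum_3:
  assumes "\<exists>!m::4. P m"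
  shows "of_bool (\<not> P 0) + of_bool (\<not> P 1) + of_bool (\<not> P 2) + of_bool (\<not> P 3) = (0::3)"
proof -
  obtain a where "\<And>m. P m \<longleftrightarrow> m = a" using assms by metis
  then show ?thesis using exhaust_4[of a] by auto
qed

text \<open>
  The labels live on the unit squares of the doubled grid; each of them is a corner at one vertex,
  and corner \<open>m\<close> at a vertex lies between the directions \<open>m\<close> and \<open>m + 1\<close>.  Neighboring squares are
  separated by a segment from a cell to an edge.  Clockwise around the cell, the label is to increase
  by 1 at this segment, unless the cell points to the edge.  The increments add up to 0 around a
  cell, which points to one of its four edges, and around an edge, to which one of its four cells
  points.  So the labels exist as a potential.

  The choice \<open>2\<close> for the top left label makes the darts that leave the grid get the colors of the
  special vertices to which they lead, if the dart in direction \<open>m\<close> is given the color \<open>lab v m + 1\<close>.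
\<close>

lemma corner_labelling:
  assumes kl: "1 \<le> k" "1 \<le> l"
    and inj: "inj_on (\<lambda>p. p + dvec (\<delta>\<^sub>0 p)) (cells k l)"
    and im: "(\<lambda>p. p + dvec (\<delta>\<^sub>0 p)) ` cells k l = {e \<in> rect k l. odd (fst e + snd e)}"
  obtains \<delta> and lab :: "int \<times> int \<Rightarrow> 4 \<Rightarrow> 3" where
    "\<And>p. p \<in> cells k l \<Longrightarrow> \<delta> p = \<delta>\<^sub>0 p" "\<delta> (2 * int k, 2) = 2"
    "\<And>v m. v \<in> grid_box k l \<Longrightarrow> lab v m = lab v (m - 1) + of_bool (m \<noteq> \<delta> (v + v))"
    "\<And>v m. v \<in> grid_box k l \<Longrightarrow> v + dvec m \<in> grid_box k l \<Longrightarrow>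
       lab (v + dvec m) (m + 2) = lab v (m - 1) - of_bool (\<delta> (left_face v m) \<noteq> m + 1)"
    "\<And>v m. v \<in> grid_box k l \<Longrightarrow> v + dvec m \<in> grid_box k l \<Longrightarrow>
       \<exists>!n. \<delta> (v + v + dvec m + dvec n) = n + 2"
    "\<And>j. (1, j) \<in> grid_box k l \<Longrightarrow> lab (1, j) 0 = 0" "\<And>i. (i, int l) \<in> grid_box k l \<Longrightarrow> lab (i, int l) 0 = 0"
    "\<And>j. (int k, j) \<in> grid_box k l \<Longrightarrow> lab (int k, j) 1 = 1" "\<And>i. (i, 1) \<in> grid_box k l \<Longrightarrow> lab (i, 1) 3 = 2"
proof -
  (* Everything outside points away from the grid, so that also the edges at the border have
     four adjacent cells exactly one of which points to them. *)
  define \<delta> where "\<delta> p = (if p \<in> cells k l then \<delta>\<^sub>0 p else if p = (2 * int k, 2) then 2 else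
    if fst p < 2 then 0 else if fst p > 2 * int k then 2 else if snd p < 2 then 3 else 1)" for p
  have ex1: "\<exists>!n. \<delta> (e + dvec n) = n + 2" if e: "e \<in> rect k l" "odd (fst e + snd e)" for e
  proof -
    have "e \<in> (\<lambda>p. p + dvec (\<delta>\<^sub>0 p)) ` cells k l" using e im by auto
    then obtain p where p: "p \<in> cells k l" "e = p + dvec (\<delta>\<^sub>0 p)" by auto
    have "\<delta> (e + dvec n) = n + 2 \<longleftrightarrow> n = \<delta>\<^sub>0 p + 2" for n
    proof
      assume n: "\<delta> (e + dvec n) = n + 2"
      let ?q = "e + dvec n"
      have "?q \<in> cells k l"
      proof (rule ccontr)
        assume nc: "?q \<notin> cells k l"
        obtain x y where xy: "e = (x, y)" by fastforce
        have "?q = (2 * int k, 2) \<or> ?q \<notin> rect k l"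
          using nc e(2) exhaust_4[of n] by (auto simp: cells_def)
        moreover have "n + 2 = (if ?q = (2 * int k, 2) then 2 else if fst ?q < 2 then 0
            else if fst ?q > 2 * int k then 2 else if snd ?q < 2 then 3 else 1)"
          using nc n by (simp add: \<delta>_def)
        ultimately show False using e(1) exhaust_4[of n] unfolding xy rect_def
          by (elim disjE) (simp_all split: if_splits)
      qed
      moreover from this n have "?q + dvec (\<delta>\<^sub>0 ?q) = e"
        by (simp add: \<delta>_def dvec_opposite)
      ultimately have "?q = p" using p inj[unfolded inj_on_def] by metis
      then have "\<delta>\<^sub>0 p = n + 2" using n p(1) by (simp add: \<delta>_def)
      then show "n = \<delta>\<^sub>0 p + 2" by (simp add: add.assoc)
    next
      assume "n = \<delta>\<^sub>0 p + 2"
      then show "\<delta> (e + dvec n) = n + 2" using p by (simp add: \<delta>_def dvec_opposite add.assoc)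
    qed
    then show ?thesis by metis
  qed
  have in_rect: "p + dvec (\<delta> p) \<in> rect k l" if "p \<in> cells k l" for p
    using im that by (auto simp: \<delta>_def)
  (* H and V are the increments to the right and downwards; the sign says whether the cell at the
     end of the crossed segment is passed clockwise. *)
  define H :: "int \<Rightarrow> int \<Rightarrow> 3" where "H r c = (if even (r + c + 1) then - of_bool (\<delta> (r, c + 1) \<noteq> 2) else of_bool (\<delta> (r + 1, c + 1) \<noteq> 0))" for r c
  define V :: "int \<Rightarrow> int \<Rightarrow> 3" where "V r c = (if even (r + c + 1) then of_bool (\<delta> (r + 1, c) \<noteq> 1) else - of_bool (\<delta> (r + 1, c + 1) \<noteq> 3))" for r c
  have "H r c + V r (c + 1) = V r c + H (r + 1) c" if rc: "1 \<le> r" "r < 2 * int k" "1 \<le> c" "c < 2 * int l" for r c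
  proof (cases "even (r + c)")
    case True
    then show ?thesis using exhaust_4[of "\<delta> (r + 1, c + 1)"]
      by (elim disjE) (simp_all add: H_def V_def)
  next
    case False
    have "\<exists>!n. \<delta> ((r + 1, c + 1) + dvec n) = n + 2"
      by (rule ex1) (use rc False in \<open>auto simp: rect_def\<close>)
    from of_bool_sum_3[OF this] have sum: "of_bool (\<delta> (r, c + 1) \<noteq> 2) + of_bool (\<delta> (r + 1, c + 1 + 1) \<noteq> 3) +
        of_bool (\<delta> (r + 1 + 1, c + 1) \<noteq> 0) + of_bool (\<delta> (r + 1, c) \<noteq> 1) = (0::3)"
      by (simp only: dvec_simps) simp
    have arith: "- a - b = d + c" if "a + b + c + d = 0" for a b c d :: 3
    proof -
      have "- a - b = (a + b + c + d) - a - b" unfolding that by simp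
      then show ?thesis by simp
    qed
    show ?thesis using arith[OF sum] False by (simp only: H_def V_def) simp
  qed
  then obtain \<Lambda> where \<Lambda>1: "\<Lambda> 1 1 = 2"
    and \<Lambda>H: "\<And>r c. 1 \<le> c \<Longrightarrow> \<Lambda> r (c + 1) = \<Lambda> r c + H r c"
    and \<Lambda>V: "\<And>r c. 1 \<le> r \<Longrightarrow> r < 2 * int k \<Longrightarrow> 1 \<le> c \<Longrightarrow> c \<le> 2 * int l \<Longrightarrow> \<Lambda> (r + 1) c = \<Lambda> r c + V r c"
    by (rule discrete_potential[of "2 * int k" "2 * int l" H V 2]; blast)
  define lab where "lab v m = \<Lambda> (2 * fst v - of_bool (m = 0 \<or> m = 3)) (2 * snd v - of_bool (m = 2 \<or> m = 3))" for v and m :: 4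
  have lab_simps: "lab (i, j) 0 = \<Lambda> (2 * i - 1) (2 * j)" "lab (i, j) 1 = \<Lambda> (2 * i) (2 * j)"
     "lab (i, j) 2 = \<Lambda> (2 * i) (2 * j - 1)" "lab (i, j) 3 = \<Lambda> (2 * i - 1) (2 * j - 1)" for i j
    by (simp_all add: lab_def)
  have around: "\<Lambda> (2 * i - 1) (2 * j) = \<Lambda> (2 * i - 1) (2 * j - 1) + of_bool (\<delta> (2 * i, 2 * j) \<noteq> 0)"
      "\<Lambda> (2 * i) (2 * j) = \<Lambda> (2 * i - 1) (2 * j) + of_bool (\<delta> (2 * i, 2 * j) \<noteq> 1)"
      "\<Lambda> (2 * i) (2 * j) = \<Lambda> (2 * i) (2 * j - 1) - of_bool (\<delta> (2 * i, 2 * j) \<noteq> 2)"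
      "\<Lambda> (2 * i) (2 * j - 1) = \<Lambda> (2 * i - 1) (2 * j - 1) - of_bool (\<delta> (2 * i, 2 * j) \<noteq> 3)"
    if "(i, j) \<in> grid_box k l" for i j
    using that \<Lambda>H[of "2 * j - 1" "2 * i - 1"] \<Lambda>V[of "2 * i - 1" "2 * j"] \<Lambda>H[of "2 * j - 1" "2 * i"] \<Lambda>V[of "2 * i - 1" "2 * j - 1"]
    by (auto simp: H_def V_def grid_box_def algebra_simps)
  have across_h: "\<Lambda> (2 * i - 1) (2 * j + 1) = \<Lambda> (2 * i - 1) (2 * j) - of_bool (\<delta> (2 * i - 1, 2 * j + 1) \<noteq> 2)"
      "\<Lambda> (2 * i) (2 * j + 1) = \<Lambda> (2 * i) (2 * j) + of_bool (\<delta> (2 * i + 1, 2 * j + 1) \<noteq> 0)"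
    if "1 \<le> j" for i j
    using that \<Lambda>H[of "2 * j" "2 * i - 1"] \<Lambda>H[of "2 * j" "2 * i"]
    by (auto simp: H_def algebra_simps)
  have across_v: "\<Lambda> (2 * i + 1) (2 * j) = \<Lambda> (2 * i) (2 * j) - of_bool (\<delta> (2 * i + 1, 2 * j + 1) \<noteq> 3)"
      "\<Lambda> (2 * i + 1) (2 * j - 1) = \<Lambda> (2 * i) (2 * j - 1) + of_bool (\<delta> (2 * i + 1, 2 * j - 1) \<noteq> 1)"
    if "1 \<le> i" "i < int k" "(i, j) \<in> grid_box k l" for i j
    using that \<Lambda>V[of "2 * i" "2 * j"] \<Lambda>V[of "2 * i" "2 * j - 1"]
    by (auto simp: V_def grid_box_def algebra_simps)
  show thesis
  proof (rule that[of \<delta> lab])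
    show "\<delta> p = \<delta>\<^sub>0 p" if "p \<in> cells k l" for p using that by (simp add: \<delta>_def)
    show root: "\<delta> (2 * int k, 2) = 2" by (simp add: \<delta>_def cells_def)
    show "lab v m = lab v (m - 1) + of_bool (m \<noteq> \<delta> (v + v))" if "v \<in> grid_box k l" for v m
    proof (cases v)
      case (Pair i j)
      then show ?thesis using that around[of i j] exhaust_4[of m]
        by (elim disjE) (simp_all add: lab_simps eq_commute[of _ "\<delta> _"])
    qed
    show "lab (v + dvec m) (m + 2) = lab v (m - 1) - of_bool (\<delta> (left_face v m) \<noteq> m + 1)"
      if "v \<in> grid_box k l" "v + dvec m \<in> grid_box k l" for v m
    proof (cases v)
      case (Pair i j)
      then show ?thesis using that across_h[of j i] across_h[of "j - 1" i] across_v[of i j] across_v[of "i - 1" j] exhaust_4[of m]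
        by (elim disjE) (simp_all add: lab_simps left_face_def grid_box_def algebra_simps)
    qed
    show "\<exists>!n. \<delta> (v + v + dvec m + dvec n) = n + 2"
      if "v \<in> grid_box k l" "v + dvec m \<in> grid_box k l" for v m
      by (rule ex1) (use that exhaust_4[of m] in \<open>cases v; auto simp: grid_box_def rect_def\<close>)+
    have no_up: "\<delta> (2, 2 * j) \<noteq> 0" if "1 \<le> j" "j \<le> int l" for j
      using that in_rect[of "(2, 2 * j)"] kl root
      by (cases "(2, 2 * j) \<in> cells k l") (auto simp: rect_def cells_def)
    have top: "\<Lambda> 1 (2 * j - 1) = 2 \<and> \<Lambda> 1 (2 * j) = 0" if "1 \<le> j" "j \<le> int l" for j
      using that
    proof (induction j rule: int_ge_induct)
      case base
      then show ?case using \<Lambda>1 around(1)[of 1 1] no_up[of 1] kl by (simp add: grid_box_def)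
    next
      case (step j)
      have "\<delta> (1, 2 * j + 1) = 0" by (simp add: \<delta>_def cells_def rect_def) presburger
      then show ?case using step across_h(1)[of j 1] around(1)[of 1 "j + 1"] no_up[of "j + 1"] kl
        by (simp add: grid_box_def algebra_simps)
    qed
    then show "lab (1, j) 0 = 0" if "(1, j) \<in> grid_box k l" for j
      using that by (auto simp: grid_box_def lab_simps)
    have no_right: "\<delta> (2 * i, 2 * int l) \<noteq> 1" if "1 \<le> i" "i \<le> int k" for i
      using that in_rect[of "(2 * i, 2 * int l)"] kl root
      by (cases "(2 * i, 2 * int l) \<in> cells k l") (auto simp: rect_def cells_def)
    have right: "\<Lambda> (2 * i - 1) (2 * int l) = 0" if "1 \<le> i" "i \<le> int k" for i
      using that
    proof (induction i rule: int_ge_induct)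
      case base
      then show ?case using top[of "int l"] kl by simp
    next
      case (step i)
      have "\<delta> (2 * i + 1, 2 * int l + 1) = 1" using step kl by (auto simp: \<delta>_def cells_def rect_def)
      then show ?case using step across_v(1)[of i "int l"] around(2)[of i "int l"] no_right[of i] kl
        by (simp add: grid_box_def algebra_simps)
    qed
    then show "lab (i, int l) 0 = 0" if "(i, int l) \<in> grid_box k l" for i
      using that by (auto simp: grid_box_def lab_simps)
    have no_left: "\<delta> (2 * i, 2) \<noteq> 3" if "1 \<le> i" "i \<le> int k" for i
      using that in_rect[of "(2 * i, 2)"] kl root
      by (cases "(2 * i, 2) \<in> cells k l") (auto simp: rect_def cells_def)
    have left: "\<Lambda> (2 * i - 1) 1 = 2 \<and> \<Lambda> (2 * i) 1 = 1" if "1 \<le> i" "i \<le> int k" for i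
      using that
    proof (induction i rule: int_ge_induct)
      case base
      then show ?case using \<Lambda>1 around(4)[of 1 1] no_left[of 1] kl by (simp add: grid_box_def)
    next
      case (step i)
      have "\<delta> (2 * i + 1, 1) = 3" using step kl by (auto simp: \<delta>_def cells_def rect_def)
      then show ?case using step across_v(2)[of i 1] around(4)[of "i + 1" 1] no_left[of "i + 1"] kl
        by (simp add: grid_box_def algebra_simps)
    qed
    then show "lab (i, 1) 3 = 2" if "(i, 1) \<in> grid_box k l" for i
      using that by (auto simp: grid_box_def lab_simps)
    have no_down: "\<delta> (2 * int k, 2 * j) \<noteq> 2" if "1 < j" "j \<le> int l" for j
      using that in_rect[of "(2 * int k, 2 * j)"] kl
      by (cases "(2 * int k, 2 * j) \<in> cells k l") (auto simp: rect_def cells_def)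
    have bottom: "\<Lambda> (2 * int k) (2 * j) = 1" if "1 \<le> j" "j \<le> int l" for j
      using that
    proof (induction j rule: int_ge_induct)
      case base
      then show ?case using left[of "int k"] around(3)[of "int k" 1] root kl by (simp add: grid_box_def)
    next
      case (step j)
      have "\<delta> (2 * int k + 1, 2 * j + 1) = 2" using kl by (auto simp: \<delta>_def cells_def rect_def)
      then show ?case using step across_h(2)[of j "int k"] around(3)[of "int k" "j + 1"] no_down[of "j + 1"] kl
        by (simp add: grid_box_def algebra_simps)
    qed
    then show "lab (int k, j) 1 = 1" if "(int k, j) \<in> grid_box k l" for j
      using that by (auto simp: grid_box_def lab_simps)
  qed
qed

section \<open>The rotation system of the augmented grid\<close>

lemma funpow_dist_cyclic_list:
  assumes d: "distinct xs" and step: "\<And>a. a < length xs \<Longrightarrow> f (xs ! a) = xs ! (Suc a mod length xs)"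
    and ab: "a < length xs" "b < length xs"
  shows "funpow_dist f (xs ! a) (xs ! b) = (if a \<le> b then b - a else b + length xs - a)"
proof -
  let ?n = "length xs"
  have pow: "(f ^^ t) (xs ! a) = xs ! ((a + t) mod ?n)" for t
  proof (induction t)
    case (Suc t)
    have "(a + t) mod ?n < ?n" using ab by (intro mod_less_divisor) auto
    then show ?case using Suc step by (simp add: mod_Suc_eq)
  qed (use ab in simp)
  have eq: "(f ^^ t) (xs ! a) = xs ! b \<longleftrightarrow> (a + t) mod ?n = b" for t
    unfolding pow using d ab by (subst nth_eq_iff_index_eq) (auto intro: mod_less_divisor)
  show ?thesis unfolding funpow_dist_def eq
  proof (rule Least_equality)
    show "(a + (if a \<le> b then b - a else b + ?n - a)) mod ?n = b" using ab by auto
    fix t assume t: "(a + t) mod ?n = b"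
    have "a + t = ?n * ((a + t) div ?n) + b" using t by (metis mult_div_mod_eq)
    then show "(if a \<le> b then b - a else b + ?n - a) \<le> t"
      using ab by (cases "(a + t) div ?n") auto
  qed
qed

lemma cycle_of_list_nth:
  assumes "distinct xs" "a < length xs"
  shows "cycle_of_list xs (xs ! a) = xs ! (Suc a mod length xs)"
proof -
  have "map (cycle_of_list xs) xs = rotate1 xs"
    using cyclic_rotation[OF assms(1), of 1] by (simp add: rotate1_rotate_swap)
  then have "cycle_of_list xs (xs ! a) = rotate1 xs ! a" using assms(2) by (metis nth_map)
  then show ?thesis using assms(2) by (simp add: nth_rotate1)
qed

text \<open>
  The grid vertices are addressed by integer coordinates, so that the neighbors of a vertex are
  obtained by adding unit steps, also beyond the border of the grid.
\<close>

fun gv :: "int \<times> int \<Rightarrow> grid_vertex" where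
  "gv (i, j) = Grid (nat i) (nat j)"

text \<open>
  The special vertex next to the side of the grid in direction \<open>m\<close>: \<open>a\<^sub>3\<close> is adjacent to two sides.
\<close>

definition side :: "4 \<Rightarrow> 3" where
  "side m = (if m = 0 then 1 else if m = 1 then 2 else 3)"

definition nbr :: "nat \<Rightarrow> nat \<Rightarrow> int \<times> int \<Rightarrow> 4 \<Rightarrow> grid_vertex" where
  "nbr k l v m = (if v + dvec m \<in> grid_box k l then gv (v + dvec m) else Special (side m))"

lemma side_simps [simp]: "side 0 = 1" "side 1 = 2" "side 2 = 3" "side 3 = 3"
  by (simp_all add: side_def)

lemma gv_neq_Special [simp]: "gv u \<noteq> Special s" "Special s \<noteq> gv u"
  by (cases u; simp)+

definition dir_index :: "4 \<Rightarrow> nat" where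
  "dir_index m = (if m = 0 then 0 else if m = 1 then 1 else if m = 2 then 2 else 3)"

text \<open>
  The number of clockwise quarter turns from \<open>m\<close> to \<open>n\<close>.
\<close>

definition turn :: "4 \<Rightarrow> 4 \<Rightarrow> nat" where
  "turn m n = (if dir_index m \<le> dir_index n then dir_index n - dir_index m else dir_index n + 4 - dir_index m)"

lemma dir_index_simps [simp]: "dir_index 0 = 0" "dir_index 1 = 1" "dir_index 2 = 2" "dir_index 3 = 3"
  by (simp_all add: dir_index_def)

locale augmented_grid =
  fixes k l :: nat
  assumes kl: "2 \<le> k" "2 \<le> l"
begin

abbreviation "M \<equiv> aug_grid k l"
abbreviation "r \<equiv> aug_grid_root"
abbreviation "B \<equiv> grid_box k l"
abbreviation "N \<equiv> nbr k l"
abbreviation "corner \<equiv> (int k, 1 :: int)"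

text \<open>
  From the bottom left vertex, the directions 2 and 3 both lead to \<open>a\<^sub>3\<close>, by the same dart.
  Direction 3 is taken as its representative.
\<close>

definition canonical :: "int \<times> int \<Rightarrow> 4 \<Rightarrow> bool" where
  "canonical v m \<longleftrightarrow> \<not> (v = corner \<and> m = 2)"

lemma corner_in_B: "corner \<in> B" using kl by (simp add: grid_box_def)

lemma verts_M: "verts M = gv ` B \<union> range Special"
proof -
  have "{Grid i j |i j. i \<in> {1..k} \<and> j \<in> {1..l}} = gv ` B"
  proof (intro equalityI subsetI)
    fix x assume "x \<in> {Grid i j |i j. i \<in> {1..k} \<and> j \<in> {1..l}}"
    then obtain i j where "x = Grid i j" "i \<in> {1..k}" "j \<in> {1..l}" by auto
    then show "x \<in> gv ` B" by (intro image_eqI[of _ _ "(int i, int j)"]) (auto simp: grid_box_def)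
  qed (auto simp: grid_box_def)
  then show ?thesis by (simp add: aug_grid_def aug_grid_verts_def)
qed

lemma aug_grid_nbrs_gv:
  assumes v: "v \<in> B"
  shows "aug_grid_nbrs k l (gv v) = remdups [N v 0, N v 1, N v 2, N v 3]"
proof -
  obtain i j where ij: "v = (i, j)" by fastforce
  have b: "1 \<le> i" "i \<le> int k" "1 \<le> j" "j \<le> int l" using v by (auto simp: ij grid_box_def)
  have "N v 0 = (if nat i = 1 then Special 1 else Grid (nat i - 1) (nat j))"
    "N v 1 = (if nat j = l then Special 2 else Grid (nat i) (nat j + 1))"
    "N v 2 = (if nat i = k then Special 3 else Grid (nat i + 1) (nat j))"
    "N v 3 = (if nat j = 1 then Special 3 else Grid (nat i) (nat j - 1))"
    using b by (auto simp: nbr_def ij grid_box_def nat_diff_distrib nat_add_distrib)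
  then show ?thesis unfolding ij gv.simps aug_grid_nbrs.simps by simp
qed

lemma N_eq_iff:
  assumes "v \<in> B"
  shows "N v m = N v n \<longleftrightarrow> m = n \<or> v = corner \<and> m \<in> {2, 3} \<and> n \<in> {2, 3}"
proof -
  obtain i j where ij: "v = (i, j)" by fastforce
  show ?thesis
    using assms exhaust_4[of m] exhaust_4[of n] kl unfolding ij
    by (elim disjE) (auto simp: nbr_def grid_box_def)
qed

lemma aug_grid_nbrs_gv_cases:
  assumes v: "v \<in> B"
  shows "aug_grid_nbrs k l (gv v) =
    (if v = corner then [N v 0, N v 1, N v 3] else [N v 0, N v 1, N v 2, N v 3])"
  unfolding aug_grid_nbrs_gv[OF v] using N_eq_iff[OF v] by auto

lemma cw_gv:
  assumes v: "v \<in> B" and n: "canonical v n"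
  shows "cw M (gv v, N v n) = (gv v, N v (n + 1))"
proof -
  let ?xs = "aug_grid_nbrs k l (gv v)"
  have d: "distinct ?xs" by (rule distinct_aug_grid_nbrs)
  have 23: "N v 2 = N v 3" if "v = corner" using N_eq_iff[OF v, of 2 3] that by simp
  have "cycle_of_list ?xs (N v n) = N v (n + 1)"
  proof (cases "v = corner")
    case True
    then have xs: "?xs = [N v 0, N v 1, N v 3]" using aug_grid_nbrs_gv_cases[OF v] by simp
    have "cycle_of_list ?xs (?xs ! a) = ?xs ! (Suc a mod 3)" if "a < 3" for a
      using cycle_of_list_nth[OF d, of a] that xs by simp
    from this[of 0] this[of 1] this[of 2] show ?thesis
      using exhaust_4[of n] n True 23 unfolding xs canonical_def by auto
  next
    case False
    then have xs: "?xs = [N v 0, N v 1, N v 2, N v 3]" using aug_grid_nbrs_gv_cases[OF v] by simp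
    have "cycle_of_list ?xs (?xs ! a) = ?xs ! (Suc a mod 4)" if "a < 4" for a
      using cycle_of_list_nth[OF d, of a] that xs by simp
    from this[of 0] this[of 1] this[of 2] this[of 3] show ?thesis
      using exhaust_4[of n] unfolding xs by auto
  qed
  then show ?thesis by (simp add: aug_grid_def)
qed

lemma darts_iff: "(u, x) \<in> darts M \<longleftrightarrow> {u, x} \<in> aug_grid_edges k l"
  by (simp add: aug_grid_def)

lemma darts_from:
  assumes "u \<in> verts M"
  shows "(u, x) \<in> darts M \<longleftrightarrow> x \<in> set (aug_grid_nbrs k l u)"
  using assms kl set_aug_grid_nbrs[of k l u] by (simp add: aug_grid_def)

lemma darts_gv:
  assumes "v \<in> B"
  shows "(gv v, x) \<in> darts M \<longleftrightarrow> (\<exists>m. canonical v m \<and> x = N v m)"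
proof -
  have "gv v \<in> verts M" using assms unfolding verts_M by blast
  from darts_from[OF this, of x] have "(gv v, x) \<in> darts M \<longleftrightarrow> x \<in> {N v 0, N v 1, N v 2, N v 3}"
    unfolding aug_grid_nbrs_gv[OF assms] by (simp only: set_remdups list.set)
  also have "\<dots> \<longleftrightarrow> (\<exists>m\<in>{0, 1, 2, 3}. x = N v m)" by simp
  also have "\<dots> \<longleftrightarrow> (\<exists>m. canonical v m \<and> x = N v m)"
  proof
    assume "\<exists>m\<in>{0, 1, 2, 3}. x = N v m"
    then obtain m where m: "x = N v m" by blast
    show "\<exists>m. canonical v m \<and> x = N v m"
    proof (cases "canonical v m")
      case False
      then have "canonical v 3" "x = N v 3" using m N_eq_iff[OF assms, of 2 3] by (auto simp: canonical_def)
      then show ?thesis by blast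
    qed (use m in blast)
  next
    assume "\<exists>m. canonical v m \<and> x = N v m"
    then show "\<exists>m\<in>{0, 1, 2, 3}. x = N v m" using UNIV_4 by blast
  qed
  finally show ?thesis .
qed

lemma darts_swap: "(u, x) \<in> darts M \<longleftrightarrow> (x, u) \<in> darts M"
  by (simp add: darts_iff insert_commute)

lemma dart_org: "(u, x) \<in> darts M \<Longrightarrow> u \<in> verts M"
  using kl by (auto simp: aug_grid_def aug_grid_edges_def aug_grid_verts_def doubleton_eq_iff)

text \<open>
  The darts of the suspension at a vertex in clockwise order.  At a special vertex the half-edge
  comes first, so that positions in this list can be compared with the position of the half-edge.
\<close>

definition fan :: "grid_vertex \<Rightarrow> (grid_vertex \<times> grid_vertex) susp_dart list" where
  "fan u = (case u of Special i \<Rightarrow> [Half_Edge i] | _ \<Rightarrow> []) @ map (\<lambda>x. Dart (u, x)) (aug_grid_nbrs k l u)"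

lemma distinct_fan: "distinct (fan u)"
  by (cases u) (auto simp: fan_def distinct_map distinct_aug_grid_nbrs inj_on_def simp del: aug_grid_nbrs.simps)

lemma set_fan:
  assumes "u \<in> verts M"
  shows "set (fan u) = {x \<in> susp_darts M. susp_org M r x = u}"
  using darts_from[OF assms]
  by (cases u) (auto simp: fan_def susp_darts_def aug_grid_root_def aug_grid_def simp del: aug_grid_nbrs.simps)

lemma special_nbrs_ends:
  obtains xs where "aug_grid_nbrs k l (Special i) = Special (i + 1) # xs @ [Special (i - 1)]"
    "xs \<noteq> []" "set xs \<subseteq> range (case_prod Grid)"
proof -
  have "\<exists>xs. aug_grid_nbrs k l (Special i) = Special (i + 1) # xs @ [Special (i - 1)] \<and> xs \<noteq> [] \<and> set xs \<subseteq> range (case_prod Grid)"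
    using exhaust_3[of i]
  proof (elim disjE)
    assume i: "i = 1"
    show ?thesis using kl by (intro exI[of _ "map (\<lambda>j. Grid 1 j) (rev [1..<Suc l])"]) (auto simp: i)
  next
    assume i: "i = 2"
    show ?thesis using kl by (intro exI[of _ "map (\<lambda>i. Grid i l) (rev [1..<Suc k])"]) (auto simp: i)
  next
    assume i: "i = 3"
    show ?thesis using kl
      by (intro exI[of _ "map (\<lambda>i. Grid i 1) [1..<k] @ map (\<lambda>j. Grid k j) [1..<Suc l]"]) (auto simp: i)
  qed
  then show thesis using that by blast
qed

lemma fan_step:
  assumes u: "u \<in> verts M" and a: "a < length (fan u)"
  shows "susp_cw M r (fan u ! a) = fan u ! (Suc a mod length (fan u))"
proof -
  let ?xs = "aug_grid_nbrs k l u"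
  have d: "distinct ?xs" by (rule distinct_aug_grid_nbrs)
  have cw: "cw M (u, ?xs ! b) = (u, ?xs ! (Suc b mod length ?xs))" if "b < length ?xs" for b
    using cycle_of_list_nth[OF d that] by (simp add: aug_grid_def)
  show ?thesis
  proof (cases u)
    case (Grid i j)
    have "(u, x) \<notin> range r" for x by (auto simp: aug_grid_root_def Grid)
    moreover have "length ?xs > 0" using a by (auto simp add: fan_def Grid simp del: aug_grid_nbrs.simps)
    ultimately show ?thesis using a cw[of a]
      by (simp add: fan_def Grid del: aug_grid_nbrs.simps)
  next
    case (Special i)
    obtain ys where ys: "?xs = Special (i + 1) # ys @ [Special (i - 1)]"
      using special_nbrs_ends[of i] unfolding Special by metis
    let ?n = "length ?xs"
    have n: "?n > 0" unfolding ys by simp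
    have fan: "fan u = Half_Edge i # map (\<lambda>x. Dart (u, x)) ?xs"
      by (simp add: fan_def Special del: aug_grid_nbrs.simps)
    have rng: "(u, x) \<in> range r \<longleftrightarrow> x = ?xs ! 0" for x
      unfolding ys by (auto simp: aug_grid_root_def Special)
    have the: "(THE j. r j = (u, ?xs ! 0)) = i"
      unfolding ys by (rule the_equality) (auto simp: aug_grid_root_def Special)
    show ?thesis
    proof (cases a)
      case 0
      then show ?thesis unfolding fan using n ys by (simp add: aug_grid_root_def Special)
    next
      case (Suc b)
      then have b: "b < ?n" using a by (simp add: fan)
      show ?thesis
      proof (cases "Suc b = ?n")
        case True
        have "cw M (u, ?xs ! b) = (u, ?xs ! 0)" using cw[OF b] True by simp
        then have "susp_cw M r (Dart (u, ?xs ! b)) = Half_Edge i" using rng the by simp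
        moreover have "fan u ! a = Dart (u, ?xs ! b)" "fan u ! 0 = Half_Edge i"
          unfolding fan Suc using b by simp_all
        moreover have "Suc a mod length (fan u) = 0" using True unfolding fan Suc by simp
        ultimately show ?thesis by (simp only:)
      next
        case False
        then have "Suc b < ?n" using b by simp
        moreover have "?xs ! Suc b \<noteq> ?xs ! 0" using d \<open>Suc b < ?n\<close> n by (subst nth_eq_iff_index_eq) auto
        ultimately show ?thesis unfolding fan Suc using b cw[OF b] rng by simp
      qed
    qed
  qed
qed

lemma fan_dist:
  assumes "u \<in> verts M" "a < length (fan u)" "b < length (fan u)"
  shows "funpow_dist (susp_cw M r) (fan u ! a) (fan u ! b) = (if a \<le> b then b - a else b + length (fan u) - a)"
  using funpow_dist_cyclic_list[OF distinct_fan fan_step] assms by blast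

lemma fan_gv:
  assumes v: "v \<in> B"
  shows "fan (gv v) = map (\<lambda>m. Dart (gv v, N v m)) (if v = corner then [0, 1, 3] else [0, 1, 2, 3])"
  using aug_grid_nbrs_gv_cases[OF v] by (cases v) (auto simp: fan_def simp del: aug_grid_nbrs.simps)

text \<open>
  The bottom left vertex has only three darts, so distances differ from the numbers of quarter turns
  there.  But comparing distances from a common starting point depends on the cyclic order only.
\<close>

lemma dist_gv:
  assumes v: "v \<in> B" and ok: "canonical v m" "canonical v n" "canonical v p"
  shows "funpow_dist (susp_cw M r) (Dart (gv v, N v m)) (Dart (gv v, N v n)) \<le>
      funpow_dist (susp_cw M r) (Dart (gv v, N v m)) (Dart (gv v, N v p)) \<longleftrightarrow> turn m n \<le> turn m p"
proof -
  have u: "gv v \<in> verts M" using v verts_M by auto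
  show ?thesis
  proof (cases "v = corner")
    case True
    define c where "c m = (if m = 3 then 2 else dir_index m)" for m
    have "Dart (gv v, N v m) = fan (gv v) ! c m \<and> c m < length (fan (gv v))" if "canonical v m" for m
      using that exhaust_4[of m] True unfolding fan_gv[OF v] c_def canonical_def by auto
    moreover have "length (fan (gv v)) = 3" unfolding fan_gv[OF v] using True by simp
    ultimately have "funpow_dist (susp_cw M r) (Dart (gv v, N v m)) (Dart (gv v, N v n)) =
        (if c m \<le> c n then c n - c m else c n + 3 - c m)" if "canonical v m" "canonical v n" for m n
      using fan_dist[OF u, of "c m" "c n"] that by metis
    then show ?thesis
      using ok exhaust_4[of m] exhaust_4[of n] exhaust_4[of p] True
      by (simp add: canonical_def) (elim disjE; simp add: c_def turn_def)
  next
    case False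
    have "Dart (gv v, N v m) = fan (gv v) ! dir_index m \<and> dir_index m < length (fan (gv v))" for m
      using exhaust_4[of m] False unfolding fan_gv[OF v] by auto
    moreover have "length (fan (gv v)) = 4" unfolding fan_gv[OF v] using False by simp
    ultimately have "funpow_dist (susp_cw M r) (Dart (gv v, N v m)) (Dart (gv v, N v n)) = turn m n" for m n
      using fan_dist[OF u, of "dir_index m" "dir_index n"] unfolding turn_def by metis
    then show ?thesis by simp
  qed
qed

lemma dist_gv_self: "funpow_dist (susp_cw M r) x x = 0"
  by (rule funpow_dist_0) simp

lemma clockwise_gv:
  assumes v: "v \<in> B" and ok: "canonical v m" "canonical v n" "canonical v p"
  shows "clockwise M r (Dart (gv v, N v m)) (Dart (gv v, N v n)) (Dart (gv v, N v p)) \<longleftrightarrow>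
    0 < turn m n \<and> turn m n < turn m p"
  using dist_gv[OF v ok(1) ok(2) ok(1)] dist_gv[OF v ok(1) ok(3) ok(2)]
  by (auto simp: clockwise_def dist_gv_self turn_def)

lemma sector_gv:
  assumes v: "v \<in> B" and ok: "canonical v m" "canonical v n" "canonical v p"
  shows "in_cw_sector M r (Dart (gv v, N v m)) (Dart (gv v, N v n)) (Dart (gv v, N v p)) \<longleftrightarrow>
    turn m n \<le> turn m p"
  using dist_gv[OF assms] by (simp add: in_cw_sector_def)

end

section \<open>The vertex rule in local coordinates\<close>

text \<open>
  The colors of the darts at a grid vertex if \<open>a\<close> is the only direction in which no edge leaves and
  \<open>x\<close> is the color of the dart opposite to \<open>a\<close>.
\<close>

definition outcol :: "4 \<Rightarrow> 3 \<Rightarrow> 4 \<Rightarrow> 3 option" where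
  "outcol a x m = (if m = a then None else if m = a + 1 then Some (x - 1)
     else if m = a + 2 then Some x else Some (x + 1))"

lemma turn_cyclic:
  assumes "0 < turn (\<pi> 1) (\<pi> 2)" "turn (\<pi> 1) (\<pi> 2) < turn (\<pi> 1) (\<pi> (3::3))"
  obtains a x where "\<pi> x = a + 2" "\<pi> (x + 1) = a + 3" "\<pi> (x - 1) = a + 1"
proof -
  have "\<exists>a. \<pi> 1 = a + 1 \<and> \<pi> 2 = a + 2 \<and> \<pi> 3 = a + 3 \<or> \<pi> 1 = a + 2 \<and> \<pi> 2 = a + 3 \<and> \<pi> 3 = a + 1 \<or>
     \<pi> 1 = a + 3 \<and> \<pi> 2 = a + 1 \<and> \<pi> 3 = a + 2"
  proof -
    have "(\<forall>a. \<not> (p = a + 1 \<and> q = a + 2 \<and> s = a + 3 \<or> p = a + 2 \<and> q = a + 3 \<and> s = a + 1 \<or>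
       p = a + 3 \<and> q = a + 1 \<and> s = a + 2)) \<longrightarrow> \<not> (0 < turn p q \<and> turn p q < turn p s)" for p q s
      unfolding all_4 using exhaust_4[of p] exhaust_4[of q] exhaust_4[of s]
      by (elim disjE; simp add: turn_def)
    from this[of "\<pi> 1" "\<pi> 2" "\<pi> 3"] assms show ?thesis by blast
  qed
  then obtain a where "\<pi> 1 = a + 1 \<and> \<pi> 2 = a + 2 \<and> \<pi> 3 = a + 3 \<or> \<pi> 1 = a + 2 \<and> \<pi> 2 = a + 3 \<and> \<pi> 3 = a + 1 \<or>
     \<pi> 1 = a + 3 \<and> \<pi> 2 = a + 1 \<and> \<pi> 3 = a + 2" by blast
  moreover have "(2::3) + 1 = 3" "(3::3) + 1 = 1" "(1::3) - 1 = 3" "(1::3) + 1 = 2" "(2::3) - 1 = 1" "(3::3) - 1 = 2" by simp_all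
  ultimately show thesis
    using that[of 2 a] that[of 1 a] that[of 3 a] by metis
qed

lemma three_colors: "i = x \<or> i = x + 1 \<or> i = x - (1::3)"
  using exhaust_3[of i] exhaust_3[of x] by auto

text \<open>
  An edge that enters in the direction \<open>a\<close> without outgoing dart has to go straight on, that is, to
  have the color of the opposite outgoing dart.  An edge that enters along an outgoing dart only
  needs to have a color different from that of this dart.
\<close>

lemma turn_sector:
  assumes "\<pi> x = a + 2" "\<pi> (x + 1) = a + 3" "\<pi> (x - 1) = a + (1::4)"
  shows "turn (\<pi> (i + 1)) m \<le> turn (\<pi> (i + 1)) (\<pi> (i - 1)) \<longleftrightarrow> (if m = a then i = x else outcol a x m \<noteq> Some i)"
proof -
  have c: "x + 1 + 1 = x - 1" "x - 1 - 1 = x + 1" by (simp_all add: algebra_simps)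
  from three_colors[of i x] show ?thesis
  proof (elim disjE)
    assume i: "i = x"
    show ?thesis unfolding i assms using exhaust_4[of a] exhaust_4[of m]
      by (elim disjE; simp add: turn_def outcol_def)
  next
    assume i: "i = x + 1"
    have "x + 1 - 1 = x" by simp
    then show ?thesis unfolding i c assms using exhaust_4[of a] exhaust_4[of m]
      by (elim disjE; simp add: turn_def outcol_def assms)
  next
    assume i: "i = x - 1"
    have "x - 1 + 1 = x" by simp
    then show ?thesis unfolding i c assms using exhaust_4[of a] exhaust_4[of m]
      by (elim disjE; simp add: turn_def outcol_def assms)
  qed
qed

lemma turn_clockwise:
  assumes "\<pi> x = a + 2" "\<pi> (x + 1) = a + 3" "\<pi> (x - 1) = a + (1::4)"
  shows "0 < turn (\<pi> 1) (\<pi> 2) \<and> turn (\<pi> 1) (\<pi> 2) < turn (\<pi> 1) (\<pi> (3::3))"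
proof -
  have e: "(2::3) + 1 = 3" "(3::3) + 1 = 1" "(1::3) - 1 = 3" "(1::3) + 1 = 2" "(2::3) - 1 = 1" "(3::3) - 1 = 2" by simp_all
  show ?thesis
    using exhaust_3[of x]
  proof (elim disjE)
    assume x: "x = 1"
    show ?thesis using assms exhaust_4[of a] unfolding x e by (elim disjE; simp add: turn_def)
  next
    assume x: "x = 2"
    show ?thesis using assms exhaust_4[of a] unfolding x e by (elim disjE; simp add: turn_def)
  next
    assume x: "x = 3"
    show ?thesis using assms exhaust_4[of a] unfolding x e by (elim disjE; simp add: turn_def)
  qed
qed

context augmented_grid begin

text \<open>
  Condition (W3) at the vertex \<open>v\<close>.
\<close>

definition vertex_rule :: "((grid_vertex \<times> grid_vertex) susp_dart \<rightharpoonup> 3) \<Rightarrow> grid_vertex \<Rightarrow> bool" where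
  "vertex_rule w v \<longleftrightarrow> (\<exists>e :: 3 \<Rightarrow> (grid_vertex \<times> grid_vertex) susp_dart.
        (\<forall>i. {x \<in> susp_darts M. susp_org M r x = v \<and> w x = Some i} = {e i}) \<and>
        clockwise M r (e 1) (e 2) (e 3) \<and>
        (\<forall>d\<in>darts M. \<forall>i. org M d = v \<and> w (Dart (rev_dart M d)) = Some i \<longrightarrow>
           in_cw_sector M r (e (i + 1)) (Dart d) (e (i - 1))))"

lemma org_rev: "org M d = fst d" "rev_dart M d = prod.swap d"
  by (simp_all add: aug_grid_def)

lemma susp_darts_gv:
  assumes "v \<in> B"
  shows "x \<in> susp_darts M \<and> susp_org M r x = gv v \<longleftrightarrow> (\<exists>m. canonical v m \<and> x = Dart (gv v, N v m))"
proof (cases x)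
  case (Dart d)
  obtain y z where d: "d = (y, z)" by fastforce
  show ?thesis unfolding Dart d using darts_gv[OF assms, of z]
    by (auto simp: susp_darts_def org_rev)
qed (auto simp: aug_grid_root_def org_rev)

text \<open>
  The three outgoing darts leave one direction \<open>a\<close> free, and their cyclic order leaves only the
  choice of one color \<open>x\<close>.  At the bottom left vertex all darts are outgoing, and \<open>a\<close> is the
  direction that is not canonical.
\<close>

lemma vertex_rule_gv:
  assumes v: "v \<in> B"
  shows "vertex_rule w (gv v) \<longleftrightarrow> (\<exists>a x. (v = corner \<longrightarrow> a = 2) \<and>
     (\<forall>m. canonical v m \<longrightarrow> w (Dart (gv v, N v m)) = outcol a x m) \<and>
     (\<forall>m i. canonical v m \<longrightarrow> w (Dart (N v m, gv v)) = Some i \<longrightarrow> (if m = a then i = x else outcol a x m \<noteq> Some i)))"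
    (is "?L \<longleftrightarrow> ?R")
proof
  define D where "D m = Dart (gv v, N v m)" for m
  have D_inj: "D m = D n \<longleftrightarrow> m = n" if "canonical v m" "canonical v n" for m n
    using that N_eq_iff[OF v, of m n] by (auto simp: D_def canonical_def)
  have set: "x \<in> susp_darts M \<and> susp_org M r x = gv v \<longleftrightarrow> (\<exists>m. canonical v m \<and> x = D m)" for x
    unfolding D_def by (rule susp_darts_gv[OF v])
  {
    assume ?L
    then obtain e where e: "\<And>i. {x \<in> susp_darts M. susp_org M r x = gv v \<and> w x = Some i} = {e i}"
      and cl: "clockwise M r (e 1) (e 2) (e 3)"
      and sec: "\<And>d i. d \<in> darts M \<Longrightarrow> org M d = gv v \<and> w (Dart (rev_dart M d)) = Some i \<Longrightarrow>
           in_cw_sector M r (e (i + 1)) (Dart d) (e (i - 1))"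
      unfolding vertex_rule_def by blast
    have e': "e i \<in> susp_darts M \<and> susp_org M r (e i) = gv v" for i
      using e[of i] by blast
    have "\<exists>m. canonical v m \<and> e i = D m" for i
      using e'[of i] set by blast
    then obtain \<pi> where \<pi>: "\<And>i. canonical v (\<pi> i) \<and> e i = D (\<pi> i)" by metis
    have f: "w (D m) = Some i \<longleftrightarrow> m = \<pi> i" if "canonical v m" for m i
    proof -
      have "D m \<in> susp_darts M \<and> susp_org M r (D m) = gv v" using set that by blast
      then have "w (D m) = Some i \<longleftrightarrow> D m \<in> {e i}" unfolding e[of i, symmetric] by blast
      also have "\<dots> \<longleftrightarrow> m = \<pi> i" using \<pi>[of i] D_inj that by auto
      finally show ?thesis .
    qed
    have "0 < turn (\<pi> 1) (\<pi> 2) \<and> turn (\<pi> 1) (\<pi> 2) < turn (\<pi> 1) (\<pi> 3)"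
      using cl \<pi> clockwise_gv[OF v, of "\<pi> 1" "\<pi> 2" "\<pi> 3"] by (simp add: D_def)
    then obtain a x where ax: "\<pi> x = a + 2" "\<pi> (x + 1) = a + 3" "\<pi> (x - 1) = a + 1"
      using turn_cyclic by blast
    have corner: "a = 2" if "v = corner"
      using \<pi>[of x] \<pi>[of "x + 1"] \<pi>[of "x - 1"] exhaust_4[of a] that unfolding ax canonical_def
      by (elim disjE) simp_all
    have out: "w (D m) = outcol a x m" if m: "canonical v m" for m
    proof -
      consider "m = a" | "m = a + 1" | "m = a + 2" | "m = a + 3"
        using exhaust_4[of m] exhaust_4[of a] by fastforce
      then show ?thesis
      proof cases
        case 1
        have "w (D m) \<noteq> Some i" for i
          using f[OF m, of i] three_colors[of i x] ax 1 by auto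
        then show ?thesis using 1 by (auto simp: outcol_def)
      qed (use f[OF m] ax in \<open>auto simp: outcol_def\<close>)
    qed
    have "if m = a then i = x else outcol a x m \<noteq> Some i"
      if m: "canonical v m" "w (Dart (N v m, gv v)) = Some i" for m i
    proof -
      have "(gv v, N v m) \<in> darts M" using darts_gv[OF v] m by blast
      from sec[OF this, of i] m have "in_cw_sector M r (e (i + 1)) (D m) (e (i - 1))"
        by (simp add: org_rev D_def)
      then have "turn (\<pi> (i + 1)) m \<le> turn (\<pi> (i + 1)) (\<pi> (i - 1))"
        using \<pi> sector_gv[OF v, of "\<pi> (i + 1)" m "\<pi> (i - 1)"] m by (simp add: D_def)
      then show ?thesis unfolding turn_sector[OF ax] .
    qed
    with corner out show ?R unfolding D_def by blast
  }
  {
    assume ?R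
    then obtain a x where corner: "v = corner \<longrightarrow> a = 2"
      and out: "\<And>m. canonical v m \<Longrightarrow> w (D m) = outcol a x m"
      and inc: "\<And>m i. canonical v m \<Longrightarrow> w (Dart (N v m, gv v)) = Some i \<Longrightarrow> (if m = a then i = x else outcol a x m \<noteq> Some i)"
      unfolding D_def by blast
    define \<pi> where "\<pi> i = (if i = x then a + 2 else if i = x + 1 then a + 3 else a + 1)" for i
    have ax: "\<pi> x = a + 2" "\<pi> (x + 1) = a + 3" "\<pi> (x - 1) = a + 1"
      by (simp_all add: \<pi>_def)
    have ok: "canonical v (\<pi> i)" for i
      using corner exhaust_4[of a] by (auto simp: \<pi>_def canonical_def)
    have f: "w (D m) = Some i \<longleftrightarrow> m = \<pi> i" if "canonical v m" for m i
      unfolding out[OF that] using three_colors[of i x] exhaust_4[of m] exhaust_4[of a]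
      by (elim disjE; simp add: outcol_def \<pi>_def)
    show ?L unfolding vertex_rule_def
    proof (intro exI[of _ "\<lambda>i. D (\<pi> i)"] conjI allI ballI impI)
      fix i
      show "{x \<in> susp_darts M. susp_org M r x = gv v \<and> w x = Some i} = {D (\<pi> i)}"
      proof (intro equalityI subsetI)
        fix y assume "y \<in> {x \<in> susp_darts M. susp_org M r x = gv v \<and> w x = Some i}"
        then have y: "y \<in> susp_darts M \<and> susp_org M r y = gv v" "w y = Some i" by simp_all
        from y(1) obtain m where "canonical v m" "y = D m" unfolding set by blast
        then show "y \<in> {D (\<pi> i)}" using f[of m i] y(2) by simp
      next
        fix y assume "y \<in> {D (\<pi> i)}"
        then have y: "y = D (\<pi> i)" by simp
        have "y \<in> susp_darts M \<and> susp_org M r y = gv v" unfolding set y using ok by blast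
        then show "y \<in> {x \<in> susp_darts M. susp_org M r x = gv v \<and> w x = Some i}"
          using f[OF ok] y by simp
      qed
    next
      show "clockwise M r (D (\<pi> 1)) (D (\<pi> 2)) (D (\<pi> 3))"
        using turn_clockwise[OF ax] clockwise_gv[OF v ok ok ok] by (simp add: D_def)
    next
      fix d i assume d: "d \<in> darts M" "org M d = gv v \<and> w (Dart (rev_dart M d)) = Some i"
      obtain m where m: "canonical v m" "d = (gv v, N v m)"
        using d darts_gv[OF v] by (cases d) (auto simp: org_rev)
      have "if m = a then i = x else outcol a x m \<noteq> Some i"
        using inc[OF m(1)] d(2) m(2) by (simp add: org_rev)
      then have "turn (\<pi> (i + 1)) m \<le> turn (\<pi> (i + 1)) (\<pi> (i - 1))"
        unfolding turn_sector[OF ax] .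
      then show "in_cw_sector M r (D (\<pi> (i + 1))) (Dart d) (D (\<pi> (i - 1)))"
        using sector_gv[OF v ok m(1) ok] m(2) by (simp add: D_def)
    qed
  }
qed

lemma fan_Special:
  obtains n where "3 \<le> n" "length (fan (Special i)) = Suc n" "fan (Special i) ! 0 = Half_Edge i"
    "fan (Special i) ! 1 = Dart (Special i, Special (i + 1))"
    "fan (Special i) ! n = Dart (Special i, Special (i - 1))"
    "\<And>t. 1 \<le> t \<Longrightarrow> t \<le> n \<Longrightarrow> \<exists>y. fan (Special i) ! t = Dart (Special i, y)"
proof -
  obtain ys where ys: "aug_grid_nbrs k l (Special i) = Special (i + 1) # ys @ [Special (i - 1)]" "ys \<noteq> []"
    using special_nbrs_ends[of i] by metis
  have fan: "fan (Special i) = Half_Edge i # map (\<lambda>x. Dart (Special i, x)) (Special (i + 1) # ys @ [Special (i - 1)])"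
    unfolding fan_def ys by simp
  show thesis
  proof (rule that[of "length ys + 2"])
    show "3 \<le> length ys + 2" using ys(2) by (cases ys) auto
    show "fan (Special i) ! (length ys + 2) = Dart (Special i, Special (i - 1))"
      unfolding fan by (simp add: nth_append)
    fix t assume "1 \<le> t" "t \<le> length ys + 2"
    then show "\<exists>y. fan (Special i) ! t = Dart (Special i, y)"
      unfolding fan by (cases t) (simp_all del: list.map add: nth_map)
  qed (simp_all add: fan)
qed

lemma Special_in_verts: "Special i \<in> verts M"
  by (simp add: verts_M)

lemma cyclic_3: "i + 1 + 1 = i - 1" "i - 1 - 1 = i + (1::3)"
  by (simp_all add: algebra_simps)

text \<open>
  In the fan of \<open>a\<^sub>i\<close> the half-edge of color \<open>i\<close> has position 0; so the other two outgoing darts have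
  positions \<open>p < q\<close>, and the sectors become intervals of positions.
\<close>

lemma vertex_rule_SpecialD:
  assumes rule: "vertex_rule w (Special i)" and half: "w (Half_Edge i) = Some i"
    and n: "length (fan (Special i)) = Suc n" "fan (Special i) ! 0 = Half_Edge i"
  obtains p q where "0 < p" "p < q" "q \<le> n"
    "\<And>t. t \<le> n \<Longrightarrow> w (fan (Special i) ! t) =
       (if t = 0 then Some i else if t = p then Some (i + 1) else if t = q then Some (i - 1) else None)"
    "\<And>t y c. t \<le> n \<Longrightarrow> fan (Special i) ! t = Dart (Special i, y) \<Longrightarrow> w (Dart (y, Special i)) = Some c \<Longrightarrow>
       (c = i \<longrightarrow> p \<le> t \<and> t \<le> q) \<and> (c = i + 1 \<longrightarrow> q \<le> t) \<and> (c = i - 1 \<longrightarrow> t \<le> p)"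
proof -
  let ?L = "fan (Special i)"
  from rule obtain e where e: "\<And>j. {x \<in> susp_darts M. susp_org M r x = Special i \<and> w x = Some j} = {e j}"
      and cl: "clockwise M r (e 1) (e 2) (e 3)"
      and sec: "\<And>d j. d \<in> darts M \<Longrightarrow> org M d = Special i \<and> w (Dart (rev_dart M d)) = Some j \<Longrightarrow>
           in_cw_sector M r (e (j + 1)) (Dart d) (e (j - 1))"
      unfolding vertex_rule_def by blast
  have set: "set ?L = {x \<in> susp_darts M. susp_org M r x = Special i}"
    by (rule set_fan[OF Special_in_verts])
  have "\<exists>t\<le>n. e j = ?L ! t" for j
  proof -
    have "e j \<in> set ?L" unfolding set using e[of j] by blast
    then show ?thesis unfolding in_set_conv_nth n(1) by (auto simp: less_Suc_eq_le)
  qed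
  then obtain \<pi> where \<pi>: "\<And>j. \<pi> j \<le> n \<and> e j = ?L ! \<pi> j" by metis
  have nth_eq: "?L ! s = ?L ! t \<longleftrightarrow> s = t" if "s \<le> n" "t \<le> n" for s t
    using distinct_fan[of "Special i"] that n(1) by (subst nth_eq_iff_index_eq) auto
  have f: "w (?L ! t) = Some j \<longleftrightarrow> t = \<pi> j" if t: "t \<le> n" for t j
  proof -
    have "?L ! t \<in> set ?L" using t n(1) by simp
    then have "w (?L ! t) = Some j \<longleftrightarrow> ?L ! t \<in> {e j}" unfolding e[of j, symmetric] set by blast
    then show ?thesis using \<pi>[of j] nth_eq t by auto
  qed
  have dist: "funpow_dist (susp_cw M r) (?L ! s) (?L ! t) = (if s \<le> t then t - s else t + Suc n - s)"
    if "s \<le> n" "t \<le> n" for s t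
    using fan_dist[OF Special_in_verts, of s i t] that n(1) by simp
  have "\<pi> i = 0" using f[of 0 i] half n(2) by simp
  have cl': "0 < funpow_dist (susp_cw M r) (?L ! \<pi> 1) (?L ! \<pi> 2)"
    "funpow_dist (susp_cw M r) (?L ! \<pi> 1) (?L ! \<pi> 2) < funpow_dist (susp_cw M r) (?L ! \<pi> 1) (?L ! \<pi> 3)"
    using cl \<pi> by (simp_all add: clockwise_def)
  note cl'' = cl'[unfolded dist[OF conjunct1[OF \<pi>] conjunct1[OF \<pi>]]]
  have bounds: "\<pi> 1 \<le> n" "\<pi> 2 \<le> n" "\<pi> 3 \<le> n" using \<pi> by blast+
  have e3: "(2::3) + 1 = 3" "(3::3) + 1 = 1" "(1::3) - 1 = 3" "(1::3) + 1 = 2" "(2::3) - 1 = 1" "(3::3) - 1 = 2" by simp_all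
  have pq: "0 < \<pi> (i + 1)" "\<pi> (i + 1) < \<pi> (i - 1)"
    using exhaust_3[of i] cl'' bounds \<open>\<pi> i = 0\<close>
    by (elim disjE; simp only: e3; simp split: if_splits)+
  show thesis
  proof (rule that[of "\<pi> (i + 1)" "\<pi> (i - 1)"])
    show "0 < \<pi> (i + 1)" "\<pi> (i + 1) < \<pi> (i - 1)" "\<pi> (i - 1) \<le> n" using pq \<pi> by auto
    show "w (?L ! t) = (if t = 0 then Some i else if t = \<pi> (i + 1) then Some (i + 1) else
       if t = \<pi> (i - 1) then Some (i - 1) else None)" if t: "t \<le> n" for t
    proof -
      have "w (?L ! t) = None" if "t \<noteq> 0" "t \<noteq> \<pi> (i + 1)" "t \<noteq> \<pi> (i - 1)"
      proof (rule ccontr)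
        assume "w (?L ! t) \<noteq> None"
        then obtain j where "w (?L ! t) = Some j" by auto
        then have "t = \<pi> j" using f[OF t] by simp
        with that three_colors[of j i] \<open>\<pi> i = 0\<close> show False by auto
      qed
      then show ?thesis using f[OF t] \<open>\<pi> i = 0\<close> by metis
    qed
    show "(c = i \<longrightarrow> \<pi> (i + 1) \<le> t \<and> t \<le> \<pi> (i - 1)) \<and> (c = i + 1 \<longrightarrow> \<pi> (i - 1) \<le> t) \<and> (c = i - 1 \<longrightarrow> t \<le> \<pi> (i + 1))"
      if t: "t \<le> n" "?L ! t = Dart (Special i, y)" "w (Dart (y, Special i)) = Some c" for t y c
    proof -
      have "?L ! t \<in> susp_darts M" using set t(1) n(1) nth_mem[of t ?L] by auto
      then have "(Special i, y) \<in> darts M" using t(2) by (auto simp: susp_darts_def)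
      from sec[OF this, of c] t have "in_cw_sector M r (?L ! \<pi> (c + 1)) (?L ! t) (?L ! \<pi> (c - 1))"
        using \<pi> by (simp add: org_rev)
      then have le: "(if \<pi> (c + 1) \<le> t then t - \<pi> (c + 1) else t + Suc n - \<pi> (c + 1)) \<le>
          (if \<pi> (c + 1) \<le> \<pi> (c - 1) then \<pi> (c - 1) - \<pi> (c + 1) else \<pi> (c - 1) + Suc n - \<pi> (c + 1))"
        using dist \<pi> t(1) by (simp add: in_cw_sector_def)
      have t0: "t > 0" using t(2) n(2) by (cases t) auto
      have bounds: "\<pi> (i - 1) \<le> n" using \<pi> by blast
      show ?thesis
      proof (intro conjI impI)
        assume c: "c = i"
        show "\<pi> (i + 1) \<le> t" "t \<le> \<pi> (i - 1)"
          using le pq t(1) bounds unfolding c by (auto split: if_splits)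
      next
        assume c: "c = i + 1"
        have "i + 1 - 1 = i" by simp
        then show "\<pi> (i - 1) \<le> t"
          using le pq t(1) bounds \<open>\<pi> i = 0\<close> t0 unfolding c cyclic_3 by (auto split: if_splits)
      next
        assume c: "c = i - 1"
        have "i - 1 + 1 = i" by simp
        then show "t \<le> \<pi> (i + 1)"
          using le pq t(1) bounds \<open>\<pi> i = 0\<close> t0 unfolding c cyclic_3 by (auto split: if_splits)
      qed
    qed
  qed
qed

lemma vertex_rule_SpecialI:
  assumes half: "w (Half_Edge i) = Some i"
    and right: "w (Dart (Special i, Special (i + 1))) = Some (i + 1)"
    and left: "w (Dart (Special i, Special (i - 1))) = Some (i - 1)"
    and spokes: "\<And>v. w (Dart (Special i, gv v)) = None" "w (Dart (Special i, Special i)) = None"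
    and inc: "\<And>y c. (Special i, y) \<in> darts M \<Longrightarrow> w (Dart (y, Special i)) = Some c \<Longrightarrow> c = i"
    and half': "\<And>j. w (Half_Edge j) = Some j"
  shows "vertex_rule w (Special i)"
proof -
  let ?L = "fan (Special i)"
  obtain n where n: "3 \<le> n" "length ?L = Suc n" "?L ! 0 = Half_Edge i"
    "?L ! 1 = Dart (Special i, Special (i + 1))" "?L ! n = Dart (Special i, Special (i - 1))"
    by (rule fan_Special[of i])
  have set: "set ?L = {x \<in> susp_darts M. susp_org M r x = Special i}"
    by (rule set_fan[OF Special_in_verts])
  have dist: "funpow_dist (susp_cw M r) (?L ! s) (?L ! t) = (if s \<le> t then t - s else t + Suc n - s)"
    if "s \<le> n" "t \<le> n" for s t
    using fan_dist[OF Special_in_verts, of s i t] that n(2) by simp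
  define \<pi> where "\<pi> j = (if j = i then 0 else if j = i + 1 then 1 else n)" for j
  have \<pi>: "\<pi> i = 0" "\<pi> (i + 1) = 1" "\<pi> (i - 1) = n" "\<And>j. \<pi> j \<le> n"
    using n(1) by (auto simp: \<pi>_def)
  have w\<pi>: "w (?L ! \<pi> j) = Some j" for j
    using three_colors[of j i] half right left n(3-5) by (auto simp: \<pi>_def)
  have nth_eq: "?L ! s = ?L ! t \<longleftrightarrow> s = t" if "s \<le> n" "t \<le> n" for s t
    using distinct_fan[of "Special i"] that n(2) by (subst nth_eq_iff_index_eq) auto
  show ?thesis unfolding vertex_rule_def
  proof (intro exI[of _ "\<lambda>j. ?L ! \<pi> j"] conjI allI ballI impI)
    fix j
    show "{x \<in> susp_darts M. susp_org M r x = Special i \<and> w x = Some j} = {?L ! \<pi> j}"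
    proof (intro equalityI subsetI)
      fix x assume x: "x \<in> {x \<in> susp_darts M. susp_org M r x = Special i \<and> w x = Some j}"
      then have "x \<in> set ?L" unfolding set by blast
      show "x \<in> {?L ! \<pi> j}"
      proof (cases x)
        case (Half_Edge s)
        then have "s = i" "j = i" using x half' by (auto simp: aug_grid_root_def org_rev)
        then show ?thesis using Half_Edge n(3) \<pi>(1) by simp
      next
        case (Dart d)
        obtain y where d: "d = (Special i, y)" using x Dart by (cases d) (auto simp: org_rev)
        show ?thesis
        proof (cases y)
          case (Grid s t)
          then have "y = gv (int s, int t)" by simp
          then have "w x = None" using spokes(1)[of "(int s, int t)"] Dart d by simp
          then show ?thesis using x by simp
        next
          case (Special s)
          then show ?thesis using three_colors[of s i] x Dart d spokes(2) right left n(4,5) \<pi>(2,3) by auto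
        qed
      qed
    next
      fix x assume "x \<in> {?L ! \<pi> j}"
      then have "x = ?L ! \<pi> j" by simp
      moreover have "?L ! \<pi> j \<in> set ?L" using \<pi>(4) n(2) by (simp add: less_Suc_eq_le)
      ultimately show "x \<in> {x \<in> susp_darts M. susp_org M r x = Special i \<and> w x = Some j}"
        using w\<pi> unfolding set by simp
    qed
  next
    have e3: "(2::3) + 1 = 3" "(3::3) + 1 = 1" "(1::3) - 1 = 3" "(1::3) + 1 = 2" "(2::3) - 1 = 1" "(3::3) - 1 = 2" by simp_all
    show "clockwise M r (?L ! \<pi> 1) (?L ! \<pi> 2) (?L ! \<pi> 3)"
      unfolding clockwise_def dist[OF \<pi>(4) \<pi>(4)]
      using exhaust_3[of i] \<pi>(1-3) n(1) by (elim disjE; simp only: e3; simp)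
  next
    fix d c assume d: "d \<in> darts M" "org M d = Special i \<and> w (Dart (rev_dart M d)) = Some c"
    obtain y where y: "d = (Special i, y)" using d(2) by (cases d) (auto simp: org_rev)
    have c: "c = i" using inc[of y c] d y by (simp add: org_rev)
    have "Dart d \<in> set ?L" unfolding set using d by (simp add: susp_darts_def)
    then obtain t where t: "t \<le> n" "Dart d = ?L ! t" unfolding in_set_conv_nth n(2) by (auto simp: less_Suc_eq_le)
    have "t \<noteq> 0" using t n(3) by (cases t) auto
    then show "in_cw_sector M r (?L ! \<pi> (c + 1)) (Dart d) (?L ! \<pi> (c - 1))"
      using t(1) n(1) dist[of 1 t] dist[of 1 n] unfolding c t(2) in_cw_sector_def \<pi>(2,3)
      by simp
  qed
qed

end

section \<open>From Schnyder woods to spanning trees\<close>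

context augmented_grid begin

abbreviation "woods \<equiv> schnyder_woods M r"

lemma wood_iff:
  "w \<in> woods \<longleftrightarrow> dom w \<subseteq> susp_darts M \<and>
     (\<forall>d\<in>darts M. (w (Dart d) \<noteq> None \<or> w (Dart (prod.swap d)) \<noteq> None) \<and>
        (w (Dart d) \<noteq> None \<and> w (Dart (prod.swap d)) \<noteq> None \<longrightarrow> w (Dart d) \<noteq> w (Dart (prod.swap d)))) \<and>
     (\<forall>i. w (Half_Edge i) = Some i) \<and> (\<forall>v\<in>verts M. vertex_rule w v) \<and>
     (\<forall>F\<in>interior_faces M r. \<forall>i. \<not> (\<forall>d\<in>F. w (Dart d) = Some i) \<and> \<not> (\<forall>d\<in>F. w (Dart (prod.swap d)) = Some i))"
  unfolding schnyder_woods_def schnyder_wood_def vertex_rule_def org_rev(2) by simp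

lemma wood_dom: "w \<in> woods \<Longrightarrow> dom w \<subseteq> susp_darts M"
  unfolding wood_iff by (elim conjE)

lemma wood_W1:
  assumes w: "w \<in> woods" and d: "(x, y) \<in> darts M"
  shows "w (Dart (x, y)) \<noteq> None \<or> w (Dart (y, x)) \<noteq> None"
    and "w (Dart (x, y)) \<noteq> None \<Longrightarrow> w (Dart (y, x)) \<noteq> None \<Longrightarrow> w (Dart (x, y)) \<noteq> w (Dart (y, x))"
proof -
  have "\<forall>d\<in>darts M. (w (Dart d) \<noteq> None \<or> w (Dart (prod.swap d)) \<noteq> None) \<and>
        (w (Dart d) \<noteq> None \<and> w (Dart (prod.swap d)) \<noteq> None \<longrightarrow> w (Dart d) \<noteq> w (Dart (prod.swap d)))"
    using w unfolding wood_iff by (elim conjE)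
  from bspec[OF this d]
  show "w (Dart (x, y)) \<noteq> None \<or> w (Dart (y, x)) \<noteq> None"
    and "w (Dart (x, y)) \<noteq> None \<Longrightarrow> w (Dart (y, x)) \<noteq> None \<Longrightarrow> w (Dart (x, y)) \<noteq> w (Dart (y, x))"
    by simp_all
qed

lemma N_outside: "v + dvec m \<notin> B \<Longrightarrow> N v m = Special (side m)"
  by (simp add: nbr_def)

lemma N_inside: "v + dvec m \<in> B \<Longrightarrow> N v m = gv (v + dvec m)"
  by (simp add: nbr_def)

lemma N_dart:
  assumes v: "v \<in> B"
  shows "(gv v, N v m) \<in> darts M"
proof (cases "canonical v m")
  case False
  then have "N v m = N v 3" "canonical v 3" using N_eq_iff[OF v, of 2 3] by (auto simp: canonical_def)
  then show ?thesis using darts_gv[OF v] by blast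
qed (use darts_gv[OF v] in blast)

lemma canonical_inside: "v + dvec m \<in> B \<Longrightarrow> canonical v m"
  using kl by (auto simp: canonical_def grid_box_def)

lemma step_back: "(v :: int \<times> int) + dvec m + dvec (m + 2) = v"
  by (simp add: dvec_opposite)

lemma N_back: "v \<in> B \<Longrightarrow> v + dvec m \<in> B \<Longrightarrow> N (v + dvec m) (m + 2) = gv v"
  using N_inside[of "v + dvec m" "m + 2"] step_back by simp

text \<open>
  Suppose that an edge of the triangle were not outgoing at one of its ends.  At its other end it
  would be the outgoing dart next to the outer face, whose color is known from the order of the
  colors, and this color is not allowed to enter the first end next to the outer face.  Hence the
  triangle takes up all outgoing darts of the special vertices, and the remaining edges at \<open>a\<^sub>i\<close>
  enter strictly between its outgoing edges, where only the color \<open>i\<close> is allowed.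
\<close>

lemma outer_edges_and_spokes:
  assumes w: "w \<in> woods"
  shows "w (Dart (Special i, Special (i + 1))) = Some (i + 1)"
    and "w (Dart (Special i, Special (i - 1))) = Some (i - 1)"
    and "w (Dart (Special i, gv v)) = None"
    and "(Special i, gv v) \<in> darts M \<Longrightarrow> w (Dart (gv v, Special i)) = Some i"
proof -
  define L where "L i = fan (Special i)" for i
  define P where "P i n p q \<longleftrightarrow> 3 \<le> n \<and> length (L i) = Suc n \<and> L i ! 0 = Half_Edge i \<and>
    L i ! 1 = Dart (Special i, Special (i + 1)) \<and> L i ! n = Dart (Special i, Special (i - 1)) \<and>
    0 < p \<and> p < q \<and> q \<le> n \<and>
    (\<forall>t\<le>n. w (L i ! t) = (if t = 0 then Some i else if t = p then Some (i + 1) else if t = q then Some (i - 1) else None)) \<and>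
    (\<forall>t y c. t \<le> n \<longrightarrow> L i ! t = Dart (Special i, y) \<longrightarrow> w (Dart (y, Special i)) = Some c \<longrightarrow>
       (c = i \<longrightarrow> p \<le> t \<and> t \<le> q) \<and> (c = i + 1 \<longrightarrow> q \<le> t) \<and> (c = i - 1 \<longrightarrow> t \<le> p))" for i n p q
  have "\<exists>n p q. P i n p q" for i
  proof -
    obtain n where n: "3 \<le> n" "length (L i) = Suc n" "L i ! 0 = Half_Edge i"
      "L i ! 1 = Dart (Special i, Special (i + 1))" "L i ! n = Dart (Special i, Special (i - 1))"
      unfolding L_def by (rule fan_Special[of i])
    have "vertex_rule w (Special i)" "w (Half_Edge i) = Some i"
      using w Special_in_verts unfolding wood_iff by blast+
    then show ?thesis
    proof (rule vertex_rule_SpecialD[OF _ _ n(2,3)[unfolded L_def], folded L_def])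
      fix p q
      assume pq: "0 < p" "p < q" "q \<le> n"
        and out: "\<And>t. t \<le> n \<Longrightarrow> w (L i ! t) =
          (if t = 0 then Some i else if t = p then Some (i + 1) else if t = q then Some (i - 1) else None)"
        and inc: "\<And>t y c. t \<le> n \<Longrightarrow> L i ! t = Dart (Special i, y) \<Longrightarrow> w (Dart (y, Special i)) = Some c \<Longrightarrow>
          (c = i \<longrightarrow> p \<le> t \<and> t \<le> q) \<and> (c = i + 1 \<longrightarrow> q \<le> t) \<and> (c = i - 1 \<longrightarrow> t \<le> p)"
      have "\<forall>t\<le>n. w (L i ! t) =
          (if t = 0 then Some i else if t = p then Some (i + 1) else if t = q then Some (i - 1) else None)"
        by (intro allI impI) (rule out)
      moreover have "\<forall>t y c. t \<le> n \<longrightarrow> L i ! t = Dart (Special i, y) \<longrightarrow> w (Dart (y, Special i)) = Some c \<longrightarrow>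
          (c = i \<longrightarrow> p \<le> t \<and> t \<le> q) \<and> (c = i + 1 \<longrightarrow> q \<le> t) \<and> (c = i - 1 \<longrightarrow> t \<le> p)"
      proof (rule allI, rule allI, rule allI, rule impI, rule impI, rule impI)
        fix t y c assume "t \<le> n" "L i ! t = Dart (Special i, y)" "w (Dart (y, Special i)) = Some c"
        then show "(c = i \<longrightarrow> p \<le> t \<and> t \<le> q) \<and> (c = i + 1 \<longrightarrow> q \<le> t) \<and> (c = i - 1 \<longrightarrow> t \<le> p)"
          by (rule inc)
      qed
      ultimately have "P i n p q" unfolding P_def using n pq by blast
      then show "\<exists>n p q. P i n p q" by blast
    qed
  qed
  then obtain n p q where P: "\<And>i. P i (n i) (p i) (q i)" by metis
  have n: "3 \<le> n i" "length (L i) = Suc (n i)" "L i ! 0 = Half_Edge i"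
     "L i ! 1 = Dart (Special i, Special (i + 1))" "L i ! n i = Dart (Special i, Special (i - 1))"
     "0 < p i" "p i < q i" "q i \<le> n i" for i
    using P[of i] unfolding P_def by blast+
  have out: "w (L i ! t) = (if t = 0 then Some i else if t = p i then Some (i + 1) else if t = q i then Some (i - 1) else None)"
    if "t \<le> n i" for i t using P[of i] that unfolding P_def by blast
  have inc: "(c = i \<longrightarrow> p i \<le> t \<and> t \<le> q i) \<and> (c = i + 1 \<longrightarrow> q i \<le> t) \<and> (c = i - 1 \<longrightarrow> t \<le> p i)"
    if "t \<le> n i" "L i ! t = Dart (Special i, y)" "w (Dart (y, Special i)) = Some c" for i t y c
    using P[of i] that unfolding P_def by blast
  have in_darts: "(Special i, y) \<in> darts M \<longleftrightarrow> (\<exists>t\<le>n i. L i ! t = Dart (Special i, y))" for i y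
  proof -
    have "Dart (Special i, y) \<in> set (L i) \<longleftrightarrow> (Special i, y) \<in> darts M"
      unfolding L_def set_fan[OF Special_in_verts] by (auto simp: susp_darts_def org_rev)
    then show ?thesis unfolding in_set_conv_nth n(2) by (auto simp: less_Suc_eq_le)
  qed
  have W1: "w (Dart (y, x)) \<noteq> None" if "(x, y) \<in> darts M" "w (Dart (x, y)) = None" for x y
    using wood_W1(1)[OF w that(1)] that(2) by simp
  have edge: "(Special i, Special (i + 1)) \<in> darts M" for i
    unfolding in_darts using n(1,4)[of i] by (intro exI[of _ 1]) auto
  have p1: "p i = 1" for i
  proof (rule ccontr)
    assume "p i \<noteq> 1"
    then have "w (L i ! 1) = None" using out[of 1 i] n[of i] by auto
    then have "w (Dart (Special (i + 1), Special i)) \<noteq> None"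
      using W1[OF edge] n(4) by metis
    then have nN: "w (L (i + 1) ! n (i + 1)) \<noteq> None" unfolding n(5) by simp
    then have "q (i + 1) = n (i + 1)"
      using out[of "n (i + 1)" "i + 1"] n(6-8)[of "i + 1"] n(1)[of "i + 1"] by (auto split: if_splits)
    then have "w (Dart (Special (i + 1), Special i)) = Some i"
      using out[of "n (i + 1)" "i + 1"] n(6-8)[of "i + 1"] unfolding n(5) by simp
    from inc[OF _ n(4) this] n(1)[of i] have "p i \<le> 1" by simp
    then show False using \<open>p i \<noteq> 1\<close> n(6)[of i] by simp
  qed
  have first: "w (Dart (Special i, Special (i + 1))) = Some (i + 1)" for i
    using out[of 1 i] n(1,4)[of i] p1[of i] by simp
  have qn': "q (i + 1) = n (i + 1)" for i
  proof -
    have "L (i + 1) ! n (i + 1) = Dart (Special (i + 1), Special i)" using n(5)[of "i + 1"] by simp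
    from inc[OF order.refl this first] have "n (i + 1) \<le> q (i + 1)" by simp
    then show ?thesis using n(8)[of "i + 1"] by simp
  qed
  have qn: "q i = n i" for i using qn'[of "i - 1"] by simp
  show "w (Dart (Special i, Special (i + 1))) = Some (i + 1)" by (rule first)
  show "w (Dart (Special i, Special (i - 1))) = Some (i - 1)"
    using out[of "n i" i] n[of i] qn[of i] by simp
  have spoke: "w (Dart (Special i, gv v)) = None \<and> 1 < t \<and> t < n i"
    if t: "t \<le> n i" "L i ! t = Dart (Special i, gv v)" for t
  proof -
    have "t \<noteq> 0" using t(2) n(3)[of i] by (intro notI) simp
    moreover have "t \<noteq> 1" using t(2) n(4)[of i] by (intro notI) simp
    moreover have "t \<noteq> n i" using t(2) n(5)[of i] by (intro notI) simp
    ultimately show ?thesis using out[OF t(1)] t p1 qn by auto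
  qed
  show "w (Dart (Special i, gv v)) = None"
  proof (cases "(Special i, gv v) \<in> darts M")
    case True
    then show ?thesis using in_darts spoke by blast
  next
    case False
    then show ?thesis using wood_dom[OF w] by (auto simp: susp_darts_def dom_def)
  qed
  assume d: "(Special i, gv v) \<in> darts M"
  then obtain t where t: "t \<le> n i" "L i ! t = Dart (Special i, gv v)" using in_darts by blast
  obtain c where c: "w (Dart (gv v, Special i)) = Some c" using W1[OF d] spoke[OF t] by auto
  from inc[OF t c] spoke[OF t] three_colors[of c i] p1 qn
  show "w (Dart (gv v, Special i)) = Some i" using c by auto
qed

definition rooted_form :: "((grid_vertex \<times> grid_vertex) susp_dart \<rightharpoonup> 3) \<Rightarrow> int \<times> int \<Rightarrow> 4 \<times> 3 \<Rightarrow> bool" where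
  "rooted_form w v = (\<lambda>(a, x). (v = corner \<longrightarrow> a = 2) \<and>
     (\<forall>m. canonical v m \<longrightarrow> w (Dart (gv v, N v m)) = outcol a x m) \<and>
     (\<forall>m i. canonical v m \<longrightarrow> w (Dart (N v m, gv v)) = Some i \<longrightarrow> (if m = a then i = x else outcol a x m \<noteq> Some i)))"

text \<open>
  The first component is the direction without outgoing edge, the second one is the color of the dart
  opposite to it.
\<close>

definition wood_form :: "((grid_vertex \<times> grid_vertex) susp_dart \<rightharpoonup> 3) \<Rightarrow> int \<times> int \<Rightarrow> 4 \<times> 3" where
  "wood_form w v = (SOME ax. rooted_form w v ax)"

abbreviation missing where "missing w v \<equiv> fst (wood_form w v)"
abbreviation middle where "middle w v \<equiv> snd (wood_form w v)"

lemma wood_form: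
  assumes w: "w \<in> woods" and v: "v \<in> B"
  shows "v = corner \<Longrightarrow> missing w v = 2"
    and "canonical v m \<Longrightarrow> w (Dart (gv v, N v m)) = outcol (missing w v) (middle w v) m"
    and "canonical v m \<Longrightarrow> w (Dart (N v m, gv v)) = Some i \<Longrightarrow> m = missing w v \<Longrightarrow> i = middle w v"
proof -
  have "gv v \<in> verts M" using v verts_M by blast
  then have "vertex_rule w (gv v)" using w unfolding wood_iff by blast
  then have "\<exists>ax. rooted_form w v ax" unfolding vertex_rule_gv[OF v] rooted_form_def by auto
  then have "rooted_form w v (wood_form w v)" unfolding wood_form_def by (rule someI_ex)
  then have *: "rooted_form w v (missing w v, middle w v)" by simp
  show "v = corner \<Longrightarrow> missing w v = 2"
    and "canonical v m \<Longrightarrow> w (Dart (gv v, N v m)) = outcol (missing w v) (middle w v) m"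
    and "canonical v m \<Longrightarrow> w (Dart (N v m, gv v)) = Some i \<Longrightarrow> m = missing w v \<Longrightarrow> i = middle w v"
    using * unfolding rooted_form_def by auto
qed

lemma boundary_color:
  assumes w: "w \<in> woods" and v: "v \<in> B" "v + dvec m \<notin> B"
  shows "w (Dart (gv v, N v m)) = Some (side m)"
proof -
  have "(Special (side m), gv v) \<in> darts M"
    using N_dart[OF v(1), of m] darts_swap N_outside[OF v(2)] by metis
  from outer_edges_and_spokes(4)[OF w this] show ?thesis using N_outside[OF v(2)] by simp
qed

lemma missing_inside:
  assumes w: "w \<in> woods" and v: "v \<in> B" "v \<noteq> corner"
  shows "v + dvec (missing w v) \<in> B"
proof (rule ccontr)
  assume "v + dvec (missing w v) \<notin> B"
  from boundary_color[OF w v(1) this] wood_form(2)[OF w v(1), of "missing w v"] v(2)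
  show False by (simp add: canonical_def outcol_def)
qed

lemma middle_corner: 
  assumes w: "w \<in> woods"
  shows "middle w corner = 1"
proof -
  have "w (Dart (gv corner, N corner 3)) = Some 3"
    using boundary_color[OF w corner_in_B, of 3] by (simp add: grid_box_def)
  moreover have "w (Dart (gv corner, N corner 3)) = outcol 2 (middle w corner) 3"
    using wood_form(1,2)[OF w corner_in_B] by (simp add: canonical_def del: gv.simps)
  ultimately show ?thesis using exhaust_3[of "middle w corner"] by (auto simp: outcol_def)
qed

text \<open>
  The color in which an edge would have to enter \<open>v\<close> through the corner between the directions \<open>m\<close>
  and \<open>m + 1\<close>.
\<close>

definition label :: "((grid_vertex \<times> grid_vertex) susp_dart \<rightharpoonup> 3) \<Rightarrow> int \<times> int \<Rightarrow> 4 \<Rightarrow> 3" where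
  "label w v m = (let a = missing w v; x = middle w v in
     if m = a + 1 then x + 1 else if m = a + 2 then x - 1 else x)"

lemma label_step: "label w v (m - 1) = label w v m - of_bool (m \<noteq> missing w v)"
  using exhaust_4[of m] exhaust_4[of "missing w v"]
  by (elim disjE; simp add: label_def Let_def)

lemma label_missing: "label w v (missing w v) = middle w v"
  using exhaust_4[of "missing w v"] by (elim disjE; simp add: label_def Let_def)

lemma color_label:
  assumes "w \<in> woods" "v \<in> B" "canonical v m"
  shows "w (Dart (gv v, N v m)) = (if m = missing w v then None else Some (label w v m + 1))"
  unfolding wood_form(2)[OF assms] using exhaust_4[of m] exhaust_4[of "missing w v"]
  by (elim disjE; simp add: label_def Let_def outcol_def)

text \<open>
  The two corners on the left side of the edge in direction \<open>m\<close> from \<open>v\<close> have the same label.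
\<close>

definition left_agree where
  "left_agree w v m \<longleftrightarrow> label w (v + dvec m) (m + 2) = label w v (m - 1)"

text \<open>
  Seen from \<open>v\<close>, the label on the left side stays equal or drops by 1.  A case distinction on the
  orientation of the edge shows that exactly one of the following four things happens: the edge is
  missing at one end, or at the other, or the labels agree on one side, or on the other.  In this
  way each edge belongs to at most one vertex or face.
\<close>

lemma edge_labels:
  assumes w: "w \<in> woods" and v: "v \<in> B" "v + dvec m \<in> B"
  shows "\<not> (missing w v = m \<and> missing w (v + dvec m) = m + 2)"
    and "left_agree w v m \<Longrightarrow> missing w v \<noteq> m \<and> missing w (v + dvec m) \<noteq> m + 2"
    and "\<not> (left_agree w v m \<and> left_agree w (v + dvec m) (m + 2))"
    and "\<not> left_agree w v m \<Longrightarrow> label w (v + dvec m) (m + 2) = label w v (m - 1) - 1"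
proof -
  let ?u = "v + dvec m"
  have return: "?u + dvec (m + 2) = v" by (rule step_back)
  have N: "N v m = gv ?u" "N ?u (m + 2) = gv v" using N_inside[OF v(2)] N_back[OF v] by auto
  have ok: "canonical v m" "canonical ?u (m + 2)" using canonical_inside[OF v(2)] canonical_inside[of ?u "m + 2"] return v(1) by auto
  define y z where "y = label w v m" and "z = label w ?u (m + 2)"
  have out: "w (Dart (gv v, gv ?u)) = (if m = missing w v then None else Some (y + 1))"
    "w (Dart (gv ?u, gv v)) = (if m + 2 = missing w ?u then None else Some (z + 1))"
    using color_label[OF w v(1) ok(1)] color_label[OF w v(2) ok(2)] by (simp_all add: N y_def z_def)
  have "(gv v, gv ?u) \<in> darts M" using N_dart[OF v(1), of m] N by simp
  note W1 = wood_W1[OF w this]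
  show one: "\<not> (missing w v = m \<and> missing w ?u = m + 2)" using W1(1) out by auto
  have steps: "label w v (m - 1) = y - of_bool (m \<noteq> missing w v)"
    "label w ?u (m + 1) = z - of_bool (m + 2 \<noteq> missing w ?u)"
  proof -
    have "m + 2 - 1 = m + 1" by (simp add: algebra_simps)
    then show "label w ?u (m + 1) = z - of_bool (m + 2 \<noteq> missing w ?u)"
      using label_step[of w ?u "m + 2"] unfolding z_def by metis
    show "label w v (m - 1) = y - of_bool (m \<noteq> missing w v)"
      using label_step[of w v m] unfolding y_def .
  qed
  have agree: "left_agree w v m \<longleftrightarrow> z = y - of_bool (m \<noteq> missing w v)"
    "left_agree w ?u (m + 2) \<longleftrightarrow> y = z - of_bool (m + 2 \<noteq> missing w ?u)"
  proof -
    have arith: "m + 2 - 1 = m + 1" "m + 2 + 2 = m" by (simp_all add: algebra_simps)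
    show "left_agree w v m \<longleftrightarrow> z = y - of_bool (m \<noteq> missing w v)"
      unfolding left_agree_def steps(1) z_def ..
    show "left_agree w ?u (m + 2) \<longleftrightarrow> y = z - of_bool (m + 2 \<noteq> missing w ?u)"
      unfolding left_agree_def return arith steps(2) y_def ..
  qed
  have trichotomy: "(m \<noteq> missing w v \<and> m + 2 \<noteq> missing w ?u \<and> y \<noteq> z) \<or>
    (m = missing w v \<and> m + 2 \<noteq> missing w ?u \<and> z = y - 1) \<or>
    (m \<noteq> missing w v \<and> m + 2 = missing w ?u \<and> z = y + 1)"
  proof (cases "m = missing w v")
    case True
    have "z + 1 = middle w v"
      using wood_form(3)[OF w v(1) ok(1), of "z + 1"] out(2) True one N by auto
    then have "z = y - 1" using True label_missing[of w v] by (simp add: y_def eq_diff_eq)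
    then show ?thesis using True one by auto
  next
    case vm: False
    show ?thesis
    proof (cases "m + 2 = missing w ?u")
      case True
      have "y + 1 = middle w ?u"
        using wood_form(3)[OF w v(2) ok(2), of "y + 1"] out(1) True vm N by auto
      then have "z = y + 1" using True label_missing[of w ?u] by (simp add: z_def)
      then show ?thesis using True vm by simp
    next
      case False
      then have "y \<noteq> z" using W1(2) out vm by auto
      then show ?thesis using False vm by simp
    qed
  qed
  show "left_agree w v m \<Longrightarrow> missing w v \<noteq> m \<and> missing w ?u \<noteq> m + 2"
    unfolding agree using trichotomy by auto
  show "\<not> (left_agree w v m \<and> left_agree w ?u (m + 2))"
    unfolding agree using trichotomy by auto
  show "label w ?u (m + 2) = label w v (m - 1) - 1" if "\<not> left_agree w v m"
  proof -
    have "z = y \<or> z = y - 1 \<or> z = y - 1 - 1"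
      using three_colors[of z y] unfolding cyclic_3 by blast
    with that trichotomy show ?thesis
      unfolding agree steps z_def[symmetric] by (elim disjE conjE) (simp_all add: cyclic_3)
  qed
qed

text \<open>
  The pointers that match vertices and faces with edges.  For a face several edges may qualify as far
  as the labels are concerned, and any of them will do.
\<close>

definition wood_orientation :: "((grid_vertex \<times> grid_vertex) susp_dart \<rightharpoonup> 3) \<Rightarrow> int \<times> int \<Rightarrow> 4" where
  "wood_orientation w p = (if even (fst p) then missing w (fst p div 2, snd p div 2)
     else SOME n. \<exists>v m. v \<in> B \<and> v + dvec m \<in> B \<and> left_face v m = p \<and> n = m + 1 \<and> left_agree w v m)"

lemma wood_orientation_vertex: "wood_orientation w (v + v) = missing w v"
  by (cases v) (simp add: wood_orientation_def)

lemma even_cells: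
  assumes "p \<in> cells k l" "even (fst p)"
  obtains v where "v \<in> B" "v \<noteq> corner" "p = v + v"
proof -
  obtain x y where xy: "p = (x, y)" by fastforce
  have "even x" "even y" using assms by (auto simp: xy cells_def)
  then obtain i j where ij: "x = 2 * i" "y = 2 * j" by (auto elim!: evenE)
  have "(i, j) \<in> B" "(i, j) \<noteq> corner" "p = (i, j) + (i, j)"
    using assms by (auto simp: xy ij cells_def rect_def grid_box_def)
  then show thesis by (rule that)
qed

text \<open>
  Going around the face, the label would otherwise drop by 1 at each of the four sides, but \<open>4 \<noteq> 0\<close>
  modulo 3.
\<close>

lemma wood_orientation_face:
  assumes w: "w \<in> woods" and p: "p \<in> cells k l" "odd (fst p)"
  obtains v m where "v \<in> B" "v + dvec m \<in> B" "left_face v m = p" "wood_orientation w p = m + 1" "left_agree w v m"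
proof -
  obtain x y where xy: "p = (x, y)" by fastforce
  have "odd x" "odd y" using p by (auto simp: xy cells_def)
  then obtain i j where ij: "x = 2 * i + 1" "y = 2 * j + 1" by (auto elim!: oddE)
  have in_B: "(i, j) \<in> B" "(i, j + 1) \<in> B" "(i + 1, j) \<in> B" "(i + 1, j + 1) \<in> B"
    using p by (auto simp: xy ij cells_def rect_def grid_box_def)
  have "\<exists>v m. v \<in> B \<and> v + dvec m \<in> B \<and> left_face v m = p \<and> left_agree w v m"
  proof (rule ccontr)
    assume "\<nexists>v m. v \<in> B \<and> v + dvec m \<in> B \<and> left_face v m = p \<and> left_agree w v m"
    then have no: "label w (v + dvec m) (m + 2) = label w v (m - 1) - 1"
      if "v \<in> B" "v + dvec m \<in> B" "left_face v m = p" for v m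
      using edge_labels(4)[OF w that(1,2)] that by blast
    (* The four sides counterclockwise, starting with the bottom side. *)
    have "label w (i + 1, j + 1) 3 = label w (i + 1, j) 0 - 1"
      using no[of "(i + 1, j)" 1] in_B by (simp add: left_face_def xy ij)
    moreover have "label w (i, j + 1) 2 = label w (i + 1, j + 1) 3 - 1"
      using no[of "(i + 1, j + 1)" 0] in_B by (simp add: left_face_def xy ij)
    moreover have "label w (i, j) 1 = label w (i, j + 1) 2 - 1"
      using no[of "(i, j + 1)" 3] in_B by (simp add: left_face_def xy ij)
    moreover have "label w (i + 1, j) 0 = label w (i, j) 1 - 1"
      using no[of "(i, j)" 2] in_B by (simp add: left_face_def xy ij)
    ultimately have "label w (i + 1, j) 0 = label w (i + 1, j) 0 - 1 - 1 - 1 - 1" by simp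
    then show False using exhaust_3[of "label w (i + 1, j) 0"] by auto
  qed
  then have "\<exists>n v m. v \<in> B \<and> v + dvec m \<in> B \<and> left_face v m = p \<and> n = m + 1 \<and> left_agree w v m" by blast
  from someI_ex[OF this] p(2) show thesis using that by (auto simp: wood_orientation_def)
qed

lemma left_face_edge: "left_face v m + dvec (m + 1) = v + v + dvec m"
proof -
  have "dvec (m - 1) + dvec (m + 1) = 0" using exhaust_4[of m] by (auto simp: zero_prod_def)
  then show ?thesis by (simp add: left_face_def add.assoc)
qed

lemma midpoint_cases:
  assumes "v + v + dvec m = u + u + dvec n"
  shows "u = v \<and> n = m \<or> u = v + dvec m \<and> n = m + 2"
proof -
  have "even (fst (v + v)) = even (fst (u + u))" by simp
  from same_edge_cases[OF assms this] show ?thesis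
  proof (elim disjE conjE)
    assume "v + v = u + u" "m = n"
    then show ?thesis by (cases u; cases v) auto
  next
    assume "u + u = v + v + dvec m + dvec m" "n = m + 2"
    then show ?thesis by (cases u; cases v; cases "dvec m") auto
  qed
qed

lemma wood_orientation_inj:
  assumes w: "w \<in> woods" and pq: "p \<in> cells k l" "q \<in> cells k l"
    "p + dvec (wood_orientation w p) = q + dvec (wood_orientation w q)"
  shows "p = q"
proof -
  have vertex_face: False if cells: "p \<in> cells k l" "q \<in> cells k l" "even (fst p)" "odd (fst q)"
    "p + dvec (wood_orientation w p) = q + dvec (wood_orientation w q)" for p q
  proof -
    obtain v where v: "v \<in> B" "v \<noteq> corner" "p = v + v" by (rule even_cells[OF cells(1,3)])
    obtain u m where u: "u \<in> B" "u + dvec m \<in> B" "left_face u m = q" "wood_orientation w q = m + 1" "left_agree w u m"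
      by (rule wood_orientation_face[OF w cells(2,4)])
    have "v + v + dvec (missing w v) = u + u + dvec m"
      using cells(5) v(3) u(3,4) left_face_edge[of u m] wood_orientation_vertex by metis
    from midpoint_cases[OF this] edge_labels(2)[OF w u(1,2,5)] show False
      by (auto simp: step_back)
  qed
  consider "even (fst p)" "even (fst q)" | "odd (fst p)" "odd (fst q)"
    using vertex_face[OF pq(1,2) _ _ pq(3)] vertex_face[OF pq(2,1) _ _ pq(3)[symmetric]] by blast
  then show ?thesis
  proof cases
    case 1
    obtain v where v: "v \<in> B" "v \<noteq> corner" "p = v + v" by (rule even_cells[OF pq(1) 1(1)])
    obtain u where u: "u \<in> B" "u \<noteq> corner" "q = u + u" by (rule even_cells[OF pq(2) 1(2)])
    have "v + v + dvec (missing w v) = u + u + dvec (missing w u)"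
      using pq(3) unfolding v(3) u(3) wood_orientation_vertex .
    from midpoint_cases[OF this] edge_labels(1)[OF w v(1), of "missing w v"] u(1)
    show ?thesis using v(3) u(3) by auto
  next
    case 2
    obtain v m where v: "v \<in> B" "v + dvec m \<in> B" "left_face v m = p" "wood_orientation w p = m + 1" "left_agree w v m"
      by (rule wood_orientation_face[OF w pq(1) 2(1)])
    obtain u n where u: "u \<in> B" "u + dvec n \<in> B" "left_face u n = q" "wood_orientation w q = n + 1" "left_agree w u n"
      by (rule wood_orientation_face[OF w pq(2) 2(2)])
    have "v + v + dvec m = u + u + dvec n"
      using pq(3) v(3,4) u(3,4) left_face_edge by metis
    from midpoint_cases[OF this] edge_labels(3)[OF w v(1,2)] v(3,5) u(3,5)
    show ?thesis by auto
  qed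
qed

definition wood_directions :: "((grid_vertex \<times> grid_vertex) susp_dart \<rightharpoonup> 3) \<Rightarrow> int \<times> int \<Rightarrow> 4" where
  "wood_directions w = restrict (missing w) B"

text \<open>
  An invariant set cannot contain the bottom left vertex, which points out of the grid, and so it
  would contain a cycle.
\<close>

lemma wood_directions_escaping:
  assumes w: "w \<in> woods"
  shows "wood_directions w \<in> escaping_walks k l"
proof -
  have "C = {}" if C: "C \<subseteq> B" "(\<lambda>v. v + dvec (missing w v)) ` C \<subseteq> C" for C
  proof -
    have "corner \<notin> C"
    proof
      assume c: "corner \<in> C"
      then have "corner + dvec (missing w corner) \<in> C" using C(2) by blast
      then have "corner + dvec 2 \<in> B" using C(1) wood_form(1)[OF w corner_in_B] by auto
      then show False by (simp add: grid_box_def)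
    qed
    define D where "D = (\<lambda>v. v + v) ` C"
    have D_cells: "D \<subseteq> cells k l"
      using C(1) \<open>corner \<notin> C\<close> by (auto simp: D_def cells_def rect_def grid_box_def)
    have hop: "hop (wood_orientation w) (v + v) = (v + dvec (missing w v)) + (v + dvec (missing w v))" for v
      unfolding hop_def wood_orientation_vertex by (simp add: algebra_simps)
    have "hop (wood_orientation w) ` D \<subseteq> D"
    proof (rule image_subsetI)
      fix p assume "p \<in> D"
      then obtain v where v: "v \<in> C" "p = v + v" by (auto simp: D_def)
      then have "v + dvec (missing w v) \<in> C" using C(2) by blast
      then show "hop (wood_orientation w) p \<in> D" unfolding v hop D_def by (rule imageI)
    qed
    moreover have "finite D" using D_cells finite_cells by (rule finite_subset)
    ultimately have "D = {} \<or> (\<exists>E\<subseteq>D. E \<noteq> {} \<and> hop (wood_orientation w) ` E = E)"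
      using exists_image_fixed_subset by metis
    moreover have "E = {}" if "E \<subseteq> D" "hop (wood_orientation w) ` E = E" for E
    proof (rule no_hop_cycle[of k l "wood_orientation w" E True])
      show "p = q" if "p \<in> cells k l" "q \<in> cells k l"
        "p + dvec (wood_orientation w p) = q + dvec (wood_orientation w q)" for p q
        using wood_orientation_inj[OF w that] .
      show "E \<subseteq> cells k l" using that(1) D_cells by (rule order.trans)
      show "even (fst p) = True" if "p \<in> E" for p
        using that \<open>E \<subseteq> D\<close> by (auto simp: D_def)
    qed fact
    ultimately show ?thesis by (auto simp: D_def)
  qed
  moreover have "(\<lambda>v. v + dvec (wood_directions w v)) ` C = (\<lambda>v. v + dvec (missing w v)) ` C" if "C \<subseteq> B" for C
    using that by (intro image_cong refl) (auto simp: wood_directions_def)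
  ultimately show ?thesis
    unfolding escaping_walks_def escaping_def by (auto simp: wood_directions_def)
qed

text \<open>
  An edge that enters a vertex in the missing direction has the color opposite to it.  So \<open>middle\<close> is
  determined by the colors at the vertex to which the missing direction leads.  Hence the vertices
  at which two woods with the same missing directions differ form an invariant set, which is empty.
\<close>

lemma wood_directions_inj: "inj_on wood_directions woods"
proof (rule inj_onI)
  fix w w' assume w: "w \<in> woods" "w' \<in> woods" and eq: "wood_directions w = wood_directions w'"
  have miss: "missing w v = missing w' v" if "v \<in> B" for v
    using fun_cong[OF eq, of v] that by (simp add: wood_directions_def)
  define C where "C = {v \<in> B. middle w v \<noteq> middle w' v}"
  have "C \<subseteq> B" by (auto simp: C_def)
  moreover have "(\<lambda>v. v + dvec (wood_directions w v)) ` C \<subseteq> C"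
  proof (rule image_subsetI)
    fix v assume v: "v \<in> C"
    then have vB: "v \<in> B" by (simp add: C_def)
    have nc: "v \<noteq> corner" using v middle_corner w by (auto simp: C_def)
    define m where "m = missing w v"
    let ?u = "v + dvec m"
    have uB: "?u \<in> B" unfolding m_def by (rule missing_inside[OF w(1) vB nc])
    have okv: "canonical v m" and oku: "canonical ?u (m + 2)"
      using canonical_inside[OF uB] canonical_inside[of ?u "m + 2"] step_back vB by auto
    have N: "N v m = gv ?u" "N ?u (m + 2) = gv v" using N_inside[OF uB] N_back[OF vB uB] by auto
    have "middle w ?u \<noteq> middle w' ?u"
    proof
      assume same: "middle w ?u = middle w' ?u"
      have "w (Dart (gv ?u, gv v)) = w' (Dart (gv ?u, gv v))"
        using wood_form(2)[OF w(1) uB oku] wood_form(2)[OF w(2) uB oku] miss[OF uB] same N by simp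
      moreover have "w (Dart (gv ?u, gv v)) \<noteq> None"
        using color_label[OF w(1) uB oku] edge_labels(1)[OF w(1) vB uB] N m_def by auto
      ultimately have "middle w v = middle w' v"
        using wood_form(3)[OF w(1) vB okv] wood_form(3)[OF w(2) vB okv] miss[OF vB] N m_def by auto
      with v show False by (simp add: C_def)
    qed
    then show "v + dvec (wood_directions w v) \<in> C" using uB vB by (simp add: C_def wood_directions_def m_def)
  qed
  ultimately have "C = {}"
    using wood_directions_escaping[OF w(1)] unfolding escaping_walks_def escaping_def by blast
  have mid: "middle w v = middle w' v" if "v \<in> B" for v
  proof (rule ccontr)
    assume "middle w v \<noteq> middle w' v"
    then have "v \<in> C" using that by (simp add: C_def)
    then show False using \<open>C = {}\<close> by simp
  qed
  show "w = w'"
  proof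
    fix x
    show "w x = w' x"
    proof (cases "x \<in> susp_darts M")
      case False
      then have "x \<notin> dom w" "x \<notin> dom w'" using wood_dom[OF w(1)] wood_dom[OF w(2)] by blast+
      then show ?thesis by (simp add: domIff)
    next
      case True
      show ?thesis
      proof (cases x)
        case (Half_Edge i)
        then show ?thesis using w unfolding wood_iff by simp
      next
        case (Dart d)
        obtain u y where d: "d = (u, y)" by fastforce
        have uy: "(u, y) \<in> darts M" using True Dart d by (auto simp: susp_darts_def)
        from dart_org[OF uy] show ?thesis unfolding verts_M
        proof (elim UnE imageE)
          fix v assume v: "u = gv v" "v \<in> B"
          then obtain m where m: "canonical v m" "y = N v m" using uy darts_gv by blast
          show ?thesis
            using wood_form(2)[OF w(1) v(2) m(1)] wood_form(2)[OF w(2) v(2) m(1)] miss[OF v(2)] mid[OF v(2)]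
            unfolding Dart d v m by simp
        next
          fix i assume i: "u = Special i"
          show ?thesis
          proof (cases y)
            case (Grid a b)
            then have "y = gv (int a, int b)" by simp
            then show ?thesis using outer_edges_and_spokes(3)[OF w(1)] outer_edges_and_spokes(3)[OF w(2)]
              unfolding Dart d i by metis
          next
            case (Special j)
            have "j \<noteq> i" using uy unfolding i Special darts_iff
              by (auto simp: aug_grid_edges_def doubleton_eq_iff)
            then have "j = i + 1 \<or> j = i - 1" using three_colors[of j i] by blast
            then show ?thesis
              using outer_edges_and_spokes(1,2)[OF w(1)] outer_edges_and_spokes(1,2)[OF w(2)]
              unfolding Dart d i Special by auto
          qed
        qed
      qed
    qed
  qed
qed

lemma finite_escaping_walks: "finite (escaping_walks k l)"
  by (rule finite_subset[of _ "B \<rightarrow>\<^sub>E UNIV"]) (auto simp: escaping_walks_def grid_box_def intro!: finite_PiE)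

lemma finite_woods: "finite woods"
  by (rule inj_on_finite[OF wood_directions_inj _ finite_escaping_walks]) (use wood_directions_escaping in blast)

lemma card_woods_upper: "card woods \<le> card (escaping_walks k l)"
  by (rule card_inj_on_le[OF wood_directions_inj _ finite_escaping_walks]) (use wood_directions_escaping in blast)

end

section \<open>From spanning trees to Schnyder woods\<close>

text \<open>
  A spanning tree \<open>\<delta>\<close> together with the labels that \<open>corner_labelling\<close> provides for it.
\<close>

locale corner_labelled_grid = augmented_grid +
  fixes \<delta> :: "int \<times> int \<Rightarrow> 4" and lab :: "int \<times> int \<Rightarrow> 4 \<Rightarrow> 3"
  assumes inside: "\<And>v. v \<in> grid_box k l \<Longrightarrow> v \<noteq> (int k, 1) \<Longrightarrow> v + dvec (\<delta> (v + v)) \<in> grid_box k l"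
    and at_corner: "\<delta> (2 * int k, 2) = 2"
    and lab_step: "\<And>v m. v \<in> grid_box k l \<Longrightarrow> lab v m = lab v (m - 1) + of_bool (m \<noteq> \<delta> (v + v))"
    and lab_left: "\<And>v m. v \<in> grid_box k l \<Longrightarrow> v + dvec m \<in> grid_box k l \<Longrightarrow>
       lab (v + dvec m) (m + 2) = lab v (m - 1) - of_bool (\<delta> (left_face v m) \<noteq> m + 1)"
    and unique: "\<And>v m. v \<in> grid_box k l \<Longrightarrow> v + dvec m \<in> grid_box k l \<Longrightarrow>
       \<exists>!n. \<delta> (v + v + dvec m + dvec n) = n + 2"
    and lab_top: "\<And>j. (1, j) \<in> grid_box k l \<Longrightarrow> lab (1, j) 0 = 0"
    and lab_right: "\<And>i. (i, int l) \<in> grid_box k l \<Longrightarrow> lab (i, int l) 0 = 0"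
    and lab_bottom: "\<And>j. (int k, j) \<in> grid_box k l \<Longrightarrow> lab (int k, j) 1 = 1"
    and lab_side: "\<And>i. (i, 1) \<in> grid_box k l \<Longrightarrow> lab (i, 1) 3 = 2"
begin

text \<open>
  The dart in direction \<open>m\<close> has the color \<open>lab v m + 1\<close>, unless \<open>v\<close> points in direction \<open>m\<close>.  At the
  bottom left vertex, which points in direction 2, this selects direction 3 for the dart to \<open>a\<^sub>3\<close>,
  so that the description by \<open>THE\<close> is unique there as well.
\<close>

definition wood :: "(grid_vertex \<times> grid_vertex) susp_dart \<rightharpoonup> 3" where
  "wood x = (case x of Half_Edge i \<Rightarrow> Some i | Dart (u, y) \<Rightarrow> (case u of
       Special i \<Rightarrow> if y = Special (i + 1) then Some (i + 1) else if y = Special (i - 1) then Some (i - 1) else None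
     | Grid a b \<Rightarrow> if (int a, int b) \<in> B \<and> (\<exists>m. m \<noteq> \<delta> ((int a, int b) + (int a, int b)) \<and> N (int a, int b) m = y)
         then Some (lab (int a, int b) (THE m. m \<noteq> \<delta> ((int a, int b) + (int a, int b)) \<and> N (int a, int b) m = y) + 1)
         else None))"

lemma delta_corner: "\<delta> (corner + corner) = 2"
  using at_corner by simp

lemma wood_Half_Edge: "wood (Half_Edge i) = Some i"
  by (simp add: wood_def)

lemma wood_Special:
  "wood (Dart (Special i, Special (i + 1))) = Some (i + 1)"
  "wood (Dart (Special i, Special (i - 1))) = Some (i - 1)"
  "wood (Dart (Special i, gv v)) = None"
  "wood (Dart (Special i, Special i)) = None"
  by (simp_all add: wood_def)

lemma wood_gv:
  assumes v: "v \<in> B" and ok: "canonical v m"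
  shows "wood (Dart (gv v, N v m)) = (if m = \<delta> (v + v) then None else Some (lab v m + 1))"
proof -
  obtain i j where ij: "v = (i, j)" by fastforce
  have gv: "gv v = Grid (nat i) (nat j)" "(int (nat i), int (nat j)) = v"
    using v by (auto simp: ij grid_box_def)
  have uniq: "m' = m" if "m' \<noteq> \<delta> (v + v)" "N v m' = N v m" for m'
    using that N_eq_iff[OF v, of m' m] ok delta_corner by (auto simp: canonical_def)
  have "(\<exists>m'. m' \<noteq> \<delta> (v + v) \<and> N v m' = N v m) \<longleftrightarrow> m \<noteq> \<delta> (v + v)"
    using uniq by blast
  moreover have "(THE m'. m' \<noteq> \<delta> (v + v) \<and> N v m' = N v m) = m" if "m \<noteq> \<delta> (v + v)"
    using that uniq by (intro the_equality) auto
  ultimately show ?thesis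
    unfolding wood_def gv(1) susp_dart.case prod.case grid_vertex.case gv(2) using v by simp
qed

lemma dom_wood: "dom wood \<subseteq> susp_darts M"
proof
  fix x assume x: "x \<in> dom wood"
  show "x \<in> susp_darts M"
  proof (cases x)
    case (Dart d)
    obtain u y where d: "d = (u, y)" by fastforce
    have "(u, y) \<in> darts M"
    proof (cases u)
      case (Grid a b)
      then obtain m where "(int a, int b) \<in> B" "N (int a, int b) m = y"
        using x unfolding Dart d by (auto simp: wood_def dom_def split: if_splits)
      then show ?thesis using N_dart[of "(int a, int b)" m] Grid by simp
    next
      case (Special i)
      then have "y = Special (i + 1) \<or> y = Special (i - 1)"
        using x unfolding Dart d by (auto simp: wood_def dom_def split: if_splits)
      moreover have "i \<noteq> i + 1" "i \<noteq> i - 1" by simp_all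
      ultimately show ?thesis unfolding darts_iff Special aug_grid_edges_def by blast
    qed
    then show ?thesis by (simp add: Dart d susp_darts_def)
  qed (simp add: susp_darts_def)
qed

text \<open>
  Each edge is claimed by only one of its two vertices and two faces.
\<close>

lemma edge_directions:
  assumes v: "v \<in> B" "v + dvec m \<in> B"
  shows "\<not> (\<delta> (v + v) = m \<and> \<delta> ((v + dvec m) + (v + dvec m)) = m + 2)"
    and "\<delta> (v + v) = m \<Longrightarrow> \<delta> (left_face v m) \<noteq> m + 1"
proof -
  obtain n where n: "\<And>n'. \<delta> (v + v + dvec m + dvec n') = n' + 2 \<longleftrightarrow> n' = n"
    using unique[OF v] by metis
  have ends: "v + v + dvec m + dvec (m + 2) = v + v" "v + v + dvec m + dvec m = (v + dvec m) + (v + dvec m)"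
    by (simp_all add: dvec_opposite algebra_simps)
  have "m + 2 + 2 = m" by (simp add: add.assoc)
  then have *: "\<delta> (v + v) = m \<longleftrightarrow> m + 2 = n" "\<delta> ((v + dvec m) + (v + dvec m)) = m + 2 \<longleftrightarrow> m = n"
    using n[of "m + 2"] n[of m] unfolding ends by metis+
  then show "\<not> (\<delta> (v + v) = m \<and> \<delta> ((v + dvec m) + (v + dvec m)) = m + 2)" by auto
  have "m - 1 + 2 = m + 1" "m - 1 \<noteq> m + 2" using exhaust_4[of m] by auto
  then show "\<delta> (left_face v m) \<noteq> m + 1" if "\<delta> (v + v) = m"
    using n[of "m - 1"] * that unfolding left_face_def by auto
qed

lemma wood_edge:
  assumes v: "v \<in> B" "v + dvec m \<in> B"
  shows "wood (Dart (gv v, gv (v + dvec m))) = (if m = \<delta> (v + v) then None else Some (lab v m + 1))"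
    and "wood (Dart (gv (v + dvec m), gv v)) =
      (if m + 2 = \<delta> ((v + dvec m) + (v + dvec m)) then None else Some (lab (v + dvec m) (m + 2) + 1))"
    and "m \<noteq> \<delta> (v + v) \<Longrightarrow> lab (v + dvec m) (m + 2) \<noteq> lab v m"
    and "m = \<delta> (v + v) \<Longrightarrow> lab (v + dvec m) (m + 2) = lab v m - 1"
proof -
  let ?u = "v + dvec m"
  have "canonical v m" "canonical ?u (m + 2)" using canonical_inside[OF v(2)] canonical_inside[of ?u "m + 2"] step_back v(1) by auto
  then show "wood (Dart (gv v, gv ?u)) = (if m = \<delta> (v + v) then None else Some (lab v m + 1))"
    "wood (Dart (gv ?u, gv v)) = (if m + 2 = \<delta> (?u + ?u) then None else Some (lab ?u (m + 2) + 1))"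
    using wood_gv[OF v(1)] wood_gv[OF v(2)] N_inside[OF v(2)] N_back[OF v] by metis+
  have left: "lab ?u (m + 2) = lab v (m - 1) - of_bool (\<delta> (left_face v m) \<noteq> m + 1)" by (rule lab_left[OF v])
  have step: "lab v m = lab v (m - 1) + of_bool (m \<noteq> \<delta> (v + v))" by (rule lab_step[OF v(1)])
  show "lab ?u (m + 2) \<noteq> lab v m" if "m \<noteq> \<delta> (v + v)"
    using left step that exhaust_3[of "lab v (m - 1)"] by auto
  show "lab ?u (m + 2) = lab v m - 1" if "m = \<delta> (v + v)"
    using left step that edge_directions(2)[OF v] by auto
qed

lemma wood_boundary:
  assumes v: "v \<in> B" "v + dvec m \<notin> B" and ok: "canonical v m"
  shows "wood (Dart (gv v, N v m)) = Some (side m)"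
proof -
  have ne: "m \<noteq> \<delta> (v + v)"
    using inside[OF v(1)] v(2) ok delta_corner by (cases "v = corner") (auto simp: canonical_def)
  obtain i j where ij: "v = (i, j)" by fastforce
  have e: "(3::3) = 0" "(1::3) + 1 + 1 = 0" by simp_all
  have "lab v m + 1 = side m"
    using exhaust_4[of m]
  proof (elim disjE)
    assume m: "m = 0"
    then have "i = 1" using v by (auto simp: ij grid_box_def)
    then show ?thesis using lab_top[of j] v(1) by (simp add: m ij)
  next
    assume m: "m = 1"
    then have "j = int l" using v by (auto simp: ij grid_box_def)
    then show ?thesis using lab_right[of i] v(1) lab_step[OF v(1), of 1] ne by (simp add: m ij)
  next
    assume m: "m = 2"
    then have "i = int k" using v by (auto simp: ij grid_box_def)
    then show ?thesis using lab_bottom[of j] v(1) lab_step[OF v(1), of 2] ne by (simp add: m ij)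
  next
    assume m: "m = 3"
    then have "j = 1" using v by (auto simp: ij grid_box_def)
    then show ?thesis using lab_side[of i] v(1) by (simp add: m ij)
  qed
  then show ?thesis using wood_gv[OF v(1) ok] ne by simp
qed

lemma wood_vertex_rule_gv:
  assumes v: "v \<in> B"
  shows "vertex_rule wood (gv v)"
  unfolding vertex_rule_gv[OF v]
proof (intro exI[of _ "\<delta> (v + v)"] exI[of _ "lab v (\<delta> (v + v))"] conjI allI impI)
  let ?a = "\<delta> (v + v)"
  show "?a = 2" if "v = corner" using that delta_corner by simp
  have out: "outcol ?a (lab v ?a) m = (if m = ?a then None else Some (lab v m + 1))" for m
  proof -
    have "lab v (?a + 1) = lab v ?a + 1" "lab v (?a + 2) = lab v ?a + 1 + 1" "lab v (?a + 3) = lab v ?a + 1 + 1 + 1"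
      using lab_step[OF v, of "?a + 1"] lab_step[OF v, of "?a + 2"] lab_step[OF v, of "?a + 3"]
      by (simp_all add: algebra_simps)
    moreover have "m = ?a \<or> m = ?a + 1 \<or> m = ?a + 2 \<or> m = ?a + 3"
      using exhaust_4[of m] exhaust_4[of ?a] by fastforce
    ultimately show ?thesis by (elim disjE) (simp_all add: outcol_def cyclic_3)
  qed
  show "wood (Dart (gv v, N v m)) = outcol ?a (lab v ?a) m" if "canonical v m" for m
    unfolding out using wood_gv[OF v that] .
  show "if m = ?a then i = lab v ?a else outcol ?a (lab v ?a) m \<noteq> Some i"
    if m: "canonical v m" and i: "wood (Dart (N v m, gv v)) = Some i" for m i
  proof (cases "v + dvec m \<in> B")
    case True
    have N: "N v m = gv (v + dvec m)" by (rule N_inside[OF True])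
    from i have i': "i = lab (v + dvec m) (m + 2) + 1"
      using wood_edge(2)[OF v True] unfolding N by (auto split: if_splits)
    show ?thesis
    proof (cases "m = ?a")
      case True
      then show ?thesis using wood_edge(4)[OF v \<open>v + dvec m \<in> B\<close> True] i' by simp
    next
      case False
      then show ?thesis using wood_edge(3)[OF v \<open>v + dvec m \<in> B\<close> False] i' unfolding out by simp
    qed
  next
    case False
    then show ?thesis using i wood_Special(3) by (simp add: N_outside)
  qed
qed

lemma special_darts:
  assumes "(Special i, y) \<in> darts M"
  obtains "y = Special (i + 1)" | "y = Special (i - 1)"
    | v m where "v \<in> B" "canonical v m" "v + dvec m \<notin> B" "y = gv v" "i = side m" "N v m = Special i"
proof (cases y)
  case (Special j)
  have "j \<noteq> i" using assms unfolding Special darts_iff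
    by (auto simp: aug_grid_edges_def doubleton_eq_iff)
  then show thesis using that(1,2) three_colors[of j i] Special by blast
next
  case (Grid a b)
  have d: "(y, Special i) \<in> darts M" using assms darts_swap by blast
  from dart_org[OF d] obtain v where v: "v \<in> B" "y = gv v" unfolding verts_M using Grid by auto
  with d obtain m where m: "canonical v m" "Special i = N v m" using darts_gv by blast
  then have "v + dvec m \<notin> B" using N_inside by fastforce
  then show thesis using that(3)[of v m] v m N_outside by simp
qed

lemma wood_vertex_rule_Special: "vertex_rule wood (Special i)"
proof (rule vertex_rule_SpecialI)
  fix y c assume d: "(Special i, y) \<in> darts M" and c: "wood (Dart (y, Special i)) = Some c"
  from d show "c = i"
  proof (cases rule: special_darts)
    case 1
    then show ?thesis using wood_Special(2)[of "i + 1"] c by simp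
  next
    case 2
    then show ?thesis using wood_Special(1)[of "i - 1"] c by simp
  next
    case (3 v m)
    then show ?thesis using wood_boundary[of v m] c by simp
  qed
qed (simp_all add: wood_Half_Edge wood_Special)

definition oriented_edge :: "grid_vertex \<Rightarrow> grid_vertex \<Rightarrow> bool" where
  "oriented_edge x y \<longleftrightarrow> (wood (Dart (x, y)) \<noteq> None \<or> wood (Dart (y, x)) \<noteq> None) \<and>
    (wood (Dart (x, y)) \<noteq> None \<and> wood (Dart (y, x)) \<noteq> None \<longrightarrow> wood (Dart (x, y)) \<noteq> wood (Dart (y, x)))"

lemma oriented_edge_sym: "oriented_edge x y \<Longrightarrow> oriented_edge y x"
  unfolding oriented_edge_def by metis

lemma oriented_edge_Special:
  assumes "(Special i, y) \<in> darts M"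
  shows "oriented_edge (Special i) y"
  using assms
proof (cases rule: special_darts)
  case 1
  then show ?thesis using wood_Special(1)[of i] wood_Special(2)[of "i + 1"] by (simp add: oriented_edge_def)
next
  case 2
  then show ?thesis using wood_Special(2)[of i] wood_Special(1)[of "i - 1"] by (simp add: oriented_edge_def)
next
  case (3 v m)
  then show ?thesis using wood_boundary[of v m] wood_Special(3)[of i v] by (simp add: oriented_edge_def)
qed

lemma oriented_edge_darts:
  assumes d: "(x, y) \<in> darts M"
  shows "oriented_edge x y"
proof (cases x)
  case (Special i)
  then show ?thesis using oriented_edge_Special d by simp
next
  case Grid
  from dart_org[OF d] obtain v where v: "v \<in> B" "x = gv v" unfolding verts_M using Grid by auto
  with d obtain m where m: "canonical v m" "y = N v m" using darts_gv by blast
  show ?thesis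
  proof (cases "v + dvec m \<in> B")
    case True
    then show ?thesis
      using wood_edge[OF v(1) True] edge_directions(1)[OF v(1) True] N_inside[OF True] v m
      by (auto simp: oriented_edge_def)
  next
    case False
    then have "(Special (side m), x) \<in> darts M" using d m N_outside darts_swap by metis
    from oriented_edge_sym[OF oriented_edge_Special[OF this]] show ?thesis using m N_outside[OF False] by simp
  qed
qed

abbreviation "succ \<equiv> face_succ M"

lemma succ_eq: "succ (u, y) = cw M (y, u)"
  by (simp add: face_succ_def org_rev)

lemma cw_pair: "cw M (u, y) = (u, cycle_of_list (aug_grid_nbrs k l u) y)"
  by (simp add: aug_grid_def)

lemma inj_succ: "inj succ"
proof (rule injI)
  fix d d' assume eq: "succ d = succ d'"
  obtain u y u' y' where d: "d = (u, y)" "d' = (u', y')" by (meson surj_pair)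
  have "inj (cycle_of_list (aug_grid_nbrs k l y))"
    by (rule permutes_inj[OF cycle_permutes])
  then show "d = d'" using eq unfolding d succ_eq cw_pair by (auto dest: injD)
qed

lemma succ_darts: "d \<in> darts M \<Longrightarrow> succ d \<in> darts M"
proof -
  assume d: "d \<in> darts M"
  obtain u y where uy: "d = (u, y)" by fastforce
  have yu: "(y, u) \<in> darts M" using d darts_swap unfolding uy by blast
  have y: "y \<in> verts M" by (rule dart_org[OF yu])
  have "u \<in> set (aug_grid_nbrs k l y)" using yu darts_from[OF y] by blast
  then have "cycle_of_list (aug_grid_nbrs k l y) u \<in> set (aug_grid_nbrs k l y)"
    by (simp only: permutes_in_image[OF cycle_permutes])
  then show "succ d \<in> darts M" unfolding uy succ_eq cw_pair darts_from[OF y] .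
qed

lemma succ_root: "succ (r i) = r (i + 1)"
proof -
  obtain xs where xs: "aug_grid_nbrs k l (Special (i + 1)) = Special (i + 1 + 1) # xs @ [Special (i + 1 - 1)]"
    using special_nbrs_ends[of "i + 1"] by metis
  let ?L = "aug_grid_nbrs k l (Special (i + 1))"
  have "cycle_of_list ?L (?L ! (length xs + 1)) = ?L ! (Suc (length xs + 1) mod length ?L)"
    by (rule cycle_of_list_nth[OF distinct_aug_grid_nbrs]) (simp add: xs del: aug_grid_nbrs.simps)
  then have "cycle_of_list ?L (Special i) = Special (i + 1 + 1)"
    unfolding xs by (simp add: nth_append)
  then show ?thesis unfolding aug_grid_root_def succ_eq cw_pair by simp
qed

lemma succ_backwards: "\<exists>v. succ (Special i, Special (i - 1)) = (Special (i - 1), gv v)"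
proof -
  obtain xs where xs: "aug_grid_nbrs k l (Special (i - 1)) = Special (i - 1 + 1) # xs @ [Special (i - 1 - 1)]"
    "xs \<noteq> []" "set xs \<subseteq> range (case_prod Grid)"
    using special_nbrs_ends[of "i - 1"] by metis
  let ?L = "aug_grid_nbrs k l (Special (i - 1))"
  obtain a b ys where ys: "xs = Grid a b # ys" using xs(2,3) by (cases xs) auto
  have "cycle_of_list ?L (?L ! 0) = ?L ! (Suc 0 mod length ?L)"
    by (rule cycle_of_list_nth[OF distinct_aug_grid_nbrs]) (simp add: xs del: aug_grid_nbrs.simps)
  then have "cycle_of_list ?L (Special i) = Grid a b"
    unfolding xs ys by simp
  then have "succ (Special i, Special (i - 1)) = (Special (i - 1), gv (int a, int b))"
    unfolding succ_eq cw_pair by simp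
  then show ?thesis by blast
qed

text \<open>
  The permutation of the darts is injective and rotates the three root darts, so an orbit that meets
  them consists of them.
\<close>

lemma outer_face:
  assumes "r i \<in> orbit succ d"
  shows "orbit succ d = orbit succ (r 1)"
proof -
  have "x \<in> range r \<Longrightarrow> d \<in> range r" if "x \<in> orbit succ d" for x
    using that
  proof (induction rule: orbit.induct)
    case base
    then obtain j where "succ d = succ (r (j - 1))" using succ_root[of "j - 1" for j] by auto
    then have "d = r (j - 1)" using inj_succ by (auto dest: injD)
    then show ?case by simp
  next
    case (step x)
    then obtain j where "succ x = succ (r (j - 1))" using succ_root[of "j - 1" for j] by auto
    then have "x = r (j - 1)" using inj_succ by (auto dest: injD)
    then show ?case using step by simp
  qed
  then have "d \<in> range r" using assms by blast
  moreover have orb: "orbit succ (r j) = range r" for j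
  proof (intro equalityI subsetI)
    fix x assume "x \<in> orbit succ (r j)"
    then show "x \<in> range r" by (induction rule: orbit.induct) (auto simp: succ_root)
  next
    fix x assume "x \<in> range r"
    then obtain m where m: "x = r m" by blast
    have "r (j + 1) \<in> orbit succ (r j)" using orbit.base[of succ "r j"] by (simp add: succ_root)
    moreover from orbit.step[OF this] have "r (j - 1) \<in> orbit succ (r j)" by (simp add: succ_root cyclic_3)
    moreover from orbit.step[OF this] have "r j \<in> orbit succ (r j)" by (simp add: succ_root)
    ultimately show "x \<in> orbit succ (r j)" unfolding m using three_colors[of m j] by blast
  qed
  ultimately show ?thesis by auto
qed

lemma succ_grid:
  assumes v: "v \<in> B" "v + dvec m \<in> B"
  shows "succ (gv v, gv (v + dvec m)) = (gv (v + dvec m), N (v + dvec m) (m - 1))"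
proof -
  let ?u = "v + dvec m"
  have ok: "canonical ?u (m + 2)" using canonical_inside[of ?u "m + 2"] step_back v(1) by auto
  have "m + 2 + 1 = m - 1" using exhaust_4[of m] by auto
  then show ?thesis using cw_gv[OF v(2) ok] unfolding succ_eq N_back[OF v] by (simp only:)
qed

text \<open>
  A dart along the triangle either belongs to the outer face or is followed by a dart from a special
  vertex to the grid, and every dart from the grid to a special vertex is followed by one that starts
  at a special vertex.  So a face as assumed here stays inside the grid, where each dart is followed
  by the one that turns left.
\<close>

lemma interior_face_grid:
  assumes F: "F \<in> interior_faces M r" and no: "\<And>i v. (Special i, gv v) \<notin> F"
  obtains v m where "v \<in> B" "v + dvec m \<in> B" "v + dvec m + dvec (m - 1) \<in> B"
    "v + dvec m + dvec (m - 1) + dvec (m - 2) \<in> B"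
    "(gv v, gv (v + dvec m)) \<in> F" "(gv (v + dvec m), gv (v + dvec m + dvec (m - 1))) \<in> F"
    "(gv (v + dvec m + dvec (m - 1)), gv (v + dvec m + dvec (m - 1) + dvec (m - 2))) \<in> F"
proof -
  obtain d0 where d0: "d0 \<in> darts M" "F = orbit succ d0" "F \<noteq> orbit succ (r 1)"
    using F by (auto simp: interior_faces_def faces_def)
  have closed: "succ d \<in> F" if "d \<in> F" for d
    using that unfolding d0(2) by (rule orbit.step)
  have in_darts: "d \<in> darts M" if "d \<in> F" for d
    using that unfolding d0(2) by (induction rule: orbit.induct) (auto intro: succ_darts d0(1))
  have no_root: "r i \<notin> F" for i using outer_face[of i d0] d0 by blast
  have no_special: "(Special i, y) \<notin> F" for i y
  proof
    assume y: "(Special i, y) \<in> F"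
    from in_darts[OF y] show False
    proof (cases rule: special_darts)
      case 1
      then show ?thesis using no_root[of i] y by (simp add: aug_grid_root_def)
    next
      case 2
      then show ?thesis using closed[OF y] succ_backwards[of i] no by metis
    next
      case (3 v m)
      then show ?thesis using no y by simp
    qed
  qed
  have grid: "v + dvec m \<in> B" if v: "v \<in> B" "(gv v, N v m) \<in> F" for v m
  proof (rule ccontr)
    assume "v + dvec m \<notin> B"
    then have "succ (gv v, N v m) = (Special (side m), snd (succ (gv v, N v m)))"
      by (simp add: N_outside succ_eq cw_pair)
    then show False using closed[OF v(2)] no_special by metis
  qed
  have next_dart: "v + dvec m + dvec (m - 1) \<in> B \<and> (gv (v + dvec m), gv (v + dvec m + dvec (m - 1))) \<in> F"
    if v: "v \<in> B" "v + dvec m \<in> B" "(gv v, gv (v + dvec m)) \<in> F" for v m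
  proof -
    have d: "(gv (v + dvec m), N (v + dvec m) (m - 1)) \<in> F"
      using closed[OF v(3)] succ_grid[OF v(1,2)] by simp
    from grid[OF v(2) d] d show ?thesis by (simp add: N_inside)
  qed
  have s: "succ d0 \<in> F" unfolding d0(2) by (rule orbit.base)
  obtain u y where uy: "succ d0 = (u, y)" by fastforce
  have "u \<in> verts M" using dart_org in_darts[OF s] uy by metis
  then obtain v where v: "v \<in> B" "u = gv v" using no_special s uy unfolding verts_M by auto
  then obtain m where m: "y = N v m" using in_darts[OF s] darts_gv uy by metis
  have v1: "v + dvec m \<in> B" using grid[OF v(1)] s uy v m by metis
  have d1: "(gv v, gv (v + dvec m)) \<in> F" using s uy v m N_inside[OF v1] by simp
  note n2 = next_dart[OF v(1) v1 d1]
  note n3 = next_dart[OF v1 conjunct1[OF n2] conjunct2[OF n2]]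
  have "m - 1 - 1 = m - 2" using exhaust_4[of m] by auto
  with n3 show thesis using that[OF v(1) v1] n2 d1 by simp
qed

lemma left_face_turn: "left_face (v + dvec m) (m - 1) = left_face v m"
proof -
  have "dvec (m - 1 - 1) = - dvec m" using exhaust_4[of m] by auto
  then show ?thesis by (simp add: left_face_def algebra_simps)
qed

text \<open>
  If the colors are constant around a face inside the grid, then so are the labels of its corners, and
  the face would have to point to each of its sides.  Each triangular face
  contains, in either sense of rotation, a dart from a special vertex to the grid, and these darts
  have no color.
\<close>

lemma wood_W4:
  assumes F: "F \<in> interior_faces M r"
  shows "\<not> (\<forall>d\<in>F. wood (Dart d) = Some i)" and "\<not> (\<forall>d\<in>F. wood (Dart (prod.swap d)) = Some i)"
proof -
  have m4: "m - 1 + 2 = m + (1::4)" "m - 2 + 2 = m" "m - 1 - 1 = m + 2" "m - 2 - 1 = m + 1" "m - 1 + 1 = m"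
    "m - 2 + 1 = m - 1" "m - 1 \<noteq> m" "m \<noteq> m + 1" for m
    using exhaust_4[of m] by auto
  show "\<not> (\<forall>d\<in>F. wood (Dart d) = Some i)"
  proof
    assume mono: "\<forall>d\<in>F. wood (Dart d) = Some i"
    have no: "(Special j, gv v) \<notin> F" for j v using mono wood_Special(3)[of j v] by auto
    from F no show False
    proof (rule interior_face_grid)
      fix v m
      let ?u = "v + dvec m" let ?t = "?u + dvec (m - 1)" let ?s = "?t + dvec (m - 2)"
      assume B: "v \<in> B" "?u \<in> B" "?t \<in> B" "?s \<in> B"
        and F: "(gv v, gv ?u) \<in> F" "(gv ?u, gv ?t) \<in> F" "(gv ?t, gv ?s) \<in> F"
      have c: "m \<noteq> \<delta> (v + v)" "lab v m + 1 = i" "m - 1 \<noteq> \<delta> (?u + ?u)" "lab ?u (m - 1) + 1 = i"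
        "m - 2 \<noteq> \<delta> (?t + ?t)" "lab ?t (m - 2) + 1 = i"
        using wood_edge(1)[OF B(1,2)] wood_edge(1)[OF B(2,3)] wood_edge(1)[OF B(3,4)] mono F
        by (auto split: if_splits)
      (* As the colors agree, so do the labels on the left side of these darts. *)
      have eq: "lab v m = lab ?u (m - 1)" "lab ?u (m - 1) = lab ?t (m - 2)" using c by (metis add_right_cancel)+
      have s: "lab v m = lab v (m - 1) + 1" "lab ?u (m - 1) = lab ?u (m + 2) + 1" "lab ?t (m - 2) = lab ?t (m + 1) + 1"
        using lab_step[OF B(1), of m] lab_step[OF B(2), of "m - 1"] lab_step[OF B(3), of "m - 2"] c(1,3,5)
        unfolding m4 by simp_all
      have "\<delta> (left_face v m) = m + 1"
        using lab_left[OF B(1,2)] eq s by (auto split: if_splits simp: of_bool_def)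
      moreover have "\<delta> (left_face ?u (m - 1)) = m"
        using lab_left[OF B(2,3)] eq s unfolding m4 by (auto split: if_splits simp: of_bool_def)
      ultimately show False using left_face_turn[of v m] m4(8)[of m] by simp
    qed
  qed
  show "\<not> (\<forall>d\<in>F. wood (Dart (prod.swap d)) = Some i)"
  proof
    assume mono: "\<forall>d\<in>F. wood (Dart (prod.swap d)) = Some i"
    have mono': "wood (Dart (y, x)) = Some i" if "(x, y) \<in> F" for x y
      using bspec[OF mono that] by simp
    have closed: "succ d \<in> F \<and> d \<in> darts M" if "d \<in> F" for d
    proof -
      obtain d0 where d0: "d0 \<in> darts M" "F = orbit succ d0"
        using F by (auto simp: interior_faces_def faces_def)
      have "d \<in> darts M" using that unfolding d0(2) by (induction rule: orbit.induct) (auto intro: succ_darts d0(1))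
      then show ?thesis using that unfolding d0(2) by (auto intro: orbit.step)
    qed
    have no_in: "(gv v, Special j) \<notin> F" for j v using mono'[of "gv v" "Special j"] wood_Special(3)[of j v] by auto
    have no: "(Special j, gv v) \<notin> F" for j v
    proof
      assume d: "(Special j, gv v) \<in> F"
      then have "(Special j, gv v) \<in> darts M" using closed by blast
      then show False
      proof (cases rule: special_darts)
        case (3 v' m)
        then have d': "(Special j, gv v') \<in> F" using d by simp
        have "succ (Special j, gv v') = (gv v', N v' (m + 1))"
          unfolding succ_eq using cw_gv[OF 3(1,2)] 3(6) by simp
        then have d1: "(gv v', N v' (m + 1)) \<in> F" using closed[OF d'] by simp
        show False
        proof (cases "v' + dvec (m + 1) \<in> B")
          case False
          then show ?thesis using d1 no_in by (simp add: N_outside)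
        next
          case True
          then have d2: "(gv v', gv (v' + dvec (m + 1))) \<in> F" using d1 by (simp add: N_inside)
          have "succ (gv v', gv (v' + dvec (m + 1))) = (gv (v' + dvec (m + 1)), N (v' + dvec (m + 1)) m)"
            using succ_grid[OF 3(1) True] by simp
          moreover have "v' + dvec (m + 1) + dvec m \<notin> B"
            using 3(1,3) True exhaust_4[of m] by (cases v') (auto simp: grid_box_def)
          ultimately show ?thesis using closed[OF d2] no_in by (simp add: N_outside)
        qed
      qed simp_all
    qed
    from F no show False
    proof (rule interior_face_grid)
      fix v m
      let ?u = "v + dvec m" let ?t = "?u + dvec (m - 1)" let ?s = "?t + dvec (m - 2)"
      assume B: "v \<in> B" "?u \<in> B" "?t \<in> B" "?s \<in> B"
        and F: "(gv v, gv ?u) \<in> F" "(gv ?u, gv ?t) \<in> F" "(gv ?t, gv ?s) \<in> F"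
      have "lab ?u (m + 2) + 1 = i" "lab ?t (m + 1) + 1 = i" "lab ?s m + 1 = i"
        using wood_edge(2)[OF B(1,2)] wood_edge(2)[OF B(2,3)] wood_edge(2)[OF B(3,4)]
          mono'[OF F(1)] mono'[OF F(2)] mono'[OF F(3)] unfolding m4 by (auto split: if_splits)
      then have eq: "lab ?t (m + 1) = lab ?u (m + 2)" "lab ?s m = lab ?t (m + 1)" by (metis add_right_cancel)+
      have "\<delta> (left_face ?u (m - 1)) = m"
        using lab_left[OF B(2,3)] eq unfolding m4 by (auto split: if_splits simp: of_bool_def)
      moreover have "\<delta> (left_face ?t (m - 2)) = m - 1"
        using lab_left[OF B(3,4)] eq unfolding m4 by (auto split: if_splits simp: of_bool_def)
      moreover have "left_face ?t (m - 2) = left_face ?u (m - 1)"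
        using left_face_turn[of ?u "m - 1"] m4 by (simp add: algebra_simps)
      ultimately show False using m4(7)[of m] by simp
    qed
  qed
qed

theorem wood_in_woods: "wood \<in> woods"
  unfolding wood_iff
proof (intro conjI ballI allI)
  show "dom wood \<subseteq> susp_darts M" by (rule dom_wood)
  show "wood (Half_Edge i) = Some i" for i by (rule wood_Half_Edge)
  show "vertex_rule wood v" if "v \<in> verts M" for v
    using that wood_vertex_rule_gv wood_vertex_rule_Special unfolding verts_M by auto
  show "\<not> (\<forall>d\<in>F. wood (Dart d) = Some i)" "\<not> (\<forall>d\<in>F. wood (Dart (prod.swap d)) = Some i)"
    if "F \<in> interior_faces M r" for F i using wood_W4[OF that] by auto
  fix d assume d: "d \<in> darts M"
  obtain x y where "d = (x, y)" by fastforce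
  then show "wood (Dart d) \<noteq> None \<or> wood (Dart (prod.swap d)) \<noteq> None"
    "wood (Dart d) \<noteq> None \<and> wood (Dart (prod.swap d)) \<noteq> None \<longrightarrow> wood (Dart d) \<noteq> wood (Dart (prod.swap d))"
    using oriented_edge_darts[of x y] d unfolding oriented_edge_def by simp_all
qed

end

text \<open>
  The inner points keep the directions of \<open>d\<close>.  The outermost ring is made to lead to the bottom left
  vertex: the left and the right side downwards, the top and the bottom side to the left.
\<close>

definition tree_step :: "nat \<Rightarrow> nat \<Rightarrow> (int \<times> int \<Rightarrow> 4) \<Rightarrow> int \<times> int \<Rightarrow> 4" where
  "tree_step k l d v = (if snd v = 1 then 2 else if fst v = 1 then 3 else if fst v = int k then 3
     else if snd v = int l then 2 else d (fst v - 1, snd v - 1))"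

lemma tree_step_pair: "tree_step k l d (i, j) = (if j = 1 then 2 else if i = 1 \<or> i = int k then 3
    else if j = int l then 2 else d (i - 1, j - 1))"
  by (simp add: tree_step_def)

context augmented_grid begin

lemma tree_step_inside:
  assumes "v \<in> B" "v \<noteq> corner"
  shows "v + dvec (tree_step k l d v) \<in> B"
proof -
  obtain i j where ij: "v = (i, j)" by fastforce
  show ?thesis using assms exhaust_4[of "d (i - 1, j - 1)"]
    by (auto simp: ij tree_step_pair grid_box_def)
qed

lemma tree_step_escaping:
  assumes d: "d \<in> escaping_walks (k - 2) (l - 2)" and C: "C \<subseteq> B" "corner \<notin> C"
    and inv: "(\<lambda>v. v + dvec (tree_step k l d v)) ` C \<subseteq> C"
  shows "C = {}"
proof -
  have step: "v + dvec (tree_step k l d v) \<in> C" if "v \<in> C" for v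
    using inv that by blast
  have left: "(int k - int n, 1) \<notin> C" for n
  proof (induction n)
    case 0
    then show ?case using C(2) by simp
  next
    case (Suc n)
    then show ?case using step[of "(int k - int (Suc n), 1)"] by (auto simp: tree_step_pair)
  qed
  have left': "(i, 1) \<notin> C" for i
  proof
    assume c: "(i, 1) \<in> C"
    then have "i \<le> int k" using C(1) by (auto simp: grid_box_def)
    then show False using left[of "nat (int k - i)"] c by simp
  qed
  have horizontal: "(i, 1 + int n) \<notin> C" if i: "i = 1 \<or> i = int k" for i n
  proof (induction n)
    case 0
    then show ?case using left' by simp
  next
    case (Suc n)
    then show ?case using step[of "(i, 1 + int (Suc n))"] i by (auto simp: tree_step_pair)
  qed
  have horizontal': "(i, j) \<notin> C" if "i = 1 \<or> i = int k" for i j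
  proof
    assume c: "(i, j) \<in> C"
    then have "1 \<le> j" using C(1) by (auto simp: grid_box_def)
    then show False using horizontal[OF that, of "nat (j - 1)"] c by simp
  qed
  have right: "(int k - int n, int l) \<notin> C" for n
  proof (induction n)
    case 0
    then show ?case using horizontal' by simp
  next
    case (Suc n)
    then show ?case using step[of "(int k - int (Suc n), int l)"] horizontal' left' kl
      by (cases "int k - int (Suc n) = 1") (auto simp: tree_step_pair)
  qed
  have right': "(i, int l) \<notin> C" for i
  proof
    assume c: "(i, int l) \<in> C"
    then have "i \<le> int k" using C(1) by (auto simp: grid_box_def)
    then show False using right[of "nat (int k - i)"] c by simp
  qed
  have inner: "i \<noteq> 1 \<and> i \<noteq> int k \<and> j \<noteq> 1 \<and> j \<noteq> int l" if "(i, j) \<in> C" for i j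
    using that left' horizontal' right' by blast
  define C' where "C' = (\<lambda>v. v - (1, 1)) ` C"
  have "C' \<subseteq> grid_box (k - 2) (l - 2)"
    using C(1) inner kl by (fastforce simp: C'_def grid_box_def)
  moreover have "(\<lambda>v. v + dvec (d v)) ` C' \<subseteq> C'"
  proof (rule image_subsetI)
    fix u assume "u \<in> C'"
    then obtain v where v: "v \<in> C" "u = v - (1, 1)" by (auto simp: C'_def)
    obtain i j where ij: "v = (i, j)" by fastforce
    have "tree_step k l d v = d u" using inner[of i j] v by (simp add: ij tree_step_pair)
    then have "v + dvec (d u) \<in> C" using step[OF v(1)] by simp
    moreover have "u + dvec (d u) = v + dvec (d u) - (1, 1)" by (simp add: v(2))
    ultimately show "u + dvec (d u) \<in> C'" unfolding C'_def by (metis imageI)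
  qed
  ultimately have "C' = {}" using d unfolding escaping_walks_def escaping_def by blast
  then show ?thesis by (simp add: C'_def)
qed

text \<open>
  The wood remembers the walk, since the inner points have their missing edges in the directions of
  the walk.
\<close>

lemma wood_from_walk:
  assumes d: "d \<in> escaping_walks (k - 2) (l - 2)"
  shows "\<exists>w\<in>woods. \<forall>v\<in>B. v \<noteq> corner \<longrightarrow> (\<forall>m. w (Dart (gv v, N v m)) = None \<longleftrightarrow> m = tree_step k l d v)"
proof -
  define a where "a p = tree_step k l d (fst p div 2, snd p div 2)" for p
  have a: "a (v + v) = tree_step k l d v" for v by (cases v) (simp add: a_def)
  have cellI: "v + v \<in> cells k l \<and> even (fst (v + v))" if "v \<in> B" "v \<noteq> corner" for v
    using that by (cases v) (auto simp: cells_def rect_def grid_box_def)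
  have inrect: "p + dvec (a p) \<in> rect k l" if p: "p \<in> cells k l" "even (fst p)" for p
  proof -
    obtain v where v: "v \<in> B" "v \<noteq> corner" "p = v + v" by (rule even_cells[OF p])
    obtain i j where ij: "v = (i, j)" by fastforce
    show ?thesis using tree_step_inside[OF v(1,2), of d] v(1) exhaust_4[of "tree_step k l d v"]
      unfolding v(3) a by (auto simp: ij rect_def grid_box_def)
  qed
  have esc: "escaping {p \<in> cells k l. even (fst p)} (hop a)"
    unfolding escaping_def
  proof (intro allI impI)
    fix C assume C: "C \<subseteq> {p \<in> cells k l. even (fst p)}" "hop a ` C \<subseteq> C"
    define C' where "C' = {v. v + v \<in> C}"
    have dbl: "v + v \<in> C \<Longrightarrow> v \<in> B \<and> v \<noteq> corner" for v
      using C(1) by (cases v) (auto simp: cells_def rect_def grid_box_def)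
    have "(\<lambda>v. v + dvec (tree_step k l d v)) ` C' \<subseteq> C'"
    proof (rule image_subsetI)
      fix v assume "v \<in> C'"
      then have "hop a (v + v) \<in> C" using C(2) by (auto simp: C'_def)
      then show "v + dvec (tree_step k l d v) \<in> C'" unfolding hop_def a C'_def by (simp add: algebra_simps)
    qed
    moreover have "C' \<subseteq> B" "corner \<notin> C'" using dbl dbl[of corner] unfolding C'_def by blast+
    ultimately have "C' = {}" using tree_step_escaping[OF d] by blast
    show "C = {}"
    proof (rule ccontr)
      assume "C \<noteq> {}"
      then obtain p where p: "p \<in> C" by blast
      then obtain v where "p = v + v" using even_cells C(1) by blast
      then have "v \<in> C'" using p by (simp add: C'_def)
      then show False using \<open>C' = {}\<close> by simp
    qed
  qed
  have kl1: "1 \<le> k" "1 \<le> l" using kl by auto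
  obtain \<delta>\<^sub>0 where \<delta>\<^sub>0: "\<And>p. p \<in> cells k l \<Longrightarrow> even (fst p) \<Longrightarrow> \<delta>\<^sub>0 p = a p"
    "inj_on (\<lambda>p. p + dvec (\<delta>\<^sub>0 p)) (cells k l)"
    "(\<lambda>p. p + dvec (\<delta>\<^sub>0 p)) ` cells k l = {e \<in> rect k l. odd (fst e + snd e)}"
    by (rule dual_orientation[OF kl1 inrect esc]; blast)
  show ?thesis
  proof (rule corner_labelling[OF kl1 \<delta>\<^sub>0(2,3)])
    fix \<delta> and lab :: "int \<times> int \<Rightarrow> 4 \<Rightarrow> 3"
    assume \<delta>: "\<And>p. p \<in> cells k l \<Longrightarrow> \<delta> p = \<delta>\<^sub>0 p" "\<delta> (2 * int k, 2) = 2"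
    assume lab: "\<And>v m. v \<in> B \<Longrightarrow> lab v m = lab v (m - 1) + of_bool (m \<noteq> \<delta> (v + v))"
      "\<And>v m. v \<in> B \<Longrightarrow> v + dvec m \<in> B \<Longrightarrow>
         lab (v + dvec m) (m + 2) = lab v (m - 1) - of_bool (\<delta> (left_face v m) \<noteq> m + 1)"
      "\<And>v m. v \<in> B \<Longrightarrow> v + dvec m \<in> B \<Longrightarrow> \<exists>!n. \<delta> (v + v + dvec m + dvec n) = n + 2"
      "\<And>j. (1, j) \<in> B \<Longrightarrow> lab (1, j) 0 = 0" "\<And>i. (i, int l) \<in> B \<Longrightarrow> lab (i, int l) 0 = 0"
      "\<And>j. (int k, j) \<in> B \<Longrightarrow> lab (int k, j) 1 = 1" "\<And>i. (i, 1) \<in> B \<Longrightarrow> lab (i, 1) 3 = 2"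
    have \<delta>v: "\<delta> (v + v) = tree_step k l d v" if "v \<in> B" "v \<noteq> corner" for v
      using cellI[OF that] \<delta>(1) \<delta>\<^sub>0(1) a by metis
    interpret corner_labelled_grid k l \<delta> lab
    proof unfold_locales
      show "v + dvec (\<delta> (v + v)) \<in> B" if "v \<in> B" "v \<noteq> corner" for v
        unfolding \<delta>v[OF that] by (rule tree_step_inside[OF that])
    qed (fact \<delta>(2) lab)+
    have "wood (Dart (gv v, N v m)) = None \<longleftrightarrow> m = tree_step k l d v" if "v \<in> B" "v \<noteq> corner" for v m
      using wood_gv[OF that(1), of m] that \<delta>v by (simp add: canonical_def)
    then have "\<forall>v\<in>B. v \<noteq> corner \<longrightarrow> (\<forall>m. wood (Dart (gv v, N v m)) = None \<longleftrightarrow> m = tree_step k l d v)"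
      by simp
    then show ?thesis using wood_in_woods by (rule bexI)
  qed
qed

lemma card_woods_lower: "card (escaping_walks (k - 2) (l - 2)) \<le> card woods"
proof -
  obtain f where f: "\<And>d. d \<in> escaping_walks (k - 2) (l - 2) \<Longrightarrow> f d \<in> woods \<and>
      (\<forall>v\<in>B. v \<noteq> corner \<longrightarrow> (\<forall>m. f d (Dart (gv v, N v m)) = None \<longleftrightarrow> m = tree_step k l d v))"
    using wood_from_walk by metis
  have "inj_on f (escaping_walks (k - 2) (l - 2))"
  proof (rule inj_onI)
    fix d d' assume d: "d \<in> escaping_walks (k - 2) (l - 2)" "d' \<in> escaping_walks (k - 2) (l - 2)" and eq: "f d = f d'"
    have "d u = d' u" if u: "u \<in> grid_box (k - 2) (l - 2)" for u
    proof -
      obtain i j where ij: "u = (i, j)" by fastforce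
      let ?v = "(i + 1, j + 1)"
      have v: "?v \<in> B" "?v \<noteq> corner" using u by (auto simp: ij grid_box_def)
      have "tree_step k l d ?v = tree_step k l d' ?v"
        using f[OF d(1)] f[OF d(2)] v eq by metis
      moreover have "i + 1 \<noteq> 1" "j + 1 \<noteq> 1" "i + 1 \<noteq> int k" "j + 1 \<noteq> int l"
        using u kl by (auto simp: ij grid_box_def)
      ultimately show ?thesis by (simp add: ij tree_step_pair)
    qed
    then show "d = d'" using d unfolding escaping_walks_def by (intro PiE_ext[of d "grid_box (k - 2) (l - 2)" "\<lambda>_. UNIV"]) auto
  qed
  then show ?thesis by (rule card_inj_on_le) (use f finite_woods in auto)
qed

end

section \<open>The growth rate\<close>

theorem theorem8:
  shows "\<exists>L::real.
    ((\<lambda>(k, l). real (card (schnyder_woods (aug_grid k l) aug_grid_root)) powr (1 / real (k * l)))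
       \<longlongrightarrow> L) (sequentially \<times>\<^sub>F sequentially) \<and>
    3.209 \<le> L \<and> L < 3.210"
proof (intro exI[of _ schnyder_growth_rate] conjI schnyder_growth_rate_bounds sandwich_growth_rate)
  fix k l :: nat assume kl: "3 \<le> k" "3 \<le> l"
  interpret augmented_grid k l by unfold_locales (use kl in auto)
  show "laplacian_product (k - 2) (l - 2) \<le> real (card (schnyder_woods (aug_grid k l) aug_grid_root))"
    using card_woods_lower unfolding card_escaping_walks[symmetric] by simp
  show "real (card (schnyder_woods (aug_grid k l) aug_grid_root)) \<le> laplacian_product k l"
    using card_woods_upper unfolding card_escaping_walks[symmetric] by simp
qed

end
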